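(* Let $G$ be a topological group. If $G$ is Fubini and $X$ is a cofinally seminorm respecting $G$-flow, then $X$ is Fubini.
   Context: All groups and spaces are Hausdorff. $G$ is a topological group with identity $e_G$. A $G$-space is a topological space with a continuous left $G$-action; a $G$-flow is a compact $G$-space. For a $G$-space $X$, $\mathrm{C}(X)$ is the algebra of bounded continuous functions $X\to\mathbb{C}$ with the sup norm, and $(pg)(x)=p(gx)$. $\mathrm{C}_G(X)$ is the closed subalgebra of those $p$ for which $g\mapsto pg$ is norm continuous, and $\alpha_G(X)$ is the Gelfand space of $\mathrm{C}_G(X)$, a $G$-flow and the maximal $G$-equivariant compactification of $X$. The Samuel compactification is $\mathrm{Sa}(G):=\alpha_G(G)$, with $G$ acting on itself by left multiplication. If $\langle X_i:i\in I\rangle$ are $G$-flows, $\bigsqcup_i X_i$ embeds in $\alpha_G(\bigsqcup_i X_i)$; the map $\pi_I\colon\bigsqcup_i X_i\to\beta I$ (trivial action on $\beta I$) sending $X_i$ to $i$ extends continuously to $\alpha_G(\bigsqcup_i X_i)$, and for an infinite set $I$ and $\mathcal{U}\in\beta I$ the ultracoproduct is the $G$-flow $\Sigma^G_{\mathcal{U}}X_i:=\pi_I^{-1}(\{\mathcal{U}\})$ (an ultracopower $\Sigma_{\mathcal U}^GX$ when all $X_i=X$). For ultrafilters $\mathcal{U}\in\beta I$, $\mathcal{V}\in\beta J$, $\mathcal{U}\otimes\mathcal{V}\in\beta(I\times J)$ is defined by $A\in\mathcal{U}\otimes\mathcal{V}$ iff $\{i:\{j:(i,j)\in A\}\in\mathcal{V}\}\in\mathcal{U}$.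 For a $G$-flow $X$, for each $i\in I$ we have $\{i\}\times\Sigma^G_{\mathcal{V}}X\subseteq \alpha_G(\{i\}\times J\times X)\subseteq\alpha_G(I\times J\times X)$; the union of these inclusions over $i\in I$ extends continuously to a $G$-map $\psi\colon\alpha_G(I\times\Sigma^G_{\mathcal{V}}X)\to\alpha_G(I\times J\times X)$, with $\psi[\Sigma^G_{\mathcal{U}}\Sigma^G_{\mathcal{V}}X]=\Sigma^G_{\mathcal{U}\otimes\mathcal{V}}X$. The restriction $\psi\colon\Sigma^G_{\mathcal{U}}\Sigma^G_{\mathcal{V}}X\to\Sigma^G_{\mathcal{U}\otimes\mathcal{V}}X$ is the canonical factor map. $X$ is Fubini if for all infinite sets $I,J$ and all $\mathcal{U}\in\beta I$, $\mathcal{V}\in\beta J$ this canonical factor map is an isomorphism. The group $G$ is Fubini if $\mathrm{Sa}(G)$ is a Fubini $G$-flow. A semi-norm on $G$ is a bounded continuous $\sigma\colon G\to\mathbb{R}^{\ge0}$ with $\sigma(e_G)=0$, $\sigma(g^{-1})=\sigma(g)$ and $\sigma(gh)\le\sigma(g)+\sigma(h)$. $\mathrm{SN}^1(G)$ is the set of semi-norms bounded by $1$, ordered pointwise. $\mathrm{B}_\sigma(c)=\{g:\sigma(g)<c\}$. For a $G$-flow $X$ and $\sigma\in\mathrm{SN}^1(G)$: - $\partial_\sigma\colon X\times X\to[0,1]$ is defined by: for $0\le c<1$, $\partial_\sigma(x,y)\le c$ iff for all open $A\ni x$, open $B\ni y$ and $\epsilon>0$, $\mathrm{B}_\sigma(c+\epsilon)\cdot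 A\cap B\ne\emptyset$ (and $\partial_\sigma(x,y)=1$ if this holds for no $c<1$). - $\rho_\sigma(x,y)=\sup|f(x)-f(y)|$, the supremum over continuous $f\colon X\to[0,1]$ which are $\sigma$-orbit-Lipschitz, i.e. $\|fg-f\|\le\sigma(g)$ for all $g\in G$. $X$ is cofinally seminorm respecting if there is an upwards cofinal $S\subseteq\mathrm{SN}^1(G)$ such that $\rho_\sigma=\partial_\sigma$ for every $\sigma\in S$. *)

theory Defs
  imports "HOL-Analysis.Analysis"
begin

section \<open>$G$-spaces\<close>

text \<open>
  The group is a type of class \<^class>\<open>topological_group_add\<close>; despite the additive notation it need
  not be commutative. The point set of a $G$-space is the \<^const>\<open>topspace\<close> of its topology, and the
  values of the action outside that set are irrelevant.
\<close>

record ('g, 'x) gspace =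
  space_of :: "'x topology"
  act :: "'g \<Rightarrow> 'x \<Rightarrow> 'x"

abbreviation points :: "('g, 'x) gspace \<Rightarrow> 'x set"
  where "points X \<equiv> topspace (space_of X)"

definition G_space :: "('g::{topological_group_add, t2_space}, 'x) gspace \<Rightarrow> bool"
  where "G_space X \<longleftrightarrow>
    Hausdorff_space (space_of X) \<and>
    continuous_map (prod_topology euclidean (space_of X)) (space_of X) (\<lambda>(g, x). act X g x) \<and>
    (\<forall>x\<in>points X. act X 0 x = x) \<and>
    (\<forall>g h. \<forall>x\<in>points X. act X (g + h) x = act X g (act X h x))"

definition G_flow :: "('g::{topological_group_add, t2_space}, 'x) gspace \<Rightarrow> bool"
  where "G_flow X \<longleftrightarrow> G_space X \<and> compact_space (space_of X)"

definition flow_isomorphism ::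
    "('g, 'x) gspace \<Rightarrow> ('g, 'y) gspace \<Rightarrow> ('x \<Rightarrow> 'y) \<Rightarrow> bool"
  where "flow_isomorphism X Y f \<longleftrightarrow>
    homeomorphic_map (space_of X) (space_of Y) f \<and>
    (\<forall>g. \<forall>x\<in>points X. f (act X g x) = act Y g (f x))"

section \<open>Function algebras and the maximal equivariant compactification\<close>

text \<open>
  A function on the points of \<open>X\<close> is represented by the function on the whole type that vanishes
  outside \<open>points X\<close>. Sums, products and scalar multiples are then pointwise, and the unit of the
  algebra is the indicator function of \<open>points X\<close>.
\<close>

definition on_points :: "('g, 'x) gspace \<Rightarrow> ('x \<Rightarrow> 'a::zero) \<Rightarrow> 'x \<Rightarrow> 'a"
  where "on_points X p = (\<lambda>x. if x \<in> points X then p x else 0)"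

text \<open>The translate $pg$.\<close>

definition translate :: "('g, 'x) gspace \<Rightarrow> ('x \<Rightarrow> 'a::zero) \<Rightarrow> 'g \<Rightarrow> 'x \<Rightarrow> 'a"
  where "translate X p g = on_points X (\<lambda>x. p (act X g x))"

text \<open>Inserting \<open>0\<close> only matters for the empty space, as \<open>Sup {}\<close> is unspecified on the reals.\<close>

definition supnorm :: "('g, 'x) gspace \<Rightarrow> ('x \<Rightarrow> 'a::real_normed_vector) \<Rightarrow> real"
  where "supnorm X p = Sup (insert 0 ((\<lambda>x. norm (p x)) ` points X))"

definition C_bdd :: "('g, 'x) gspace \<Rightarrow> ('x \<Rightarrow> complex) set"
  where "C_bdd X = {p. continuous_map (space_of X) euclidean p \<and> bounded (p ` points X) \<and>
                       (\<forall>x. x \<notin> points X \<longrightarrow> p x = 0)}"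

definition C_G :: "('g::{topological_group_add, t2_space}, 'x) gspace \<Rightarrow> ('x \<Rightarrow> complex) set"
  where "C_G X = {p \<in> C_bdd X.
    \<forall>h. ((\<lambda>g. supnorm X (\<lambda>x. translate X p g x - translate X p h x)) \<longlongrightarrow> 0) (at h)}"

definition characters ::
    "('g::{topological_group_add, t2_space}, 'x) gspace \<Rightarrow> (('x \<Rightarrow> complex) \<Rightarrow> complex) set"
  where "characters X = {\<phi> \<in> extensional (C_G X).
    (\<forall>p\<in>C_G X. \<forall>q\<in>C_G X. \<phi> (\<lambda>x. p x + q x) = \<phi> p + \<phi> q) \<and>
    (\<forall>c. \<forall>p\<in>C_G X. \<phi> (\<lambda>x. c * p x) = c * \<phi> p) \<and>
    (\<forall>p\<in>C_G X. \<forall>q\<in>C_G X. \<phi> (\<lambda>x. p x * q x) = \<phi> p * \<phi> q) \<and>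
    \<phi> (on_points X (\<lambda>_. 1)) = 1}"

text \<open>
  The Gelfand space with its weak-* topology, i.e. that of pointwise convergence on \<open>C_G X\<close>, and
  with the action $(g\varphi)(p) = \varphi(pg)$.
\<close>

definition alpha :: "('g::{topological_group_add, t2_space}, 'x) gspace
      \<Rightarrow> ('g, ('x \<Rightarrow> complex) \<Rightarrow> complex) gspace"
  where "alpha X =
    \<lparr>space_of = subtopology (product_topology (\<lambda>_. euclidean) (C_G X)) (characters X),
     act = (\<lambda>g \<phi>. \<lambda>p\<in>C_G X. \<phi> (translate X p g))\<rparr>"

text \<open>The canonical map from \<open>X\<close> to its compactification: evaluation at a point.\<close>

definition alpha_unit :: "('g::{topological_group_add, t2_space}, 'x) gspace
      \<Rightarrow> 'x \<Rightarrow> ('x \<Rightarrow> complex) \<Rightarrow> complex"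
  where "alpha_unit X x = (\<lambda>p\<in>C_G X. p x)"

text \<open>
  The continuous extension of \<open>f\<close> to the compactification, for a compact Hausdorff target \<open>K\<close>. It is
  unique, as the image of \<open>alpha_unit X\<close> is dense.
\<close>

definition alpha_extend :: "('g::{topological_group_add, t2_space}, 'x) gspace
      \<Rightarrow> 'k topology \<Rightarrow> ('x \<Rightarrow> 'k) \<Rightarrow> (('x \<Rightarrow> complex) \<Rightarrow> complex) \<Rightarrow> 'k"
  where "alpha_extend X K f =
    (THE h. h \<in> extensional (points (alpha X)) \<and>
            continuous_map (space_of (alpha X)) K h \<and>
            (\<forall>x\<in>points X. h (alpha_unit X x) = f x))"

text \<open>The map of compactifications induced by a continuous equivariant map \<open>f\<close> from \<open>X\<close> to \<open>Y\<close>.\<close>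

definition alpha_map :: "('g::{topological_group_add, t2_space}, 'x) gspace \<Rightarrow> ('g, 'y) gspace
      \<Rightarrow> ('x \<Rightarrow> 'y) \<Rightarrow> (('x \<Rightarrow> complex) \<Rightarrow> complex) \<Rightarrow> ('y \<Rightarrow> complex) \<Rightarrow> complex"
  where "alpha_map X Y f \<phi> = (\<lambda>p\<in>C_G Y. \<phi> (on_points X (\<lambda>x. p (f x))))"

definition translation_space :: "('g::{topological_group_add, t2_space}, 'g) gspace"
  where "translation_space = \<lparr>space_of = euclidean, act = (+)\<rparr>"

definition Samuel :: "('g::{topological_group_add, t2_space}, ('g \<Rightarrow> complex) \<Rightarrow> complex) gspace"
  where "Samuel = alpha translation_space"

section \<open>Ultrafilters\<close>

text \<open>An ultrafilter on the set \<open>I\<close> is an ultrafilter on the type that contains \<open>I\<close>.\<close>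

definition ultrafilters_on :: "'i set \<Rightarrow> 'i filter set"
  where "ultrafilters_on I = {\<U>. \<U> \<noteq> bot \<and> eventually (\<lambda>i. i \<in> I) \<U> \<and>
    (\<forall>P. eventually P \<U> \<or> eventually (\<lambda>i. \<not> P i) \<U>)}"

definition beta :: "'i set \<Rightarrow> 'i filter topology"
  where "beta I =
    topology_generated_by {{\<U> \<in> ultrafilters_on I. eventually (\<lambda>i. i \<in> A) \<U>} | A. A \<subseteq> I}"

definition tensor :: "'i filter \<Rightarrow> 'j filter \<Rightarrow> ('i \<times> 'j) filter"  (infixr "\<otimes>\<^sub>F" 70)
  where "\<U> \<otimes>\<^sub>F \<V> = Abs_filter (\<lambda>P. eventually (\<lambda>i. eventually (\<lambda>j. P (i, j)) \<V>) \<U>)"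

lemma eventually_tensor:
  "eventually P (\<U> \<otimes>\<^sub>F \<V>) \<longleftrightarrow> eventually (\<lambda>i. eventually (\<lambda>j. P (i, j)) \<V>) \<U>"
  unfolding tensor_def
proof (rule eventually_Abs_filter, rule is_filter.intro)
  fix P Q :: "'a \<times> 'b \<Rightarrow> bool"
  assume "eventually (\<lambda>i. eventually (\<lambda>j. P (i, j)) \<V>) \<U>"
    and "eventually (\<lambda>i. eventually (\<lambda>j. Q (i, j)) \<V>) \<U>"
  then show "eventually (\<lambda>i. eventually (\<lambda>j. P (i, j) \<and> Q (i, j)) \<V>) \<U>"
    by eventually_elim (rule eventually_conj)
next
  fix P Q :: "'a \<times> 'b \<Rightarrow> bool"
  assume PQ: "\<forall>x. P x \<longrightarrow> Q x" and "eventually (\<lambda>i. eventually (\<lambda>j. P (i, j)) \<V>) \<U>"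
  then show "eventually (\<lambda>i. eventually (\<lambda>j. Q (i, j)) \<V>) \<U>"
    by (auto elim!: eventually_mono)
qed simp

section \<open>Ultracoproducts\<close>

definition sum_gspace :: "'i set \<Rightarrow> ('i \<Rightarrow> ('g, 'x) gspace) \<Rightarrow> ('g, 'i \<times> 'x) gspace"
  where "sum_gspace I X =
    \<lparr>space_of = sum_topology (\<lambda>i. space_of (X i)) I, act = (\<lambda>g (i, x). (i, act (X i) g x))\<rparr>"

text \<open>The continuous extension of the map that sends each \<open>X i\<close> to the principal ultrafilter at \<open>i\<close>.\<close>

definition pi_index :: "'i set \<Rightarrow> ('i \<Rightarrow> ('g::{topological_group_add, t2_space}, 'x) gspace)
      \<Rightarrow> (('i \<times> 'x \<Rightarrow> complex) \<Rightarrow> complex) \<Rightarrow> 'i filter"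
  where "pi_index I X = alpha_extend (sum_gspace I X) (beta I) (\<lambda>(i, x). principal {i})"

definition ultracoproduct :: "'i set \<Rightarrow> 'i filter
      \<Rightarrow> ('i \<Rightarrow> ('g::{topological_group_add, t2_space}, 'x) gspace)
      \<Rightarrow> ('g, ('i \<times> 'x \<Rightarrow> complex) \<Rightarrow> complex) gspace"
  where "ultracoproduct I \<U> X =
    \<lparr>space_of = subtopology (space_of (alpha (sum_gspace I X)))
                  {\<phi> \<in> points (alpha (sum_gspace I X)). pi_index I X \<phi> = \<U>},
     act = act (alpha (sum_gspace I X))\<rparr>"

abbreviation ultracopower :: "'i set \<Rightarrow> 'i filter \<Rightarrow> ('g::{topological_group_add, t2_space}, 'x) gspace
      \<Rightarrow> ('g, ('i \<times> 'x \<Rightarrow> complex) \<Rightarrow> complex) gspace"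
  where "ultracopower I \<U> X \<equiv> ultracoproduct I \<U> (\<lambda>_. X)"

section \<open>Fubini flows and groups\<close>

text \<open>
  The map \<open>\<psi>\<close> extends the union over \<open>i\<close> of the inclusions of $\{i\}\times\Sigma^G_{\mathcal V}X$ into
  $\alpha_G(I\times J\times X)$. The points of the ultracopower are points of $\alpha_G(J\times X)$, and
  $\alpha_G(\{i\}\times J\times X)\subseteq\alpha_G(I\times J\times X)$ is induced by
  $(j,x)\mapsto((i,j),x)$.
\<close>

definition fubini_psi :: "'i set \<Rightarrow> 'j set \<Rightarrow> 'j filter
      \<Rightarrow> ('g::{topological_group_add, t2_space}, 'x) gspace
      \<Rightarrow> (('i \<times> (('j \<times> 'x \<Rightarrow> complex) \<Rightarrow> complex) \<Rightarrow> complex) \<Rightarrow> complex)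
      \<Rightarrow> ((('i \<times> 'j) \<times> 'x \<Rightarrow> complex) \<Rightarrow> complex)"
  where "fubini_psi I J \<V> X =
    alpha_extend (sum_gspace I (\<lambda>_. ultracopower J \<V> X))
      (space_of (alpha (sum_gspace (I \<times> J) (\<lambda>_. X))))
      (\<lambda>(i, \<phi>). alpha_map (sum_gspace J (\<lambda>_. X)) (sum_gspace (I \<times> J) (\<lambda>_. X))
                  (\<lambda>(j, x). ((i, j), x)) \<phi>)"

definition canonical_factor_map :: "'i set \<Rightarrow> 'i filter \<Rightarrow> 'j set \<Rightarrow> 'j filter
      \<Rightarrow> ('g::{topological_group_add, t2_space}, 'x) gspace
      \<Rightarrow> (('i \<times> (('j \<times> 'x \<Rightarrow> complex) \<Rightarrow> complex) \<Rightarrow> complex) \<Rightarrow> complex)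
      \<Rightarrow> ((('i \<times> 'j) \<times> 'x \<Rightarrow> complex) \<Rightarrow> complex)"
  where "canonical_factor_map I \<U> J \<V> X =
    restrict (fubini_psi I J \<V> X) (points (ultracopower I \<U> (ultracopower J \<V> X)))"

text \<open>
  The type \<open>'i\<close> is the universe from which the index sets are taken: a definition cannot quantify over
  types, so the universe is a parameter.
\<close>

definition fubini_flow :: "'i itself \<Rightarrow> ('g::{topological_group_add, t2_space}, 'x) gspace \<Rightarrow> bool"
  where "fubini_flow _ X \<longleftrightarrow>
    (\<forall>(I :: 'i set) (J :: 'i set). infinite I \<longrightarrow> infinite J \<longrightarrow>
      (\<forall>\<U>\<in>ultrafilters_on I. \<forall>\<V>\<in>ultrafilters_on J.
        flow_isomorphism (ultracopower I \<U> (ultracopower J \<V> X))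
          (ultracopower (I \<times> J) (\<U> \<otimes>\<^sub>F \<V>) X) (canonical_factor_map I \<U> J \<V> X)))"

definition fubini_group :: "'i itself \<Rightarrow> 'g::{topological_group_add, t2_space} itself \<Rightarrow> bool"
  where "fubini_group universe _ \<longleftrightarrow>
    fubini_flow universe (Samuel :: ('g, ('g \<Rightarrow> complex) \<Rightarrow> complex) gspace)"

section \<open>Semi-norms\<close>

definition seminorm :: "('g::{topological_group_add, t2_space} \<Rightarrow> real) \<Rightarrow> bool"
  where "seminorm \<sigma> \<longleftrightarrow>
    continuous_on UNIV \<sigma> \<and> bounded (range \<sigma>) \<and> (\<forall>g. 0 \<le> \<sigma> g) \<and>
    \<sigma> 0 = 0 \<and> (\<forall>g. \<sigma> (- g) = \<sigma> g) \<and> (\<forall>g h. \<sigma> (g + h) \<le> \<sigma> g + \<sigma> h)"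

definition SN1 :: "('g::{topological_group_add, t2_space} \<Rightarrow> real) set"
  where "SN1 = {\<sigma>. seminorm \<sigma> \<and> (\<forall>g. \<sigma> g \<le> 1)}"

definition seminorm_ball :: "('g \<Rightarrow> real) \<Rightarrow> real \<Rightarrow> 'g set"
  where "seminorm_ball \<sigma> c = {g. \<sigma> g < c}"

definition translates_meet ::
    "('g, 'x) gspace \<Rightarrow> ('g \<Rightarrow> real) \<Rightarrow> 'x \<Rightarrow> 'x \<Rightarrow> real \<Rightarrow> bool"
  where "translates_meet X \<sigma> x y c \<longleftrightarrow>
    (\<forall>A B \<epsilon>. openin (space_of X) A \<and> x \<in> A \<and> openin (space_of X) B \<and> y \<in> B \<and> \<epsilon> > 0 \<longrightarrow>
      {act X g a | g a. g \<in> seminorm_ball \<sigma> (c + \<epsilon>) \<and> a \<in> A} \<inter> B \<noteq> {})"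

definition partial_dist :: "('g, 'x) gspace \<Rightarrow> ('g \<Rightarrow> real) \<Rightarrow> 'x \<Rightarrow> 'x \<Rightarrow> real"
  where "partial_dist X \<sigma> x y = Inf (insert 1 {c. 0 \<le> c \<and> c < 1 \<and> translates_meet X \<sigma> x y c})"

text \<open>The infimum is attained, so that \<open>partial_dist\<close> is the function described by its sublevel sets:\<close>

lemma partial_dist_le_iff:
  assumes "0 \<le> c" "c < 1"
  shows "partial_dist X \<sigma> x y \<le> c \<longleftrightarrow> translates_meet X \<sigma> x y c"
proof
  let ?S = "insert 1 {c. 0 \<le> c \<and> c < 1 \<and> translates_meet X \<sigma> x y c}"
  assume le: "partial_dist X \<sigma> x y \<le> c"
  show "translates_meet X \<sigma> x y c"
    unfolding translates_meet_def
  proof (intro allI impI, elim conjE)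
    fix A B and \<epsilon> :: real
    assume *: "openin (space_of X) A" "x \<in> A" "openin (space_of X) B" "y \<in> B" "\<epsilon> > 0"
    define \<delta> where "\<delta> = min (\<epsilon> / 2) (1 - c)"
    have \<delta>: "\<delta> > 0" "\<delta> \<le> \<epsilon> / 2" "c + \<delta> \<le> 1"
      using \<open>\<epsilon> > 0\<close> assms unfolding \<delta>_def by linarith+
    have "Inf ?S < c + \<delta>"
      using le \<delta> by (simp add: partial_dist_def)
    then obtain d where d: "d \<in> ?S" "d < c + \<delta>"
      using cInf_lessD[of ?S] by blast
    then have "translates_meet X \<sigma> x y d"
      using \<delta> by auto
    then have "{act X g a | g a. g \<in> seminorm_ball \<sigma> (d + \<epsilon> / 2) \<and> a \<in> A} \<inter> B \<noteq> {}"
      using * half_gt_zero[OF \<open>\<epsilon> > 0\<close>] unfolding translates_meet_def by blast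
    moreover have "seminorm_ball \<sigma> (d + \<epsilon> / 2) \<subseteq> seminorm_ball \<sigma> (c + \<epsilon>)"
      using d \<delta> by (auto simp: seminorm_ball_def)
    ultimately show "{act X g a | g a. g \<in> seminorm_ball \<sigma> (c + \<epsilon>) \<and> a \<in> A} \<inter> B \<noteq> {}"
      by blast
  qed
next
  assume "translates_meet X \<sigma> x y c"
  then show "partial_dist X \<sigma> x y \<le> c"
    unfolding partial_dist_def using assms
    by (intro cInf_lower bdd_belowI[of _ 0]) auto
qed

lemma partial_dist_eq_1_iff:
  "partial_dist X \<sigma> x y = 1 \<longleftrightarrow> (\<forall>c. 0 \<le> c \<and> c < 1 \<longrightarrow> \<not> translates_meet X \<sigma> x y c)"
proof
  assume "partial_dist X \<sigma> x y = 1"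
  then show "\<forall>c. 0 \<le> c \<and> c < 1 \<longrightarrow> \<not> translates_meet X \<sigma> x y c"
    by (metis linorder_not_le partial_dist_le_iff)
next
  assume "\<forall>c. 0 \<le> c \<and> c < 1 \<longrightarrow> \<not> translates_meet X \<sigma> x y c"
  then have "{c. 0 \<le> c \<and> c < 1 \<and> translates_meet X \<sigma> x y c} = {}"
    by auto
  then show "partial_dist X \<sigma> x y = 1"
    by (simp only: partial_dist_def cInf_singleton)
qed

definition orbit_Lipschitz :: "('g, 'x) gspace \<Rightarrow> ('g \<Rightarrow> real) \<Rightarrow> ('x \<Rightarrow> real) \<Rightarrow> bool"
  where "orbit_Lipschitz X \<sigma> f \<longleftrightarrow>
    (\<forall>g. supnorm X (\<lambda>x. translate X f g x - f x) \<le> \<sigma> g)"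

definition rho_dist :: "('g, 'x) gspace \<Rightarrow> ('g \<Rightarrow> real) \<Rightarrow> 'x \<Rightarrow> 'x \<Rightarrow> real"
  where "rho_dist X \<sigma> x y =
    Sup {\<bar>f x - f y\<bar> | f. continuous_map (space_of X) euclideanreal f \<and>
                        f \<in> points X \<rightarrow> {0..1} \<and> orbit_Lipschitz X \<sigma> f}"

definition cofinally_seminorm_respecting ::
    "('g::{topological_group_add, t2_space}, 'x) gspace \<Rightarrow> bool"
  where "cofinally_seminorm_respecting X \<longleftrightarrow>
    (\<exists>S \<subseteq> SN1. (\<forall>\<sigma>\<in>SN1. \<exists>\<tau>\<in>S. \<forall>g. \<sigma> g \<le> \<tau> g) \<and>
      (\<forall>\<sigma>\<in>S. \<forall>x\<in>points X. \<forall>y\<in>points X. rho_dist X \<sigma> x y = partial_dist X \<sigma> x y))"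

end

theory Submission
  imports Defs
begin

text \<open>
  The canonical factor map is always surjective, since a function in $\mathrm{C}_G(I\times J\times X)$
  vanishing on its image is small on almost all copies of \<open>X\<close>. For injectivity, separate two points of
  $\Sigma^G_{\mathcal U}\Sigma^G_{\mathcal V}X$ by a function \<open>r\<close>, and lift \<open>r\<close> to functions $q_{ij}$
  on \<open>X\<close>. These need not be uniformly continuous in the direction of \<open>G\<close> jointly in $(i,j)$. Their moduli
  $\omega_{ij}(g)=\sup_x|q_{ij}(gx)-q_{ij}(x)|$, however, define a function on
  $\Sigma^G_{\mathcal U}\Sigma^G_{\mathcal V}\mathrm{Sa}(G)$. As \<open>G\<close> is Fubini, it comes from a function in
  $\mathrm{C}_G(I\times J\times\mathrm{Sa}(G))$, and the modulus of the latter is a semi-norm that bounds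
  almost all $\omega_{ij}$ up to a small error. For a larger semi-norm $\sigma$ with
  $\rho_\sigma=\partial_\sigma$, this keeps the sets where $q_{ij}$ is small and where it is large at
  positive $\rho_\sigma$-distance. So $\sigma$-orbit-Lipschitz functions separate them; being uniformly
  Lipschitz, these form a function in $\mathrm{C}_G(I\times J\times X)$ that separates the images of
  the two points.
\<close>

section \<open>Function algebras and characters\<close>

text \<open>The obstacle is that a function in C_G of a disjoint sum needs one modulus for all
  summands, while lifts made one index at a time have moduli that behave well only in the limit
  along \<U> and \<V>. Semi-norms help because the modulus of a semi-norm under left translation is
  the semi-norm itself: so control of \<omega>_ij(h) in the limit is at once control of the
  translates of \<omega>_ij. After Fubini for Sa(G) has produced one jointly uniform function, its
  values at g and at the identity, where every \<omega>_ij vanishes, are compared.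

  The resulting bound has an additive error, so the lifts u are not Lipschitz themselves. The
  regularization inf_g (u(gx) + \<sigma>(g)) is orbit-Lipschitz but in general only upper
  semicontinuous. This is where \<rho>_\<sigma> = \<partial>_\<sigma> enters: \<partial>_\<sigma> is
  bounded below directly from the bound on u, with room for the error, and \<rho>_\<sigma> supplies
  continuous functions.

  Characters are treated as limits along filters, so that statements about an ultracoproduct and
  about almost all of its factors are exchanged by taking limits.\<close>

lemma on_points_simps [simp]:
  "x \<in> points X \<Longrightarrow> on_points X p x = p x"
  "x \<notin> points X \<Longrightarrow> on_points X p x = 0"
  by (simp_all add: on_points_def)

lemma act_0 [simp]: "G_space X \<Longrightarrow> x \<in> points X \<Longrightarrow> act X 0 x = x"
  by (simp add: G_space_def)

lemma act_add: "G_space X \<Longrightarrow> x \<in> points X \<Longrightarrow> act X (g + h) x = act X g (act X h x)"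
  by (simp add: G_space_def)

lemma act_points [simp]:
  assumes "G_space X" "x \<in> points X"
  shows "act X g x \<in> points X"
proof -
  have "(\<lambda>(g, x). act X g x) \<in> topspace (prod_topology euclidean (space_of X)) \<rightarrow> points X"
    using assms(1) by (simp only: G_space_def continuous_map_def)
  from funcset_mem[OF this, of "(g, x)"] show ?thesis
    using assms(2) by simp
qed

lemma continuous_map_act:
  assumes "G_space X"
  shows "continuous_map (space_of X) (space_of X) (act X g)"
proof -
  have "continuous_map (prod_topology euclidean (space_of X)) (space_of X) (\<lambda>(g, x). act X g x)"
    using assms by (simp add: G_space_def)
  moreover have "continuous_map (space_of X) (prod_topology euclidean (space_of X)) (\<lambda>x. (g, x))"
    by (simp add: continuous_map_pairedI)
  ultimately have "continuous_map (space_of X) (space_of X) ((\<lambda>(g, x). act X g x) \<circ> (\<lambda>x. (g, x)))"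
    by (rule continuous_map_compose[rotated])
  then show ?thesis
    by (simp add: o_def)
qed

lemma supnorm_le_iff:
  assumes "0 \<le> e" "bounded (p ` points X)"
  shows "supnorm X p \<le> e \<longleftrightarrow> (\<forall>x\<in>points X. norm (p x) \<le> e)"
proof -
  have "bdd_above ((\<lambda>x. norm (p x)) ` points X)"
    using assms(2) by (auto simp: bounded_iff bdd_above_def)
  then show ?thesis
    using assms(1) by (subst supnorm_def, subst cSup_le_iff) auto
qed

lemma supnorm_nonneg:
  assumes "bounded (p ` points X)"
  shows "0 \<le> supnorm X p"
proof -
  have "bdd_above ((\<lambda>x. norm (p x)) ` points X)"
    using assms by (auto simp: bounded_iff bdd_above_def)
  then show ?thesis
    unfolding supnorm_def by (intro cSup_upper) auto
qed

lemma bounded_translate_diff: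
  fixes p :: "'x \<Rightarrow> 'a::real_normed_vector"
  assumes "G_space X" "bounded (p ` points X)"
  shows "bounded ((\<lambda>x. translate X p g x - translate X p h x) ` points X)"
proof -
  obtain B where B: "\<And>x. x \<in> points X \<Longrightarrow> norm (p x) \<le> B"
    using assms(2) by (auto simp: bounded_iff)
  have "norm (translate X p g x - translate X p h x) \<le> B + B" if "x \<in> points X" for x
    using that assms(1) unfolding translate_def
    by (intro order_trans[OF norm_triangle_ineq4] add_mono) (auto intro: B)
  then show ?thesis
    by (auto simp: bounded_iff)
qed

text \<open>Norm continuity at \<open>h\<close> reduces to continuity at the identity: as
  \<open>act X (g - h) (act X h x) = act X g x\<close>, the estimate for \<open>g - h\<close> at the
  point \<open>act X h x\<close> is the estimate for pg - ph at \<open>x\<close>. The supremum norm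
  is replaced by a pointwise bound that is uniform in \<open>x\<close>, and \<open>nhds 0\<close>
  may replace \<open>at 0\<close> because the difference vanishes at the identity.\<close>

lemma in_C_G_iff:
  fixes X :: "('g::{topological_group_add, t2_space}, 'x) gspace"
  assumes X: "G_space X"
  shows "p \<in> C_G X \<longleftrightarrow> continuous_map (space_of X) euclidean p \<and> bounded (p ` points X) \<and>
    (\<forall>x. x \<notin> points X \<longrightarrow> p x = 0) \<and>
    (\<forall>e>0. eventually (\<lambda>g. \<forall>x\<in>points X. cmod (p (act X g x) - p x) \<le> e) (nhds 0))"
    (is "_ \<longleftrightarrow> ?R")
proof -
  have *: "(\<forall>h. ((\<lambda>g. supnorm X (\<lambda>x. translate X p g x - translate X p h x)) \<longlongrightarrow> 0) (at h)) \<longleftrightarrow>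
    (\<forall>e>0. eventually (\<lambda>g. \<forall>x\<in>points X. cmod (p (act X g x) - p x) \<le> e) (nhds 0))"
    (is "?A \<longleftrightarrow> ?B") if p: "bounded (p ` points X)"
  proof
    assume A: ?A
    show ?B
    proof (intro allI impI)
      fix e :: real assume "e > 0"
      have "eventually (\<lambda>g. dist (supnorm X (\<lambda>x. translate X p g x - translate X p 0 x)) 0 < e) (at 0)"
        using A \<open>e > 0\<close> by (intro tendstoD) auto
      then have "eventually (\<lambda>g. \<forall>x\<in>points X. cmod (p (act X g x) - p x) \<le> e) (at 0)"
      proof eventually_elim
        case (elim g)
        then have "supnorm X (\<lambda>x. translate X p g x - translate X p 0 x) \<le> e"
          by simp
        then have "\<forall>x\<in>points X. cmod (translate X p g x - translate X p 0 x) \<le> e"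
          using \<open>e > 0\<close> by (subst (asm) supnorm_le_iff[OF _ bounded_translate_diff[OF X p]]) auto
        then show ?case
          using X by (simp add: translate_def)
      qed
      then show "eventually (\<lambda>g. \<forall>x\<in>points X. cmod (p (act X g x) - p x) \<le> e) (nhds 0)"
        using \<open>e > 0\<close> X by (simp add: eventually_nhds_conv_at)
    qed
  next
    assume B: ?B
    show ?A
    proof (intro allI tendstoI)
      fix h :: 'g and e :: real assume "e > 0"
      have "((\<lambda>g. g - h) \<longlongrightarrow> h - h) (at h)"
        by (intro tendsto_intros)
      then have "filterlim (\<lambda>g. g - h) (nhds 0) (at h)"
        by simp
      moreover from B have "eventually (\<lambda>g. \<forall>x\<in>points X. cmod (p (act X g x) - p x) \<le> e / 2) (nhds 0)"
        using half_gt_zero[OF \<open>e > 0\<close>] by blast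
      ultimately have "eventually (\<lambda>g. \<forall>x\<in>points X. cmod (p (act X (g - h) x) - p x) \<le> e / 2) (at h)"
        by (rule eventually_compose_filterlim[rotated])
      then show "eventually (\<lambda>g. dist (supnorm X (\<lambda>x. translate X p g x - translate X p h x)) 0 < e) (at h)"
      proof eventually_elim
        case (elim g)
        have "cmod (translate X p g x - translate X p h x) \<le> e / 2" if "x \<in> points X" for x
        proof -
          have "act X (g - h) (act X h x) = act X g x"
            using act_add[OF X that, of "g - h" h] by simp
          then show ?thesis
            using elim[rule_format, of "act X h x"] that X by (simp add: translate_def)
        qed
        then have "supnorm X (\<lambda>x. translate X p g x - translate X p h x) \<le> e / 2"
          using \<open>e > 0\<close> by (subst supnorm_le_iff[OF _ bounded_translate_diff[OF X p]]) auto
        moreover have "0 \<le> supnorm X (\<lambda>x. translate X p g x - translate X p h x)"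
          by (rule supnorm_nonneg[OF bounded_translate_diff[OF X p]])
        ultimately show ?case
          using \<open>e > 0\<close> by simp
      qed
    qed
  qed
  then show ?thesis
    unfolding C_G_def C_bdd_def by blast
qed

section \<open>Closure properties of the algebra C_G\<close>

lemma C_G_I:
  assumes "G_space X" "continuous_map (space_of X) euclidean p"
    and "\<And>x. x \<in> points X \<Longrightarrow> cmod (p x) \<le> B" "\<And>x. x \<notin> points X \<Longrightarrow> p x = 0"
    and "\<And>e. e > 0 \<Longrightarrow> eventually (\<lambda>g. \<forall>x\<in>points X. cmod (p (act X g x) - p x) \<le> e) (nhds 0)"
  shows "p \<in> C_G X"
  using assms by (auto simp: in_C_G_iff bounded_iff)

lemma C_G_D:
  assumes "G_space X" "p \<in> C_G X"
  shows "continuous_map (space_of X) euclidean p" "bounded (p ` points X)"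
    and "\<And>x. x \<notin> points X \<Longrightarrow> p x = 0"
    and "\<And>e. e > 0 \<Longrightarrow> eventually (\<lambda>g. \<forall>x\<in>points X. cmod (p (act X g x) - p x) \<le> e) (nhds 0)"
  using assms by (auto simp: in_C_G_iff)

text \<open>The values of (p, q) stay in a compact product of discs, on which \<open>f\<close> is
  bounded and uniformly continuous; so boundedness and uniformity in the group direction are
  inherited. Sums, products and conjugates are instances.\<close>

lemma C_G_comp2:
  fixes f :: "complex \<times> complex \<Rightarrow> complex"
  assumes X: "G_space X" and f: "continuous_on UNIV f" and p: "p \<in> C_G X" and q: "q \<in> C_G X"
  shows "on_points X (\<lambda>x. f (p x, q x)) \<in> C_G X"
proof -
  obtain A B where A: "\<And>x. x \<in> points X \<Longrightarrow> cmod (p x) \<le> A"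
    and B: "\<And>x. x \<in> points X \<Longrightarrow> cmod (q x) \<le> B"
    using C_G_D(2)[OF X p] C_G_D(2)[OF X q] by (auto simp: bounded_iff)
  define K where "K = cball (0::complex) A \<times> cball (0::complex) B"
  have K: "compact K"
    unfolding K_def by (intro compact_Times compact_cball)
  have inK: "(p x, q x) \<in> K" if "x \<in> points X" for x
    using A B that by (simp add: K_def)
  have fK: "continuous_on K f"
    using f continuous_on_subset by blast
  have "bounded (f ` K)"
    using K fK compact_continuous_image compact_imp_bounded by blast
  then obtain C where C: "\<And>z. z \<in> K \<Longrightarrow> cmod (f z) \<le> C"
    by (auto simp: bounded_iff)
  have "continuous_map (space_of X) (prod_topology euclidean euclidean) (\<lambda>x. (p x, q x))"
    using C_G_D(1)[OF X p] C_G_D(1)[OF X q] by (rule continuous_map_pairedI)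
  then have "continuous_map (space_of X) euclidean (\<lambda>x. (p x, q x))"
    by simp
  moreover have "continuous_map euclidean euclidean f"
    using f by simp
  ultimately have "continuous_map (space_of X) euclidean (f \<circ> (\<lambda>x. (p x, q x)))"
    by (rule continuous_map_compose)
  then have cont: "continuous_map (space_of X) euclidean (on_points X (\<lambda>x. f (p x, q x)))"
    by (rule continuous_map_eq) simp
  show ?thesis
  proof (rule C_G_I[OF X cont, of C])
    fix e :: real assume "e > 0"
    have "uniformly_continuous_on K f"
      using K fK compact_uniformly_continuous by blast
    then obtain d where d: "d > 0"
      "\<And>z w. z \<in> K \<Longrightarrow> w \<in> K \<Longrightarrow> dist z w < d \<Longrightarrow> dist (f z) (f w) < e"
      using \<open>e > 0\<close> unfolding uniformly_continuous_on_def by metis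
    have "d / 3 > 0" using d by simp
    from C_G_D(4)[OF X p this] C_G_D(4)[OF X q this]
    show "eventually (\<lambda>g. \<forall>x\<in>points X. cmod (on_points X (\<lambda>x. f (p x, q x)) (act X g x) -
        on_points X (\<lambda>x. f (p x, q x)) x) \<le> e) (nhds 0)"
    proof eventually_elim
      case (elim g)
      show ?case
      proof
        fix x assume x: "x \<in> points X"
        let ?y = "act X g x"
        have y: "?y \<in> points X" using X x by simp
        have "dist (p ?y, q ?y) (p x, q x) \<le> dist (p ?y) (p x) + dist (q ?y) (q x)"
          by (simp add: dist_Pair_Pair sqrt_sum_squares_le_sum)
        also have "\<dots> \<le> d / 3 + d / 3"
          using elim x by (intro add_mono) (auto simp: dist_norm)
        also have "\<dots> < d" using d by simp
        finally have "dist (f (p ?y, q ?y)) (f (p x, q x)) < e"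
          using d(2) inK x y by blast
        then show "cmod (on_points X (\<lambda>x. f (p x, q x)) ?y - on_points X (\<lambda>x. f (p x, q x)) x) \<le> e"
          using x y by (simp add: dist_norm)
      qed
    qed
  qed (auto intro: C inK)
qed

lemma C_G_comp:
  fixes f :: "complex \<Rightarrow> complex"
  assumes X: "G_space X" and f: "continuous_on UNIV f" and p: "p \<in> C_G X"
  shows "on_points X (\<lambda>x. f (p x)) \<in> C_G X"
proof -
  have "continuous_on UNIV (\<lambda>z::complex \<times> complex. f (fst z))"
    by (intro continuous_on_compose2[OF f] continuous_intros) auto
  from C_G_comp2[OF X this p p] show ?thesis by simp
qed

lemma C_G_add:
  assumes X: "G_space X" and p: "p \<in> C_G X" and q: "q \<in> C_G X"
  shows "(\<lambda>x. p x + q x) \<in> C_G X"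
proof -
  have "continuous_on UNIV (\<lambda>z::complex \<times> complex. fst z + snd z)"
    by (intro continuous_intros)
  from C_G_comp2[OF X this p q] have "on_points X (\<lambda>x. p x + q x) \<in> C_G X" by simp
  moreover have "on_points X (\<lambda>x. p x + q x) = (\<lambda>x. p x + q x)"
    using C_G_D(3)[OF X p] C_G_D(3)[OF X q] by (auto simp: on_points_def)
  ultimately show ?thesis by simp
qed

lemma C_G_mult:
  assumes X: "G_space X" and p: "p \<in> C_G X" and q: "q \<in> C_G X"
  shows "(\<lambda>x. p x * q x) \<in> C_G X"
proof -
  have "continuous_on UNIV (\<lambda>z::complex \<times> complex. fst z * snd z)"
    by (intro continuous_intros)
  from C_G_comp2[OF X this p q] have "on_points X (\<lambda>x. p x * q x) \<in> C_G X" by simp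
  moreover have "on_points X (\<lambda>x. p x * q x) = (\<lambda>x. p x * q x)"
    using C_G_D(3)[OF X p] C_G_D(3)[OF X q] by (auto simp: on_points_def)
  ultimately show ?thesis by simp
qed

lemma C_G_const: 
  assumes X: "G_space X"
  shows "on_points X (\<lambda>_. c) \<in> C_G X"
proof (rule C_G_I[OF X, of _ "cmod c"])
  show "continuous_map (space_of X) euclidean (on_points X (\<lambda>_. c))"
    by (rule continuous_map_eq[of _ _ "\<lambda>_. c"]) auto
qed (use X in auto)

lemma C_G_cmult:
  assumes X: "G_space X" and p: "p \<in> C_G X"
  shows "(\<lambda>x. c * p x) \<in> C_G X"
proof -
  have "(\<lambda>x. c * p x) = (\<lambda>x. on_points X (\<lambda>_. c) x * p x)"
    using C_G_D(3)[OF X p] by (auto simp: on_points_def)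
  then show ?thesis
    using C_G_mult[OF X C_G_const[OF X] p] by simp
qed

lemma C_G_cnj:
  assumes X: "G_space X" and p: "p \<in> C_G X"
  shows "(\<lambda>x. cnj (p x)) \<in> C_G X"
proof -
  have "on_points X (\<lambda>x. cnj (p x)) \<in> C_G X"
    using X p by (intro C_G_comp) (auto intro!: continuous_intros)
  moreover have "on_points X (\<lambda>x. cnj (p x)) = (\<lambda>x. cnj (p x))"
    using C_G_D(3)[OF X p] by (auto simp: on_points_def)
  ultimately show ?thesis by simp
qed

text \<open>Moving by \<open>h\<close> before \<open>g\<close> is moving by the conjugate
  \<open>g + h - g\<close> after \<open>g\<close>, and conjugation by \<open>g\<close> is continuous
  at the identity.\<close>

lemma C_G_translate:
  assumes X: "G_space X" and p: "p \<in> C_G X"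
  shows "translate X p g \<in> C_G X"
proof -
  obtain B where B: "\<And>x. x \<in> points X \<Longrightarrow> cmod (p x) \<le> B"
    using C_G_D(2)[OF X p] by (auto simp: bounded_iff)
  have "continuous_map (space_of X) euclidean (p \<circ> act X g)"
    using C_G_D(1)[OF X p] continuous_map_act[OF X] by (rule continuous_map_compose[rotated])
  then have cont: "continuous_map (space_of X) euclidean (translate X p g)"
    by (rule continuous_map_eq) (simp add: translate_def)
  show ?thesis
  proof (rule C_G_I[OF X cont, of B])
    fix e :: real assume "e > 0"
    have "((\<lambda>h. g + h - g) \<longlongrightarrow> g + 0 - g) (nhds 0)"
      by (intro tendsto_intros) (simp add: filterlim_ident)
    then have "filterlim (\<lambda>h. g + h - g) (nhds 0) (nhds 0)" by simp
    with C_G_D(4)[OF X p \<open>e > 0\<close>]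
    have "eventually (\<lambda>h. \<forall>x\<in>points X. cmod (p (act X (g + h - g) x) - p x) \<le> e) (nhds 0)"
      by (rule eventually_compose_filterlim)
    then show "eventually (\<lambda>h. \<forall>x\<in>points X. cmod (translate X p g (act X h x) - translate X p g x) \<le> e) (nhds 0)"
    proof eventually_elim
      case (elim h)
      show ?case
      proof
        fix x assume x: "x \<in> points X"
        have "act X (g + h - g) (act X g x) = act X g (act X h x)"
          using act_add[OF X x, of "g + h - g" g] act_add[OF X x, of g h] by simp
        then show "cmod (translate X p g (act X h x) - translate X p g x) \<le> e"
          using elim[rule_format, of "act X g x"] x X by (simp add: translate_def)
      qed
    qed
  qed (use X B in \<open>auto simp: translate_def\<close>)
qed

text \<open>A character is the limit of the evaluations along a filter on the points.\<close>

definition represents :: "('g::{topological_group_add, t2_space}, 'x) gspace \<Rightarrow> 'x filter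
    \<Rightarrow> (('x \<Rightarrow> complex) \<Rightarrow> complex) \<Rightarrow> bool"
  where "represents X F \<phi> \<longleftrightarrow> F \<noteq> bot \<and> eventually (\<lambda>x. x \<in> points X) F \<and>
    \<phi> \<in> extensional (C_G X) \<and> (\<forall>p\<in>C_G X. (p \<longlongrightarrow> \<phi> p) F)"

lemma representsD:
  assumes "represents X F \<phi>"
  shows "F \<noteq> bot" "eventually (\<lambda>x. x \<in> points X) F" "\<And>p. p \<in> C_G X \<Longrightarrow> (p \<longlongrightarrow> \<phi> p) F"
  using assms by (auto simp: represents_def)

lemma represents_imp_character:
  assumes X: "G_space X" and F: "represents X F \<phi>"
  shows "\<phi> \<in> characters X"
proof -
  have nb: "F \<noteq> bot" and ev: "eventually (\<lambda>x. x \<in> points X) F"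
    and lim: "\<And>p. p \<in> C_G X \<Longrightarrow> (p \<longlongrightarrow> \<phi> p) F"
    using F by (auto simp: represents_def)
  have uniq: "\<phi> p = l" if "p \<in> C_G X" "(p \<longlongrightarrow> l) F" for p l
    using tendsto_unique[OF nb lim[OF that(1)] that(2)] .
  have "(on_points X (\<lambda>_. 1 :: complex) \<longlongrightarrow> 1) F"
    by (rule tendsto_eventually) (use ev in eventually_elim, simp)
  then have "\<phi> (on_points X (\<lambda>_. 1)) = 1"
    using uniq C_G_const[OF X] by blast
  moreover have "\<phi> (\<lambda>x. p x + q x) = \<phi> p + \<phi> q" "\<phi> (\<lambda>x. p x * q x) = \<phi> p * \<phi> q"
    if "p \<in> C_G X" "q \<in> C_G X" for p q
    using that by (auto intro!: uniq C_G_add C_G_mult X tendsto_intros lim)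
  moreover have "\<phi> (\<lambda>x. c * p x) = c * \<phi> p" if "p \<in> C_G X" for p c
    using that by (auto intro!: uniq C_G_cmult X tendsto_intros lim)
  ultimately show ?thesis
    using F unfolding characters_def represents_def by blast
qed

text \<open>
  A function in the kernel of a character is not bounded away from \<open>0\<close>, as it is not invertible; and
  $|p|^2+|q|^2$ is in the kernel together with \<open>p\<close> and \<open>q\<close>.
\<close>

lemma character_kernel_small:
  assumes X: "G_space X" and \<phi>: "\<phi> \<in> characters X" and p: "p \<in> C_G X" "\<phi> p = 0" and "e > 0"
  shows "\<exists>x\<in>points X. cmod (p x) < e"
proof (rule ccontr)
  assume "\<not> ?thesis"
  then have ge: "e \<le> cmod (p x)" if "x \<in> points X" for x
    using that by force
  \<comment> \<open>On numbers of modulus at least \<open>e\<close> this is the reciprocal; the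
    maximum in the denominator makes it continuous on the whole plane, so that it can be composed
    with \<open>p\<close> inside C_G.\<close>
  define f where "f = (\<lambda>z. cnj z / of_real (max (e\<^sup>2) ((cmod z)\<^sup>2)))"
  have "continuous_on UNIV f"
    unfolding f_def using \<open>e > 0\<close>
    by (intro continuous_intros) (auto simp: max_def)
  then have q: "on_points X (\<lambda>x. f (p x)) \<in> C_G X" (is "?q \<in> _")
    using C_G_comp X p by blast
  have "p x * ?q x = on_points X (\<lambda>_. 1) x" for x
  proof (cases "x \<in> points X")
    case True
    then have "max (e\<^sup>2) ((cmod (p x))\<^sup>2) = (cmod (p x))\<^sup>2" "p x \<noteq> 0"
      using ge[of x] \<open>e > 0\<close> by (auto simp: max_def)
    then show ?thesis
      using True by (simp add: f_def complex_norm_square[symmetric] power_divide)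
  qed simp
  then have "1 = \<phi> (\<lambda>x. p x * ?q x)"
    using \<phi> by (simp add: characters_def)
  also have "\<dots> = \<phi> p * \<phi> ?q"
    using \<phi> p q by (simp add: characters_def)
  finally show False
    using p by simp
qed

text \<open>The sets where a kernel element is smaller than a positive number form a filter base:
  they are nonempty by the preceding lemma and directed by sums of squares. Convergence of
  \<open>p\<close> to \<open>\<phi> p\<close> along it holds because \<open>p\<close> minus the
  constant \<open>\<phi> p\<close> is in the kernel. From here on a character is used only through
  such limits or through its algebraic laws.\<close>

lemma character_imp_represents:
  assumes X: "G_space X" and \<phi>: "\<phi> \<in> characters X"
  obtains F where "represents X F \<phi>"
proof -
  define N where "N = {p \<in> C_G X. \<phi> p = 0} \<times> {0::real<..}"
  define S where "S = (\<lambda>(p, e). {x \<in> points X. cmod (p x) < e})"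
  define F where "F = (INF z\<in>N. principal (S z))"
  have add: "\<phi> (\<lambda>x. p x + q x) = \<phi> p + \<phi> q" and mult: "\<phi> (\<lambda>x. p x * q x) = \<phi> p * \<phi> q"
    if "p \<in> C_G X" "q \<in> C_G X" for p q
    using that \<phi> by (auto simp: characters_def)
  have one: "\<phi> (on_points X (\<lambda>_. 1)) = 1" and cmult: "\<And>p c. p \<in> C_G X \<Longrightarrow> \<phi> (\<lambda>x. c * p x) = c * \<phi> p"
    using \<phi> by (auto simp: characters_def)
  \<comment> \<open>The zero function makes \<open>N\<close> nonempty; as a multiple of the unit it
    is evaluated by \<open>cmult\<close>.\<close>
  have "\<phi> (\<lambda>x. 0 * on_points X (\<lambda>_. 1) x) = 0"
    by (subst cmult) (auto intro: C_G_const X)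
  then have zero: "(\<lambda>x. 0 * on_points X (\<lambda>_. 1) x, 1) \<in> N"
    unfolding N_def using C_G_cmult[OF X C_G_const[OF X], of 0 1] by simp
  have dir: "\<exists>z\<in>N. S z \<subseteq> S a \<inter> S b" if "a \<in> N" "b \<in> N" for a b
  proof -
    obtain p d q e where ab: "a = (p, d)" "b = (q, e)" by (metis surj_pair)
    have p: "p \<in> C_G X" "\<phi> p = 0" and q: "q \<in> C_G X" "\<phi> q = 0" and de: "d > 0" "e > 0"
      using that by (auto simp: ab N_def)
    define r where "r = (\<lambda>x. p x * cnj (p x) + q x * cnj (q x))"
    have pp: "(\<lambda>x. p x * cnj (p x)) \<in> C_G X" "(\<lambda>x. q x * cnj (q x)) \<in> C_G X"
      by (intro C_G_mult C_G_cnj X p q)+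
    then have "r \<in> C_G X" unfolding r_def by (intro C_G_add X)
    moreover have "\<phi> r = 0"
      unfolding r_def by (simp add: add pp mult C_G_cnj X p q)
    ultimately have "(r, (min d e)\<^sup>2) \<in> N"
      using de by (simp add: N_def)
    moreover have "S (r, (min d e)\<^sup>2) \<subseteq> S a \<inter> S b"
    proof
      fix x assume x: "x \<in> S (r, (min d e)\<^sup>2)"
      have "r x = of_real ((cmod (p x))\<^sup>2 + (cmod (q x))\<^sup>2)"
        by (simp add: r_def complex_norm_square[symmetric])
      then have "cmod (r x) = (cmod (p x))\<^sup>2 + (cmod (q x))\<^sup>2"
        by (simp only: norm_of_real) simp
      then have "(cmod (p x))\<^sup>2 + (cmod (q x))\<^sup>2 < (min d e)\<^sup>2"
        using x by (simp add: S_def)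
      then have "(cmod (p x))\<^sup>2 < (min d e)\<^sup>2" "(cmod (q x))\<^sup>2 < (min d e)\<^sup>2"
        by (smt (verit) zero_le_power2)+
      then have "cmod (p x) < min d e" "cmod (q x) < min d e"
        using de by (auto intro: power_less_imp_less_base simp del: min_less_iff_conj)
      then show "x \<in> S a \<inter> S b"
        using x by (simp add: S_def ab)
    qed
    ultimately show ?thesis by blast
  qed
  have ev: "eventually P F \<longleftrightarrow> (\<exists>z\<in>N. \<forall>x\<in>S z. P x)" for P
    unfolding F_def
  proof (subst eventually_INF_base)
    show "N \<noteq> {}" using zero by blast
    show "\<exists>z\<in>N. principal (S z) \<le> inf (principal (S a)) (principal (S b))"
      if "a \<in> N" "b \<in> N" for a b
      using dir[OF that] by simp
  qed (simp add: eventually_principal)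
  have "S z \<noteq> {}" if "z \<in> N" for z
  proof -
    obtain p e where z: "z = (p, e)" by (metis surj_pair)
    with that have "p \<in> C_G X" "\<phi> p = 0" "e > 0" by (simp_all add: N_def)
    from character_kernel_small[OF X \<phi> this] show ?thesis
      by (auto simp: z S_def)
  qed
  then have "F \<noteq> bot"
    unfolding trivial_limit_def ev by blast
  moreover have "eventually (\<lambda>x. x \<in> points X) F"
    unfolding ev by (intro bexI[OF _ zero]) (simp add: S_def)
  moreover have "(p \<longlongrightarrow> \<phi> p) F" if p: "p \<in> C_G X" for p
  proof (rule tendstoI)
    fix e :: real assume "e > 0"
    define q where "q = (\<lambda>x. p x + (- \<phi> p) * on_points X (\<lambda>_. 1) x)"
    have c: "(\<lambda>x. (- \<phi> p) * on_points X (\<lambda>_. 1) x) \<in> C_G X"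
      by (rule C_G_cmult[OF X C_G_const[OF X]])
    have "q \<in> C_G X" unfolding q_def by (intro C_G_add c X p)
    moreover have "\<phi> q = 0"
      unfolding q_def by (simp only: add[OF p c] cmult[OF C_G_const[OF X]] one) simp
    ultimately have "(q, e) \<in> N" using \<open>e > 0\<close> by (simp add: N_def)
    moreover have "\<forall>x\<in>S (q, e). dist (p x) (\<phi> p) < e"
      by (auto simp: S_def q_def dist_norm)
    ultimately show "eventually (\<lambda>x. dist (p x) (\<phi> p) < e) F"
      unfolding ev by blast
  qed
  moreover have "\<phi> \<in> extensional (C_G X)"
    using \<phi> by (simp add: characters_def)
  ultimately have "represents X F \<phi>"
    unfolding represents_def by blast
  then show thesis using that by blast
qed

section \<open>The maximal equivariant compactification\<close>

lemma points_alpha [simp]: "points (alpha X) = characters X"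
proof -
  have "characters X \<subseteq> extensional (C_G X)"
    by (auto simp: characters_def)
  then show ?thesis
    by (auto simp: alpha_def PiE_UNIV_domain PiE_def)
qed

lemma act_alpha: "act (alpha X) g \<phi> = (\<lambda>p\<in>C_G X. \<phi> (translate X p g))"
  by (simp add: alpha_def)

lemma continuous_map_euclidean_comp:
  "continuous_on UNIV f \<Longrightarrow> continuous_map T euclidean p \<Longrightarrow> continuous_map T euclidean (\<lambda>x. f (p x))"
  using continuous_map_compose[of T euclidean p euclidean f] by (simp add: o_def)

lemma continuous_map_euclidean_comp2:
  assumes f: "continuous_on UNIV f" and "continuous_map T euclidean p" "continuous_map T euclidean q"
  shows "continuous_map T euclidean (\<lambda>x. f (p x, q x))"
proof -
  have "continuous_map T (prod_topology euclidean euclidean) (\<lambda>x. (p x, q x))"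
    using assms(2,3) by (rule continuous_map_pairedI)
  then show ?thesis
    using continuous_map_euclidean_comp[OF f] by simp
qed

lemma continuous_map_into_alpha:
  "continuous_map T (space_of (alpha X)) f \<longleftrightarrow>
    f \<in> topspace T \<rightarrow> characters X \<and> (\<forall>p\<in>C_G X. continuous_map T euclidean (\<lambda>t. f t p))"
proof -
  have "characters X \<subseteq> extensional (C_G X)"
    by (auto simp: characters_def)
  then show ?thesis
    unfolding alpha_def by (auto simp: continuous_map_in_subtopology continuous_map_componentwise Pi_iff)
qed

lemma continuous_map_alpha_eval:
  "p \<in> C_G X \<Longrightarrow> continuous_map (space_of (alpha X)) euclidean (\<lambda>\<phi>. \<phi> p)"
  unfolding alpha_def gspace.simps
  by (intro continuous_map_from_subtopology continuous_map_product_projection)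

lemma limitin_alpha:
  "limitin (space_of (alpha X)) f \<phi> F \<longleftrightarrow> \<phi> \<in> characters X \<and>
    eventually (\<lambda>y. f y \<in> characters X) F \<and> (\<forall>p\<in>C_G X. ((\<lambda>y. f y p) \<longlongrightarrow> \<phi> p) F)"
proof -
  have c: "characters X \<subseteq> extensional (C_G X)"
    by (auto simp: characters_def)
  have ev: "eventually (\<lambda>y. f y \<in> extensional (C_G X)) F" if "eventually (\<lambda>y. f y \<in> characters X) F"
    by (rule eventually_mono[OF that]) (use c in blast)
  have "limitin (space_of (alpha X)) f \<phi> F \<longleftrightarrow> \<phi> \<in> characters X \<and> eventually (\<lambda>y. f y \<in> characters X) F \<and>
     \<phi> \<in> extensional (C_G X) \<and> eventually (\<lambda>y. f y \<in> extensional (C_G X)) F \<and>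
     (\<forall>p\<in>C_G X. ((\<lambda>y. f y p) \<longlongrightarrow> \<phi> p) F)"
    unfolding alpha_def
    by (simp add: limitin_subtopology limitin_componentwise PiE_def)
  then show ?thesis
    using c ev by blast
qed

lemma Hausdorff_alpha: "Hausdorff_space (space_of (alpha X))"
  unfolding alpha_def by (simp add: Hausdorff_space_subtopology Hausdorff_space_product_topology)

lemma represents_alpha_unit: "x \<in> points X \<Longrightarrow> represents X (principal {x}) (alpha_unit X x)"
  unfolding represents_def
  by (intro conjI ballI tendsto_eventually) (simp_all add: alpha_unit_def principal_eq_bot_iff eventually_principal)

lemma alpha_unit_character: "G_space X \<Longrightarrow> x \<in> points X \<Longrightarrow> alpha_unit X x \<in> characters X"
  by (rule represents_imp_character[OF _ represents_alpha_unit])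

lemma alpha_unit_apply [simp]: "p \<in> C_G X \<Longrightarrow> alpha_unit X x p = p x"
  by (simp add: alpha_unit_def)

lemma limitin_alpha_unit:
  assumes X: "G_space X" and F: "represents X F \<phi>"
  shows "limitin (space_of (alpha X)) (alpha_unit X) \<phi> F"
  unfolding limitin_alpha
proof (intro conjI ballI)
  show "\<phi> \<in> characters X" using represents_imp_character[OF X F] .
  show "eventually (\<lambda>y. alpha_unit X y \<in> characters X) F"
    using representsD(2)[OF F] by eventually_elim (rule alpha_unit_character[OF X])
  show "((\<lambda>y. alpha_unit X y p) \<longlongrightarrow> \<phi> p) F" if "p \<in> C_G X" for p
    using representsD(3)[OF F that] that by simp
qed

text \<open>This is density of the image of \<open>alpha_unit\<close>: both maps carry a filter
  representing \<phi> to limits of the same net of values, and limits in \<open>K\<close> are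
  unique.\<close>

lemma continuous_maps_alpha_agree:
  assumes X: "G_space X" and K: "Hausdorff_space K"
    and h: "continuous_map (space_of (alpha X)) K h" and h': "continuous_map (space_of (alpha X)) K h'"
    and eq: "\<And>x. x \<in> points X \<Longrightarrow> h (alpha_unit X x) = h' (alpha_unit X x)"
    and \<phi>: "\<phi> \<in> characters X"
  shows "h \<phi> = h' \<phi>"
proof -
  obtain F where F: "represents X F \<phi>"
    using character_imp_represents[OF X \<phi>] .
  have l: "limitin K (h \<circ> alpha_unit X) (h \<phi>) F" "limitin K (h' \<circ> alpha_unit X) (h' \<phi>) F"
    by (rule continuous_map_limit[OF h limitin_alpha_unit[OF X F]],
        rule continuous_map_limit[OF h' limitin_alpha_unit[OF X F]])
  have "eventually (\<lambda>x. (h \<circ> alpha_unit X) x = (h' \<circ> alpha_unit X) x) F"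
    using representsD(2)[OF F] by eventually_elim (simp add: eq o_def)
  with l(1) have "limitin K (h' \<circ> alpha_unit X) (h \<phi>) F"
    by (rule limitin_transform_eventually[rotated])
  from limitin_Hausdorff_unique[OF this l(2) representsD(1)[OF F] K] show ?thesis .
qed

text \<open>\<open>alpha_extend\<close> is a definite description, so it is computed by exhibiting
  an explicit extension \<open>h\<close>, which is cut down to \<open>characters X\<close> to be
  extensional. Uniqueness is density.\<close>

lemma alpha_extend_eqI:
  assumes X: "G_space X" and K: "Hausdorff_space K"
    and h: "continuous_map (space_of (alpha X)) K h" 
    and eq: "\<And>x. x \<in> points X \<Longrightarrow> h (alpha_unit X x) = f x"
    and \<phi>: "\<phi> \<in> characters X"
  shows "alpha_extend X K f \<phi> = h \<phi>"
proof -
  let ?P = "\<lambda>h. h \<in> extensional (points (alpha X)) \<and> continuous_map (space_of (alpha X)) K h \<and>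
            (\<forall>x\<in>points X. h (alpha_unit X x) = f x)"
  have 1: "?P (restrict h (characters X))"
  proof (intro conjI ballI)
    show "continuous_map (space_of (alpha X)) K (restrict h (characters X))"
      by (rule continuous_map_eq[OF h]) simp
  qed (simp_all add: alpha_unit_character[OF X] eq)
  have 2: "h1 = h2" if "?P h1" "?P h2" for h1 h2
  proof (rule extensionalityI)
    show "h1 \<in> extensional (characters X)" "h2 \<in> extensional (characters X)"
      using that by simp_all
    show "h1 \<phi> = h2 \<phi>" if "\<phi> \<in> characters X" for \<phi>
      by (rule continuous_maps_alpha_agree[OF X K, of h1 h2, OF _ _ _ that])
        (use \<open>?P h1\<close> \<open>?P h2\<close> in simp_all)
  qed
  have "alpha_extend X K f = restrict h (characters X)"
    unfolding alpha_extend_def by (rule the_equality[where P = ?P, OF 1]) (rule 2[OF _ 1])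
  then show ?thesis using \<phi> by simp
qed

lemma character_bound:
  assumes X: "G_space X" and \<phi>: "\<phi> \<in> characters X" and p: "p \<in> C_G X"
    and B: "\<And>x. x \<in> points X \<Longrightarrow> cmod (p x) \<le> B"
  shows "cmod (\<phi> p) \<le> B"
proof -
  obtain F where F: "represents X F \<phi>"
    using character_imp_represents[OF X \<phi>] .
  show ?thesis
  proof (rule tendsto_upperbound)
    show "((\<lambda>x. cmod (p x)) \<longlongrightarrow> cmod (\<phi> p)) F"
      by (intro tendsto_intros representsD[OF F] p)
    show "eventually (\<lambda>x. cmod (p x) \<le> B) F"
      using representsD(2)[OF F] by eventually_elim (rule B)
  qed (rule representsD[OF F])
qed

text \<open>The characters form a closed subset of a product of discs, whose radii bound the
  functions. Closedness holds law by law, since each algebraic law equates two continuous functions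
  of \<phi>.\<close>

lemma compact_alpha:
  assumes X: "G_space X"
  shows "compact_space (space_of (alpha X))"
proof -
  let ?T = "product_topology (\<lambda>_. euclidean) (C_G X) :: (('b \<Rightarrow> complex) \<Rightarrow> complex) topology"
  have "\<exists>B. \<forall>x\<in>points X. cmod (p x) \<le> B" if "p \<in> C_G X" for p
    using C_G_D(2)[OF X that] by (auto simp: bounded_iff)
  then obtain B where B: "\<And>p x. p \<in> C_G X \<Longrightarrow> x \<in> points X \<Longrightarrow> cmod (p x) \<le> B p"
    by metis
  have ev: "continuous_map ?T euclidean (\<lambda>\<phi>. \<phi> p)" if "p \<in> C_G X" for p
    using that by (rule continuous_map_product_projection)
  have "\<phi> \<in> characters X" if \<phi>: "\<phi> \<in> ?T closure_of characters X" for \<phi>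
  proof -
    note eq = forall_in_closure_of_eq[OF \<phi> Hausdorff_space_euclidean]
    have "\<phi> \<in> extensional (C_G X)"
      using in_closure_of[THEN iffD1, OF \<phi>] by (simp add: PiE_def)
    moreover have "\<phi> (\<lambda>x. p x + q x) = \<phi> p + \<phi> q" "\<phi> (\<lambda>x. p x * q x) = \<phi> p * \<phi> q"
      if "p \<in> C_G X" "q \<in> C_G X" for p q
    proof -
      show "\<phi> (\<lambda>x. p x + q x) = \<phi> p + \<phi> q"
      proof (rule eq)
        show "continuous_map ?T euclidean (\<lambda>\<phi>. \<phi> p + \<phi> q)"
          by (intro continuous_map_add ev that)
      qed (use that C_G_add[OF X that] in \<open>auto simp: characters_def intro: ev\<close>)
      show "\<phi> (\<lambda>x. p x * q x) = \<phi> p * \<phi> q"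
      proof (rule eq)
        show "continuous_map ?T euclidean (\<lambda>\<phi>. \<phi> p * \<phi> q)"
          by (intro continuous_map_euclidean_comp2[where f = "\<lambda>z. fst z * snd z", simplified] ev that continuous_intros)
      qed (use that C_G_mult[OF X that] in \<open>auto simp: characters_def intro: ev\<close>)
    qed
    moreover have "\<phi> (\<lambda>x. c * p x) = c * \<phi> p" if "p \<in> C_G X" for p c
    proof (rule eq)
      show "continuous_map ?T euclidean (\<lambda>\<phi>. c * \<phi> p)"
        by (intro continuous_map_euclidean_comp[where f = "\<lambda>z. c * z"] ev that continuous_intros)
    qed (use that C_G_cmult[OF X that] in \<open>auto simp: characters_def intro: ev\<close>)
    moreover have "\<phi> (on_points X (\<lambda>_. 1)) = 1" 
    proof (rule eq)
      show "continuous_map ?T euclidean (\<lambda>\<phi>. 1 :: complex)"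
        by (rule continuous_map_canonical_const)
    qed (use C_G_const[OF X] in \<open>auto simp: characters_def intro: ev\<close>)
    ultimately show ?thesis
      unfolding characters_def by blast
  qed
  then have "closedin ?T (characters X)"
  proof -
    have "characters X \<subseteq> topspace ?T"
      by (auto simp: characters_def PiE_def)
    moreover have "?T closure_of characters X \<subseteq> characters X"
      by (rule subsetI) fact
    ultimately have "?T closure_of characters X = characters X"
      using closure_of_subset[of "characters X" ?T] by blast
    then show ?thesis
      by (simp add: closure_of_eq)
  qed
  moreover have "characters X \<subseteq> PiE (C_G X) (\<lambda>p. cball 0 (B p))"
    using character_bound[OF X] B by (auto simp: PiE_def characters_def)
  moreover have "compactin ?T (PiE (C_G X) (\<lambda>p. cball 0 (B p)))"
    by (simp add: compactin_PiE)
  ultimately have "compactin ?T (characters X)"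
    using closed_compactin by blast
  then show ?thesis
    unfolding alpha_def by (simp add: compact_space_subtopology)
qed

text \<open>Translation is a right action on functions, which makes the action on characters a left
  action.\<close>

lemma translate_translate:
  assumes "G_space X"
  shows "translate X (translate X p g) h = translate X p (g + h)"
  using assms by (auto simp: translate_def on_points_def act_add)

lemma translate_0:
  assumes "G_space X" "p \<in> C_G X"
  shows "translate X p 0 = p"
  using assms C_G_D(3)[OF assms] by (auto simp: translate_def on_points_def)

lemma represents_act_alpha:
  assumes X: "G_space X" and F: "represents X F \<phi>"
  shows "represents X (filtermap (act X g) F) (act (alpha X) g \<phi>)"
  unfolding represents_def
proof (intro conjI ballI)
  show "filtermap (act X g) F \<noteq> bot"
    using representsD(1)[OF F] by (simp add: filtermap_bot_iff)
  show "eventually (\<lambda>x. x \<in> points X) (filtermap (act X g) F)"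
    unfolding eventually_filtermap using representsD(2)[OF F] by eventually_elim (simp add: X)
  fix p assume p: "p \<in> C_G X"
  have "(translate X p g \<longlongrightarrow> \<phi> (translate X p g)) F"
    by (rule representsD(3)[OF F C_G_translate[OF X p]])
  moreover have "eventually (\<lambda>x. translate X p g x = p (act X g x)) F"
    using representsD(2)[OF F] by eventually_elim (simp add: translate_def)
  ultimately have "((\<lambda>x. p (act X g x)) \<longlongrightarrow> \<phi> (translate X p g)) F"
    by (rule Lim_transform_eventually)
  then show "(p \<longlongrightarrow> act (alpha X) g \<phi> p) (filtermap (act X g) F)"
    using p by (simp add: act_alpha filterlim_filtermap)
qed (simp add: act_alpha)

lemma act_alpha_character: 
  assumes X: "G_space X" and \<phi>: "\<phi> \<in> characters X"
  shows "act (alpha X) g \<phi> \<in> characters X"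
  using character_imp_represents[OF X \<phi>] represents_act_alpha[OF X] represents_imp_character[OF X]
  by metis

lemma act_alpha_unit: 
  assumes X: "G_space X" and x: "x \<in> points X"
  shows "act (alpha X) g (alpha_unit X x) = alpha_unit X (act X g x)"
proof
  fix p
  show "act (alpha X) g (alpha_unit X x) p = alpha_unit X (act X g x) p"
    using C_G_translate[OF X, of p g] x by (simp add: act_alpha alpha_unit_def translate_def)
qed

lemma character_diff:
  assumes X: "G_space X" and \<phi>: "\<phi> \<in> characters X" and p: "p \<in> C_G X" and q: "q \<in> C_G X"
  shows "\<phi> p - \<phi> q = \<phi> (\<lambda>x. p x - q x)" "(\<lambda>x. p x - q x) \<in> C_G X"
proof -
  have c: "(\<lambda>x. (- 1) * q x) \<in> C_G X"
    by (rule C_G_cmult[OF X q])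
  have *: "(\<lambda>x. p x + (- 1) * q x) = (\<lambda>x. p x - q x)"
    by auto
  show "(\<lambda>x. p x - q x) \<in> C_G X"
    using C_G_add[OF X p c] by (simp only: *)
  have "\<phi> (\<lambda>x. p x + (- 1) * q x) = \<phi> p + \<phi> (\<lambda>x. (- 1) * q x)"
    using \<phi> p c by (simp only: characters_def mem_Collect_eq)
  also have "\<phi> (\<lambda>x. (- 1) * q x) = (- 1) * \<phi> q"
    using \<phi> q by (simp only: characters_def mem_Collect_eq)
  finally show "\<phi> p - \<phi> q = \<phi> (\<lambda>x. p x - q x)"
    by (simp only: *) simp
qed

lemma character_diff_bound:
  assumes X: "G_space X" and \<phi>: "\<phi> \<in> characters X" and p: "p \<in> C_G X" and q: "q \<in> C_G X"
    and B: "\<And>x. x \<in> points X \<Longrightarrow> cmod (p x - q x) \<le> B"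
  shows "cmod (\<phi> p - \<phi> q) \<le> B"
  unfolding character_diff(1)[OF X \<phi> p q]
  by (rule character_bound[OF X \<phi> character_diff(2)[OF X \<phi> p q] B])

lemma continuous_map_euclideanI:
  fixes f :: "'a \<Rightarrow> 'b::metric_space"
  assumes "\<And>x e. x \<in> topspace T \<Longrightarrow> e > 0 \<Longrightarrow> \<exists>U. openin T U \<and> x \<in> U \<and> (\<forall>y\<in>U. dist (f x) (f y) < e)"
  shows "continuous_map T euclidean f"
  using assms Met_TC.continuous_map_to_metric[of T f] by (simp add: mball_eq_ball)

lemma continuous_map_euclideanD:
  fixes f :: "'a \<Rightarrow> 'b::metric_space"
  assumes "continuous_map T euclidean f" "x \<in> topspace T" "e > 0"
  obtains U where "openin T U" "x \<in> U" "\<And>y. y \<in> U \<Longrightarrow> dist (f x) (f y) < e"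
proof -
  have "\<exists>U. openin T U \<and> x \<in> U \<and> (\<forall>y\<in>U. dist (f x) (f y) < e)"
    using assms Met_TC.continuous_map_to_metric[of T f] by (simp add: mball_eq_ball)
  then show thesis
    using that by blast
qed

text \<open>Joint continuity of the action is where norm continuity of the translates matters: it
  makes \<psi>(pg) close to \<psi>(ph) uniformly in the character \<psi>, so only continuity of the
  evaluation at the fixed function ph remains.\<close>

lemma G_flow_alpha:
  fixes X :: "('g::{topological_group_add, t2_space}, 'x) gspace"
  assumes X: "G_space X"
  shows "G_flow (alpha X)"
  unfolding G_flow_def G_space_def
proof (intro conjI allI ballI)
  show "continuous_map (prod_topology euclidean (space_of (alpha X))) (space_of (alpha X)) 
    (\<lambda>(g, x). act (alpha X) g x)"
    unfolding continuous_map_into_alpha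
  proof (intro conjI ballI)
    show "(\<lambda>(g, x). act (alpha X) g x) \<in> topspace (prod_topology euclidean (space_of (alpha X))) \<rightarrow> characters X"
      using act_alpha_character[OF X] by auto
    fix p assume p: "p \<in> C_G X"
    note tp = C_G_translate[OF X p]
    have "continuous_map (prod_topology euclidean (space_of (alpha X))) euclidean
      (\<lambda>z. snd z (translate X p (fst z)))"
    proof (rule continuous_map_euclideanI)
      fix z :: "'g \<times> (('x \<Rightarrow> complex) \<Rightarrow> complex)" and e :: real
      assume z: "z \<in> topspace (prod_topology euclidean (space_of (alpha X)))" and "e > 0"
      obtain h \<phi> where z_eq: "z = (h, \<phi>)" by (cases z)
      then have \<phi>: "\<phi> \<in> characters X" using z by simp
      have e2: "e / 2 > 0" using \<open>e > 0\<close> by simp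
      obtain U where U: "openin (space_of (alpha X)) U" "\<phi> \<in> U" 
        "\<And>\<psi>. \<psi> \<in> U \<Longrightarrow> dist (\<phi> (translate X p h)) (\<psi> (translate X p h)) < e / 2"
        using continuous_map_euclideanD[OF continuous_map_alpha_eval[OF tp] _ e2, of \<phi>] \<phi> by auto
      have "((\<lambda>g. g - h) \<longlongrightarrow> h - h) (nhds h)"
        by (intro tendsto_intros) (simp add: filterlim_ident)
      then have "filterlim (\<lambda>g. g - h) (nhds 0) (nhds h)" by simp
      with C_G_D(4)[OF X p e2]
      have "eventually (\<lambda>g. \<forall>x\<in>points X. cmod (p (act X (g - h) x) - p x) \<le> e / 2) (nhds h)"
        by (rule eventually_compose_filterlim)
      then obtain N where N: "open N" "h \<in> N" 
        "\<And>g x. g \<in> N \<Longrightarrow> x \<in> points X \<Longrightarrow> cmod (p (act X (g - h) x) - p x) \<le> e / 2"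
        unfolding eventually_nhds by blast
      have NU: "dist (\<phi> (translate X p h)) (\<psi> (translate X p g)) < e" if "g \<in> N" "\<psi> \<in> U" for g \<psi>
      proof -
        have \<psi>: "\<psi> \<in> characters X"
          using U(1) that(2) openin_subset by fastforce
        have "cmod (\<psi> (translate X p g) - \<psi> (translate X p h)) \<le> e / 2"
        proof (rule character_diff_bound[OF X \<psi> tp tp])
          fix x assume x: "x \<in> points X"
          have "act X (g - h) (act X h x) = act X g x"
            using act_add[OF X x, of "g - h" h] by simp
          then show "cmod (translate X p g x - translate X p h x) \<le> e / 2"
            using N(3)[OF that(1), of "act X h x"] x X by (simp add: translate_def)
        qed
        then have "dist (\<psi> (translate X p g)) (\<psi> (translate X p h)) \<le> e / 2"
          by (simp add: dist_norm)
        with U(3)[OF that(2)] show ?thesis 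
          using dist_triangle2[of "\<phi> (translate X p h)" "\<psi> (translate X p g)" "\<psi> (translate X p h)"]
          by linarith
      qed
      show "\<exists>U. openin (prod_topology euclidean (space_of (alpha X))) U \<and> z \<in> U \<and>
        (\<forall>y\<in>U. dist (snd z (translate X p (fst z))) (snd y (translate X p (fst y))) < e)"
      proof (intro exI[of _ "N \<times> U"] conjI ballI)
        show "openin (prod_topology euclidean (space_of (alpha X))) (N \<times> U)"
          using N(1) U(1) by (simp add: openin_prod_Times_iff)
      qed (use N(2) U(2) NU in \<open>auto simp: z_eq\<close>)
    qed
    then show "continuous_map (prod_topology euclidean (space_of (alpha X))) euclidean
      (\<lambda>t. (case t of (g, x) \<Rightarrow> act (alpha X) g x) p)"
      using p by (simp add: act_alpha case_prod_unfold)
  qed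
next
  fix \<phi> assume "\<phi> \<in> points (alpha X)"
  then have "\<phi> \<in> extensional (C_G X)"
    by (simp add: characters_def)
  then show "act (alpha X) 0 \<phi> = \<phi>"
    by (auto simp: act_alpha translate_0[OF X] intro!: extensionalityI[of _ "C_G X"])
next
  fix g h \<phi>
  show "act (alpha X) (g + h) \<phi> = act (alpha X) g (act (alpha X) h \<phi>)"
    by (auto simp: act_alpha translate_translate[OF X] C_G_translate[OF X])
qed (auto simp: Hausdorff_alpha compact_alpha[OF X])

lemma continuous_map_alpha_unit:
  assumes X: "G_space X"
  shows "continuous_map (space_of X) (space_of (alpha X)) (alpha_unit X)"
  unfolding continuous_map_into_alpha using C_G_D(1)[OF X] alpha_unit_character[OF X] by auto

text \<open>On a compact space the tube lemma turns pointwise continuity of the action at the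
  identity into a neighbourhood that works for all points at once.\<close>

lemma C_G_flow:
  assumes X: "G_flow X" and p: "continuous_map (space_of X) euclidean p"
  shows "on_points X p \<in> C_G X"
proof -
  have GX: "G_space X" and cX: "compact_space (space_of X)"
    using X by (auto simp: G_flow_def)
  have "compactin (space_of X) (points X)"
    using cX by (simp add: compact_space_def)
  then have "compact (p ` points X)"
    using image_compactin[OF _ p] by fastforce
  then obtain B where B: "\<And>x. x \<in> points X \<Longrightarrow> cmod (p x) \<le> B"
    using compact_imp_bounded[of "p ` points X"] by (auto simp: bounded_iff)
  have cont: "continuous_map (space_of X) euclidean (on_points X p)"
    using p by (rule continuous_map_eq) simp
  show ?thesis
  proof (rule C_G_I[OF GX cont, of B])
    fix e :: real assume "e > 0"
    let ?T = "prod_topology euclidean (space_of X)"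
    have "continuous_map ?T (space_of X) (\<lambda>z. act X (fst z) (snd z))"
      using GX by (simp add: G_space_def case_prod_unfold)
    then have "continuous_map ?T euclidean (p \<circ> (\<lambda>z. act X (fst z) (snd z)))"
      using p by (rule continuous_map_compose)
    moreover have "continuous_map ?T euclidean (p \<circ> snd)"
      using p by (intro continuous_map_compose[OF continuous_map_snd])
    ultimately have "continuous_map ?T euclideanreal (\<lambda>z. cmod (p (act X (fst z) (snd z)) - p (snd z)))"
      by (intro continuous_intros) (auto simp: o_def)
    then have op: "openin ?T {z \<in> topspace ?T. cmod (p (act X (fst z) (snd z)) - p (snd z)) \<in> {..<e}}"
      by (rule openin_continuous_map_preimage) simp
    have sub: "{0} \<times> points X \<subseteq> {z \<in> topspace ?T. cmod (p (act X (fst z) (snd z)) - p (snd z)) \<in> {..<e}}"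
      using GX \<open>e > 0\<close> by auto
    obtain U V where UV: "openin euclidean U" "0 \<in> U" "points X \<subseteq> V"
      "U \<times> V \<subseteq> {z \<in> topspace ?T. cmod (p (act X (fst z) (snd z)) - p (snd z)) \<in> {..<e}}"
      using tube_lemma_right[OF op \<open>compactin (space_of X) (points X)\<close> _ sub] by auto
    show "eventually (\<lambda>g. \<forall>x\<in>points X. cmod (on_points X p (act X g x) - on_points X p x) \<le> e) (nhds 0)"
      unfolding eventually_nhds using UV GX by (intro exI[of _ U]) force
  qed (auto simp: B)
qed

text \<open>This is surjectivity of the Gelfand transform. A continuous function on the flow
  \<open>alpha X\<close> is automatically in its C_G by compactness; its pullback along the
  equivariant map \<open>alpha_unit\<close> is therefore in C_G of \<open>X\<close>, and both sides
  of the evaluation formula agree on the dense image.\<close>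

lemma C_G_of_continuous_alpha:
  assumes X: "G_space X" and f: "continuous_map (space_of (alpha X)) euclidean f"
  shows "on_points X (\<lambda>x. f (alpha_unit X x)) \<in> C_G X" (is "?p \<in> _")
    and "\<phi> \<in> characters X \<Longrightarrow> \<phi> (on_points X (\<lambda>x. f (alpha_unit X x))) = f \<phi>"
proof -
  have GA: "G_space (alpha X)"
    using G_flow_alpha[OF X] by (simp add: G_flow_def)
  have fC: "on_points (alpha X) f \<in> C_G (alpha X)"
    by (rule C_G_flow[OF G_flow_alpha[OF X] f])
  have unit: "alpha_unit X x \<in> points (alpha X)" if "x \<in> points X" for x
    using alpha_unit_character[OF X that] by simp
  obtain B where B: "\<And>\<phi>. \<phi> \<in> characters X \<Longrightarrow> cmod (f \<phi>) \<le> B"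
    using C_G_D(2)[OF GA fC] by (auto simp: bounded_iff)
  have "continuous_map (space_of X) euclidean (f \<circ> alpha_unit X)"
    using continuous_map_alpha_unit[OF X] f by (rule continuous_map_compose)
  then have cont: "continuous_map (space_of X) euclidean ?p"
    by (rule continuous_map_eq) simp
  show p: "?p \<in> C_G X"
  proof (rule C_G_I[OF X cont, of B])
    fix e :: real assume "e > 0"
    from C_G_D(4)[OF GA fC this]
    show "eventually (\<lambda>g. \<forall>x\<in>points X. cmod (?p (act X g x) - ?p x) \<le> e) (nhds 0)"
    proof eventually_elim
      case (elim g)
      show ?case
      proof
        fix x assume x: "x \<in> points X"
        then show "cmod (?p (act X g x) - ?p x) \<le> e"
          using elim[rule_format, OF unit[OF x]] unit X by (simp add: act_alpha_unit alpha_unit_character)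
      qed
    qed
  qed (use B alpha_unit_character[OF X] in auto)
  show "\<phi> ?p = f \<phi>" if "\<phi> \<in> characters X"
    by (rule continuous_maps_alpha_agree[OF X _ continuous_map_alpha_eval[OF p] f _ that])
      (simp_all add: p)
qed

text \<open>The tool for lifting functions from an ultracoproduct, a closed subset of the
  compactification, to functions on the disjoint sum without leaving the unit interval.\<close>

lemma Tietze_alpha:
  assumes X: "G_space X" and S: "closedin (space_of (alpha X)) S"
    and f: "continuous_map (subtopology (space_of (alpha X)) S) euclideanreal f" "f ` S \<subseteq> {0..1}"
  obtains r :: "'x \<Rightarrow> real" where "\<And>x. r x \<in> {0..1}" "(\<lambda>x. of_real (r x)) \<in> C_G (X :: ('g::{topological_group_add, t2_space}, 'x) gspace)"
    "\<And>\<phi>. \<phi> \<in> S \<Longrightarrow> \<phi> (\<lambda>x. of_real (r x)) = of_real (f \<phi>)"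
proof -
  have "normal_space (space_of (alpha X))"
    using compact_alpha[OF X] Hausdorff_alpha compact_Hausdorff_or_regular_imp_normal_space by blast
  then obtain h where h: "continuous_map (space_of (alpha X)) euclideanreal h"
    "\<And>x. x \<in> S \<Longrightarrow> h x = f x" "h ` topspace (space_of (alpha X)) \<subseteq> {0..1}"
    using Tietze_extension_closed_real_interval[OF _ S f] by auto
  have hc: "continuous_map (space_of (alpha X)) euclidean (\<lambda>\<phi>. of_real (h \<phi>) :: complex)"
    by (rule continuous_map_euclidean_comp[OF _ h(1)]) (intro continuous_intros)
  \<comment> \<open>The default value 0 lies in the unit interval, so the bound on \<open>r\<close>
    holds on the whole type.\<close>
  define r where "r = on_points X (\<lambda>x. h (alpha_unit X x))"
  have eq: "(\<lambda>x. of_real (r x)) = on_points X (\<lambda>x. of_real (h (alpha_unit X x)) :: complex)"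
    by (auto simp: r_def on_points_def)
  show thesis
  proof (rule that[of r])
    show "r x \<in> {0..1}" for x
      using h(3) alpha_unit_character[OF X] by (cases "x \<in> points X") (simp_all add: r_def image_subset_iff)
    show "(\<lambda>x. of_real (r x)) \<in> C_G X"
      unfolding eq by (rule C_G_of_continuous_alpha[OF X hc])
    show "\<phi> (\<lambda>x. of_real (r x)) = of_real (f \<phi>)" if "\<phi> \<in> S" for \<phi>
      using C_G_of_continuous_alpha(2)[OF X hc, of \<phi>] h(2)[OF that] closedin_subset[OF S] that
      unfolding eq by auto
  qed
qed

section \<open>Disjoint sums of G-spaces\<close>

lemma points_sum_gspace [simp]: "points (sum_gspace I X) = (SIGMA i:I. points (X i))"
  by (auto simp: sum_gspace_def)

lemma act_sum_gspace [simp]: "act (sum_gspace I X) g (i, x) = (i, act (X i) g x)"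
  by (simp add: sum_gspace_def)

lemma fst_act_sum_gspace [simp]: "fst (act (sum_gspace I X) g z) = fst z"
  by (cases z) simp

lemma openin_sum_topology_slice:
  assumes "i \<in> I" "openin (X i) U"
  shows "openin (sum_topology X I) ({i} \<times> U)"
proof -
  have "{x. (j, x) \<in> {i} \<times> U} = (if j = i then U else {})" for j
    by auto
  then show ?thesis
    using assms openin_subset[OF assms(2)] by (auto simp: openin_sum_topology)
qed

lemma continuous_map_from_sum_topology:
  "continuous_map (sum_topology X I) Y f \<longleftrightarrow> (\<forall>i\<in>I. continuous_map (X i) Y (\<lambda>x. f (i, x)))"
proof
  assume f: "continuous_map (sum_topology X I) Y f"
  show "\<forall>i\<in>I. continuous_map (X i) Y (\<lambda>x. f (i, x))"
  proof
    fix i assume "i \<in> I"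
    then have "continuous_map (X i) Y (f \<circ> (\<lambda>x. (i, x)))"
      by (rule continuous_map_compose[OF continuous_map_component_injection f])
    then show "continuous_map (X i) Y (\<lambda>x. f (i, x))"
      by (simp add: o_def)
  qed
next
  assume f: "\<forall>i\<in>I. continuous_map (X i) Y (\<lambda>x. f (i, x))"
  show "continuous_map (sum_topology X I) Y f"
    unfolding continuous_map_def
  proof (intro conjI allI impI)
    show "f \<in> topspace (sum_topology X I) \<rightarrow> topspace Y"
      using f by (fastforce simp: continuous_map_def Pi_iff)
    fix U assume U: "openin Y U"
    have "openin (X i) {x. (i, x) \<in> {z \<in> topspace (sum_topology X I). f z \<in> U}}" if "i \<in> I" for i
    proof -
      have "openin (X i) {x \<in> topspace (X i). f (i, x) \<in> U}"
        using f that U by (auto simp: continuous_map_def)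
      moreover have "{x. (i, x) \<in> {z \<in> topspace (sum_topology X I). f z \<in> U}} = {x \<in> topspace (X i). f (i, x) \<in> U}"
        using that by auto
      ultimately show ?thesis by (simp only:)
    qed
    then show "openin (sum_topology X I) {z \<in> topspace (sum_topology X I). f z \<in> U}"
      unfolding openin_sum_topology by auto
  qed
qed

lemma Hausdorff_space_sum_topology:
  assumes "\<And>i. i \<in> I \<Longrightarrow> Hausdorff_space (X i)"
  shows "Hausdorff_space (sum_topology X I)"
  unfolding Hausdorff_space_def
proof (intro allI impI, elim conjE)
  fix a b assume ab: "a \<in> topspace (sum_topology X I)" "b \<in> topspace (sum_topology X I)" "a \<noteq> b"
  obtain i x j y where eq: "a = (i, x)" "b = (j, y)" by (metis surj_pair)
  then have ix: "i \<in> I" "j \<in> I" "x \<in> topspace (X i)" "y \<in> topspace (X j)" using ab by auto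
  show "\<exists>U V. openin (sum_topology X I) U \<and> openin (sum_topology X I) V \<and> a \<in> U \<and> b \<in> V \<and> disjnt U V"
  proof (cases "i = j")
    case True
    then have "x \<noteq> y" using ab(3) eq by simp
    then obtain U V where UV: "openin (X i) U" "openin (X i) V" "x \<in> U" "y \<in> V" "disjnt U V"
      using assms[OF ix(1)] ix True unfolding Hausdorff_space_def by metis
    have "disjnt ({i} \<times> U) ({i} \<times> V)"
      using UV(5) by (auto simp: disjnt_def)
    then show ?thesis
      using openin_sum_topology_slice[OF ix(1)] UV True eq by (metis SigmaI singletonI)
  next
    case False
    then have "disjnt ({i} \<times> topspace (X i)) ({j} \<times> topspace (X j))"
      by (auto simp: disjnt_def)
    then show ?thesis
      using openin_sum_topology_slice[OF ix(1) openin_topspace] openin_sum_topology_slice[OF ix(2) openin_topspace] ix eq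
      by (metis SigmaI singletonI)
  qed
qed

text \<open>Joint continuity is local in the summand: a neighbourhood found for the action on
  \<open>X i\<close> gives one for the sum because \<open>{i} \<times> V\<close> is open
  there.\<close>

lemma G_space_sum:
  fixes X :: "'i \<Rightarrow> ('g::{topological_group_add, t2_space}, 'x) gspace"
  assumes X: "\<forall>i\<in>I. G_space (X i)"
  shows "G_space (sum_gspace I X)"
  unfolding G_space_def
proof (intro conjI ballI allI)
  let ?S = "space_of (sum_gspace I X)"
  have S: "?S = sum_topology (\<lambda>i. space_of (X i)) I"
    by (simp add: sum_gspace_def)
  show "Hausdorff_space ?S"
    unfolding S by (rule Hausdorff_space_sum_topology) (use X in \<open>simp add: G_space_def\<close>)
  have "\<exists>W. openin (prod_topology euclidean ?S) W \<and> (g, i, x) \<in> W \<and>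
      W \<subseteq> {z \<in> topspace (prod_topology euclidean ?S). act (sum_gspace I X) (fst z) (snd z) \<in> U}"
    if U: "openin ?S U" and i: "i \<in> I" and x: "x \<in> points (X i)" and m: "(i, act (X i) g x) \<in> U" for U g i x
  proof -
    have "openin (space_of (X i)) {y. (i, y) \<in> U}"
      using U i unfolding S openin_sum_topology by auto
    moreover have "continuous_map (prod_topology euclidean (space_of (X i))) (space_of (X i)) (\<lambda>(g, x). act (X i) g x)"
      using bspec[OF X i] by (simp add: G_space_def)
    ultimately have op: "openin (prod_topology euclidean (space_of (X i)))
        {z \<in> topspace (prod_topology euclidean (space_of (X i))). (\<lambda>(g, x). act (X i) g x) z \<in> {y. (i, y) \<in> U}}"
      by (rule openin_continuous_map_preimage[rotated])
    then obtain N V where NV: "openin euclidean N" "openin (space_of (X i)) V" "g \<in> N" "x \<in> V"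
      "N \<times> V \<subseteq> {z \<in> topspace (prod_topology euclidean (space_of (X i))). (\<lambda>(g, x). act (X i) g x) z \<in> {y. (i, y) \<in> U}}"
    proof -
      have "(g, x) \<in> {z \<in> topspace (prod_topology euclidean (space_of (X i))). (\<lambda>(g, x). act (X i) g x) z \<in> {y. (i, y) \<in> U}}"
        using m x by simp
      then show thesis
        using op[unfolded openin_prod_topology_alt, THEN spec, THEN spec, THEN mp] that by blast
    qed
    have "openin (prod_topology euclidean ?S) (N \<times> ({i} \<times> V))"
      unfolding openin_prod_Times_iff S using NV(1) openin_sum_topology_slice[of i I "\<lambda>i. space_of (X i)" V] i NV(2) by simp
    moreover have "N \<times> ({i} \<times> V) \<subseteq> {z \<in> topspace (prod_topology euclidean ?S). act (sum_gspace I X) (fst z) (snd z) \<in> U}"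
      using NV(5) i by auto
    ultimately show ?thesis using NV(3,4) by blast
  qed
  then have op: "openin (prod_topology euclidean ?S)
      {z \<in> topspace (prod_topology euclidean ?S). act (sum_gspace I X) (fst z) (snd z) \<in> U}" if "openin ?S U" for U
    using that by (subst openin_subopen) auto
  show "continuous_map (prod_topology euclidean ?S) ?S (\<lambda>(g, x). act (sum_gspace I X) g x)"
    unfolding continuous_map_def case_prod_unfold
    using op X by auto
next
  fix z assume "z \<in> points (sum_gspace I X)"
  then show "act (sum_gspace I X) 0 z = z" using X by auto
next
  fix g h z assume "z \<in> points (sum_gspace I X)"
  then show "act (sum_gspace I X) (g + h) z = act (sum_gspace I X) g (act (sum_gspace I X) h z)" 
    using X act_add by fastforce
qed

text \<open>The last premise asks for a neighbourhood of the identity that serves all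
  \<open>i\<close> simultaneously. Membership of each slice in its own C_G does not give this, and
  the difficulty of the whole proof lies here.\<close>

lemma C_G_sum_I:
  assumes X: "\<forall>i\<in>I. G_space (X i)"
    and cont: "\<And>i. i \<in> I \<Longrightarrow> continuous_map (space_of (X i)) euclidean (\<lambda>x. p (i, x))"
    and B: "\<And>i x. i \<in> I \<Longrightarrow> x \<in> points (X i) \<Longrightarrow> cmod (p (i, x)) \<le> B"
    and z: "\<And>i x. i \<notin> I \<or> x \<notin> points (X i) \<Longrightarrow> p (i, x) = 0"
    and e: "\<And>e. e > 0 \<Longrightarrow> eventually (\<lambda>g. \<forall>i\<in>I. \<forall>x\<in>points (X i). cmod (p (i, act (X i) g x) - p (i, x)) \<le> e) (nhds 0)"
  shows "p \<in> C_G (sum_gspace I X)"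
proof (rule C_G_I[OF G_space_sum[OF X], of _ B])
  show "continuous_map (space_of (sum_gspace I X)) euclidean p"
    using cont by (simp add: sum_gspace_def continuous_map_from_sum_topology)
  show "eventually (\<lambda>g. \<forall>x\<in>points (sum_gspace I X). cmod (p (act (sum_gspace I X) g x) - p x) \<le> e) (nhds 0)"
    if "e > 0" for e
    using e[OF that] by eventually_elim auto
qed (use B z in auto)

lemma C_G_sum_slice:
  assumes X: "\<forall>i\<in>I. G_space (X i)" and p: "p \<in> C_G (sum_gspace I X)" and i: "i \<in> I"
  shows "(\<lambda>x. p (i, x)) \<in> C_G (X i)"
proof -
  note D = C_G_D[OF G_space_sum[OF X] p]
  obtain B where B: "\<And>z. z \<in> points (sum_gspace I X) \<Longrightarrow> cmod (p z) \<le> B"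
    using D(2) by (auto simp: bounded_iff)
  show ?thesis
  proof (rule C_G_I[OF bspec[OF X i], of _ B])
    show "continuous_map (space_of (X i)) euclidean (\<lambda>x. p (i, x))"
      using D(1) i by (simp add: sum_gspace_def continuous_map_from_sum_topology)
    show "eventually (\<lambda>g. \<forall>x\<in>points (X i). cmod (p (i, act (X i) g x) - p (i, x)) \<le> e) (nhds 0)" if "e > 0" for e
      using D(4)[OF that] by eventually_elim (use i in force)
  qed (use B D(3) i in auto)
qed

section \<open>The map to the space of ultrafilters\<close>

lemma topspace_beta [simp]: "topspace (beta I) = ultrafilters_on I"
  by (auto simp: beta_def topology_generated_by_topspace ultrafilters_on_def)

lemma Hausdorff_beta: "Hausdorff_space (beta I)"
  unfolding Hausdorff_space_def
proof (intro allI impI, elim conjE)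
  fix U V assume UV: "U \<in> topspace (beta I)" "V \<in> topspace (beta I)" "U \<noteq> V"
  then obtain P where P: "eventually P U \<noteq> eventually P V"
    by (auto simp: filter_eq_iff)
  have *: "\<exists>A B. openin (beta I) A \<and> openin (beta I) B \<and> U \<in> A \<and> V \<in> B \<and> disjnt A B"
    if "U \<in> topspace (beta I)" "V \<in> topspace (beta I)" "eventually P U" "\<not> eventually P V" for U V
  proof -
    let ?N = "\<lambda>A. {\<U> \<in> ultrafilters_on I. eventually (\<lambda>i. i \<in> A) \<U>}"
    have op: "openin (beta I) (?N A)" if "A \<subseteq> I" for A
      unfolding beta_def using that by (intro topology_generated_by_Basis) blast
    have "eventually (\<lambda>i. \<not> P i) V" "eventually (\<lambda>i. i \<in> I) U" "eventually (\<lambda>i. i \<in> I) V"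
      using that by (auto simp: ultrafilters_on_def)
    then have "U \<in> ?N {i\<in>I. P i}" "V \<in> ?N {i\<in>I. \<not> P i}"
      using that by (auto intro: eventually_conj)
    moreover have "disjnt (?N {i\<in>I. P i}) (?N {i\<in>I. \<not> P i})"
      unfolding disjnt_iff
    proof (intro allI notI, elim conjE)
      fix W assume "W \<in> ?N {i\<in>I. P i}" "W \<in> ?N {i\<in>I. \<not> P i}"
      then have "eventually (\<lambda>i. i \<in> {i\<in>I. P i}) W" "eventually (\<lambda>i. i \<in> {i\<in>I. \<not> P i}) W" "W \<noteq> bot"
        by (auto simp: ultrafilters_on_def)
      from eventually_conj[OF this(1,2)] have "eventually (\<lambda>i. False) W"
        by (rule eventually_mono) blast
      then show False using \<open>W \<noteq> bot\<close> by simp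
    qed
    ultimately show ?thesis
      using op[of "{i\<in>I. P i}"] op[of "{i\<in>I. \<not> P i}"] by blast
  qed
  show "\<exists>A B. openin (beta I) A \<and> openin (beta I) B \<and> U \<in> A \<and> V \<in> B \<and> disjnt A B"
  proof (cases "eventually P U")
    case True
    then show ?thesis using *[of U V] UV P by blast
  next
    case False
    then show ?thesis using *[of V U] UV P by (metis disjnt_sym)
  qed
qed

text \<open>These idempotents are constant on every summand, hence invariant under the action.
  Through them a character of the sum sees subsets of the index set.\<close>

definition index_indicator :: "'i set \<Rightarrow> ('i \<Rightarrow> ('g, 'x) gspace) \<Rightarrow> ('i \<Rightarrow> bool) \<Rightarrow> 'i \<times> 'x \<Rightarrow> complex"
  where "index_indicator I X P = on_points (sum_gspace I X) (\<lambda>z. of_bool (P (fst z)))"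

lemma index_indicator_C_G:
  assumes X: "\<forall>i\<in>I. G_space (X i)"
  shows "index_indicator I X P \<in> C_G (sum_gspace I X)"
proof (rule C_G_sum_I[OF X, of _ 1])
  fix i assume i: "i \<in> I"
  show "continuous_map (space_of (X i)) euclidean (\<lambda>x. index_indicator I X P (i, x))"
    by (rule continuous_map_eq[OF continuous_map_canonical_const, of _ "of_bool (P i)"])
      (use i in \<open>simp add: index_indicator_def\<close>)
next
  fix e :: real assume "e > 0"
  then show "eventually (\<lambda>g. \<forall>i\<in>I. \<forall>x\<in>points (X i).
     cmod (index_indicator I X P (i, act (X i) g x) - index_indicator I X P (i, x)) \<le> e) (nhds 0)"
    using X by (intro always_eventually allI ballI) (simp add: index_indicator_def)
qed (auto simp: index_indicator_def)

text \<open>The limit of 0-1 values is 0 or 1, and values within distance less than 1 of it are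
  equal to it. So the filter of indices is an ultrafilter, determined by the character
  alone.\<close>

lemma index_indicator_represents:
  assumes X: "\<forall>i\<in>I. G_space (X i)" and F: "represents (sum_gspace I X) F \<phi>"
  shows "\<phi> (index_indicator I X P) = (if eventually P (filtermap fst F) then 1 else 0)"
    and "eventually P (filtermap fst F) \<or> eventually (\<lambda>i. \<not> P i) (filtermap fst F)"
proof -
  note C = index_indicator_C_G[OF X, of P]
  have lim: "(index_indicator I X P \<longlongrightarrow> \<phi> (index_indicator I X P)) F"
    by (rule representsD(3)[OF F C])
  have ev: "eventually (\<lambda>z. index_indicator I X P z = of_bool (P (fst z))) F"
    using representsD(2)[OF F] by eventually_elim (simp add: index_indicator_def)
  let ?l = "\<phi> (index_indicator I X P)"
  have l: "((\<lambda>z. of_bool (P (fst z)) :: complex) \<longlongrightarrow> ?l) F"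
    using lim ev by (rule Lim_transform_eventually)
  have "?l \<in> {0, 1}"
  proof (rule Lim_in_closed_set[OF _ _ representsD(1)[OF F] l])
    show "eventually (\<lambda>z. of_bool (P (fst z)) \<in> {0, 1::complex}) F"
      by (rule always_eventually) auto
  qed (auto intro: finite_imp_closed)
  then consider "?l = 1" | "?l = 0" by auto
  then have "(?l = 1 \<and> eventually (\<lambda>z. P (fst z)) F) \<or> (?l = 0 \<and> eventually (\<lambda>z. \<not> P (fst z)) F)"
  proof cases
    case 1
    have "eventually (\<lambda>z. dist (of_bool (P (fst z))) ?l < 1) F"
      by (rule tendstoD[OF l]) simp
    then have "eventually (\<lambda>z. P (fst z)) F"
      by eventually_elim (use 1 in \<open>auto split: if_splits simp: of_bool_def\<close>)
    then show ?thesis using 1 by simp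
  next
    case 2
    have "eventually (\<lambda>z. dist (of_bool (P (fst z))) ?l < 1) F"
      by (rule tendstoD[OF l]) simp
    then have "eventually (\<lambda>z. \<not> P (fst z)) F"
      by eventually_elim (use 2 in \<open>auto split: if_splits simp: of_bool_def\<close>)
    then show ?thesis using 2 by simp
  qed
  moreover have "\<not> (eventually (\<lambda>z. P (fst z)) F \<and> eventually (\<lambda>z. \<not> P (fst z)) F)"
  proof
    assume "eventually (\<lambda>z. P (fst z)) F \<and> eventually (\<lambda>z. \<not> P (fst z)) F"
    then have "eventually (\<lambda>z. False) F"
      by (auto elim: eventually_elim2)
    then show False using representsD(1)[OF F] by simp
  qed
  ultimately show "?l = (if eventually P (filtermap fst F) then 1 else 0)"
    and "eventually P (filtermap fst F) \<or> eventually (\<lambda>i. \<not> P i) (filtermap fst F)"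
    by (auto simp: eventually_filtermap)
qed

lemma represents_index_ultrafilter:
  assumes X: "\<forall>i\<in>I. G_space (X i)" and F: "represents (sum_gspace I X) F \<phi>"
  shows "filtermap fst F \<in> ultrafilters_on I"
proof -
  have "eventually (\<lambda>i. i \<in> I) (filtermap fst F)"
    unfolding eventually_filtermap using representsD(2)[OF F] by eventually_elim auto
  then show ?thesis
    using index_indicator_represents(2)[OF X F] representsD(1)[OF F]
    by (auto simp: ultrafilters_on_def filtermap_bot_iff)
qed

text \<open>The explicit extension is the image under \<open>fst\<close> of a chosen representing
  filter. The values of \<phi> on index indicators show that the choice does not matter, and they
  also give continuity.\<close>

lemma pi_index_represents:
  assumes X: "\<forall>i\<in>I. G_space (X i)" 
  shows "represents (sum_gspace I X) F \<phi> \<Longrightarrow> pi_index I X \<phi> = filtermap fst F"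
    and "continuous_map (space_of (alpha (sum_gspace I X))) (beta I) (pi_index I X)"
proof -
  let ?S = "sum_gspace I X"
  note S = G_space_sum[OF X]
  define h where "h = (\<lambda>\<phi>. filtermap fst (SOME F. represents ?S F \<phi>))"
  have h_eq: "h \<phi> = filtermap fst F" if F: "represents ?S F \<phi>" for F \<phi>
  proof -
    have F': "represents ?S (SOME F. represents ?S F \<phi>) \<phi>"
      using F by (rule someI)
    have "eventually P (h \<phi>) \<longleftrightarrow> eventually P (filtermap fst F)" for P
      using index_indicator_represents(1)[OF X F, of P] index_indicator_represents(1)[OF X F', of P]
      by (auto simp: h_def split: if_splits)
    then show ?thesis by (simp add: filter_eq_iff)
  qed
  have h_unit: "h (alpha_unit ?S z) = (\<lambda>(i, x). principal {i}) z" if "z \<in> points ?S" for z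
    using h_eq[OF represents_alpha_unit[OF that]] by (simp add: case_prod_unfold)
  have h_uf: "h \<phi> \<in> ultrafilters_on I" if \<phi>: "\<phi> \<in> characters ?S" for \<phi>
  proof -
    obtain F where F: "represents ?S F \<phi>" using character_imp_represents[OF S \<phi>] .
    show ?thesis unfolding h_eq[OF F] by (rule represents_index_ultrafilter[OF X F])
  qed
  have cont: "continuous_map (space_of (alpha ?S)) (beta I) h"
    unfolding beta_def
  proof (rule continuous_on_generated_topo)
    fix U assume "U \<in> {{\<U> \<in> ultrafilters_on I. eventually (\<lambda>i. i \<in> A) \<U>} | A. A \<subseteq> I}"
    then obtain A where A: "A \<subseteq> I" "U = {\<U> \<in> ultrafilters_on I. eventually (\<lambda>i. i \<in> A) \<U>}"
      by blast
    let ?p = "index_indicator I X (\<lambda>i. i \<in> A)"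
    \<comment> \<open>The value is 0 or 1, so lying in the open ball of radius 1 about 1 means being
      1; this makes the preimage of a basic open set open.\<close>
    have *: "eventually (\<lambda>i. i \<in> A) (h \<phi>) \<longleftrightarrow> \<phi> ?p \<in> ball 1 1" if \<phi>: "\<phi> \<in> characters ?S" for \<phi>
    proof -
      obtain F where F: "represents ?S F \<phi>" using character_imp_represents[OF S \<phi>] .
      show ?thesis
        using index_indicator_represents(1)[OF X F, of "\<lambda>i. i \<in> A"] h_eq[OF F]
        by (auto split: if_splits)
    qed
    have "h -` U \<inter> topspace (space_of (alpha ?S)) = {\<phi> \<in> topspace (space_of (alpha ?S)). \<phi> ?p \<in> ball 1 1}"
      using * h_uf by (auto simp: A(2))
    moreover have "openin (space_of (alpha ?S)) {\<phi> \<in> topspace (space_of (alpha ?S)). \<phi> ?p \<in> ball 1 1}"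
      by (rule openin_continuous_map_preimage[OF continuous_map_alpha_eval[OF index_indicator_C_G[OF X]]]) auto
    ultimately show "openin (space_of (alpha ?S)) (h -` U \<inter> topspace (space_of (alpha ?S)))"
      by simp
  next
    have "ultrafilters_on I \<in> {{\<U> \<in> ultrafilters_on I. eventually (\<lambda>i. i \<in> A) \<U>} | A. A \<subseteq> I}"
      by (auto simp: ultrafilters_on_def intro!: exI[of _ I])
    then show "h ` topspace (space_of (alpha ?S)) \<subseteq> \<Union> {{\<U> \<in> ultrafilters_on I. eventually (\<lambda>i. i \<in> A) \<U>} | A. A \<subseteq> I}"
      using h_uf by auto
  qed
  have pi: "pi_index I X \<phi> = h \<phi>" if "\<phi> \<in> characters ?S" for \<phi>
    unfolding pi_index_def by (rule alpha_extend_eqI[OF S Hausdorff_beta cont h_unit that])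
  show "pi_index I X \<phi> = filtermap fst F" if "represents ?S F \<phi>"
    using pi[OF represents_imp_character[OF S that]] h_eq[OF that] by simp
  show "continuous_map (space_of (alpha ?S)) (beta I) (pi_index I X)"
    by (rule continuous_map_eq[OF cont]) (simp add: pi)
qed

section \<open>Ultracoproducts\<close>

lemma points_ultracoproduct:
  "points (ultracoproduct I \<U> X) = {\<phi> \<in> characters (sum_gspace I X). pi_index I X \<phi> = \<U>}"
  by (auto simp: ultracoproduct_def)

text \<open>The working description of the fibre: membership is read off from any representing
  filter, so \<open>pi_index\<close> can be forgotten.\<close>

lemma in_ultracoproduct_iff:
  assumes X: "\<forall>i\<in>I. G_space (X i)" and F: "represents (sum_gspace I X) F \<phi>"
  shows "\<phi> \<in> points (ultracoproduct I \<U> X) \<longleftrightarrow> filtermap fst F = \<U>"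
  using represents_imp_character[OF G_space_sum[OF X] F] pi_index_represents(1)[OF X F]
  by (simp add: points_ultracoproduct)

lemma ultracoproduct_represents:
  assumes X: "\<forall>i\<in>I. G_space (X i)" and \<phi>: "\<phi> \<in> points (ultracoproduct I \<U> X)"
  obtains F where "represents (sum_gspace I X) F \<phi>" "filtermap fst F = \<U>"
proof -
  have "\<phi> \<in> characters (sum_gspace I X)"
    using \<phi> by (simp add: points_ultracoproduct)
  from character_imp_represents[OF G_space_sum[OF X] this]
  obtain F where F: "represents (sum_gspace I X) F \<phi>" .
  show thesis by (rule that[OF F]) (use in_ultracoproduct_iff[OF X F] \<phi> in blast)
qed

lemma closedin_ultracoproduct:
  assumes X: "\<forall>i\<in>I. G_space (X i)" and U: "\<U> \<in> ultrafilters_on I"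
  shows "closedin (space_of (alpha (sum_gspace I X))) (points (ultracoproduct I \<U> X))"
proof -
  have "closedin (beta I) {\<U>}"
    by (rule closedin_Hausdorff_singleton[OF Hausdorff_beta]) (simp add: U)
  from closedin_continuous_map_preimage[OF pi_index_represents(2)[OF X] this]
  show ?thesis by (simp add: points_ultracoproduct)
qed

lemma space_of_ultracoproduct:
  "space_of (ultracoproduct I \<U> X) =
    subtopology (space_of (alpha (sum_gspace I X))) (points (ultracoproduct I \<U> X))"
  by (simp add: points_ultracoproduct) (simp add: ultracoproduct_def)

lemma act_ultracoproduct [simp]: "act (ultracoproduct I \<U> X) = act (alpha (sum_gspace I X))"
  by (simp add: ultracoproduct_def)

lemma act_in_ultracoproduct:
  assumes X: "\<forall>i\<in>I. G_space (X i)" and \<phi>: "\<phi> \<in> points (ultracoproduct I \<U> X)"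
  shows "act (alpha (sum_gspace I X)) g \<phi> \<in> points (ultracoproduct I \<U> X)"
proof -
  obtain F where F: "represents (sum_gspace I X) F \<phi>" "filtermap fst F = \<U>"
    by (rule ultracoproduct_represents[OF X \<phi>])
  have r: "represents (sum_gspace I X) (filtermap (act (sum_gspace I X) g) F) (act (alpha (sum_gspace I X)) g \<phi>)"
    by (rule represents_act_alpha[OF G_space_sum[OF X] F(1)])
  show ?thesis
    using in_ultracoproduct_iff[OF X r, of \<U>] F(2) by (simp add: filtermap_filtermap)
qed

lemma G_flow_ultracoproduct:
  fixes X :: "'i \<Rightarrow> ('g::{topological_group_add, t2_space}, 'x) gspace"
  assumes X: "\<forall>i\<in>I. G_space (X i)" and U: "\<U> \<in> ultrafilters_on I"
  shows "G_flow (ultracoproduct I \<U> X)"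
proof -
  let ?A = "alpha (sum_gspace I X)" and ?P = "points (ultracoproduct I \<U> X)"
  have A: "G_space ?A" "compact_space (space_of ?A)"
    using G_flow_alpha[OF G_space_sum[OF X]] by (auto simp: G_flow_def)
  note cl = closedin_ultracoproduct[OF X U]
  have sub: "?P \<subseteq> points ?A"
    using closedin_subset[OF cl] by simp
  have "compact_space (space_of (ultracoproduct I \<U> X))"
    by (subst space_of_ultracoproduct) (rule compact_space_subtopology[OF closedin_compact_space[OF A(2) cl]])
  moreover have "Hausdorff_space (space_of (ultracoproduct I \<U> X))"
    by (subst space_of_ultracoproduct) (rule Hausdorff_space_subtopology[OF Hausdorff_alpha])
  moreover have "continuous_map (prod_topology euclidean (space_of (ultracoproduct I \<U> X))) (space_of (ultracoproduct I \<U> X))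
    (\<lambda>(g, x). act ?A g x)"
  proof -
    have "prod_topology (euclidean :: 'g topology) (subtopology (space_of ?A) ?P) = subtopology (prod_topology euclidean (space_of ?A)) (UNIV \<times> ?P)"
      by (simp add: prod_topology_subtopology)
    moreover have "continuous_map (subtopology (prod_topology euclidean (space_of ?A)) (UNIV \<times> ?P)) (space_of ?A) (\<lambda>(g, x). act ?A g x)"
      using A(1) by (intro continuous_map_from_subtopology) (simp add: G_space_def)
    ultimately have "continuous_map (prod_topology euclidean (subtopology (space_of ?A) ?P)) (space_of ?A) (\<lambda>(g, x). act ?A g x)"
      by (simp only:)
    then have "continuous_map (prod_topology euclidean (subtopology (space_of ?A) ?P)) (subtopology (space_of ?A) ?P) (\<lambda>(g, x). act ?A g x)"
      unfolding continuous_map_in_subtopology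
      using act_in_ultracoproduct[OF X] by auto
    then show ?thesis
      by (simp only: space_of_ultracoproduct[symmetric])
  qed
  moreover have "act ?A 0 x = x" "act ?A (g + h) x = act ?A g (act ?A h x)" if "x \<in> ?P" for g h x
    using act_0[OF A(1) subsetD[OF sub that]] act_add[OF A(1) subsetD[OF sub that]] .
  ultimately show ?thesis
    unfolding G_flow_def G_space_def act_ultracoproduct by blast
qed

text \<open>Closed conditions that hold on almost all factors pass to the limit. Two functions are
  treated together so that inequalities between their values can be transferred.\<close>

lemma ultracoproduct_closed_property:
  fixes S :: "(complex \<times> complex) set"
  assumes X: "\<forall>i\<in>I. G_space (X i)" and \<phi>: "\<phi> \<in> points (ultracoproduct I \<U> X)"
    and p: "p \<in> C_G (sum_gspace I X)" and q: "q \<in> C_G (sum_gspace I X)" and S: "closed S"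
    and ev: "eventually (\<lambda>i. \<forall>x\<in>points (X i). (p (i, x), q (i, x)) \<in> S) \<U>"
  shows "(\<phi> p, \<phi> q) \<in> S"
proof -
  obtain F where F: "represents (sum_gspace I X) F \<phi>" "filtermap fst F = \<U>"
    by (rule ultracoproduct_represents[OF X \<phi>])
  have lim: "((\<lambda>z. (p z, q z)) \<longlongrightarrow> (\<phi> p, \<phi> q)) F"
    by (intro tendsto_Pair representsD(3)[OF F(1)] p q)
  have "eventually (\<lambda>z. \<forall>x\<in>points (X (fst z)). (p (fst z, x), q (fst z, x)) \<in> S) F"
    using ev unfolding F(2)[symmetric] eventually_filtermap .
  with representsD(2)[OF F(1)] have "eventually (\<lambda>z. (p z, q z) \<in> S) F"
    by eventually_elim auto
  then show ?thesis
    by (rule Lim_in_closed_set[OF S _ representsD(1)[OF F(1)] lim])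
qed

text \<open>A bounded function converges along an ultrafilter, because its values lie in a compact
  disc and a cluster point of an ultrafilter is a limit.\<close>

lemma ultrafilter_represents:
  assumes X: "G_space X" and F: "F \<noteq> bot" "eventually (\<lambda>x. x \<in> points X) F"
    "\<And>P. eventually P F \<or> eventually (\<lambda>x. \<not> P x) F"
  obtains \<phi> where "represents X F \<phi>"
proof -
  have "\<exists>l. (p \<longlongrightarrow> l) F" if p: "p \<in> C_G X" for p
  proof -
    obtain B where B: "\<And>x. x \<in> points X \<Longrightarrow> cmod (p x) \<le> B"
      using C_G_D(2)[OF X p] by (auto simp: bounded_iff)
    have "eventually (\<lambda>z. z \<in> cball 0 B) (filtermap p F)"
      unfolding eventually_filtermap using F(2) by eventually_elim (simp add: B)
    moreover have "filtermap p F \<noteq> bot"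
      using F(1) by (simp add: filtermap_bot_iff)
    ultimately obtain l where l: "inf (nhds l) (filtermap p F) \<noteq> bot"
      using compact_cball[of "0::complex" B] unfolding compact_filter by blast
    have "(p \<longlongrightarrow> l) F"
    proof (rule topological_tendstoI, rule ccontr)
      fix S assume S: "open S" "l \<in> S" and "\<not> eventually (\<lambda>x. p x \<in> S) F"
      then have "eventually (\<lambda>z. z \<notin> S) (filtermap p F)"
        using F(3)[of "\<lambda>x. p x \<in> S"] by (simp add: eventually_filtermap)
      moreover have "eventually (\<lambda>z. z \<in> S) (nhds l)"
        using S by (simp add: eventually_nhds_in_open)
      ultimately have "eventually (\<lambda>z. False) (inf (nhds l) (filtermap p F))"
        unfolding eventually_inf by blast
      then show False using l by (simp add: trivial_limit_def)
    qed
    then show ?thesis ..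
  qed
  then obtain l where "\<And>p. p \<in> C_G X \<Longrightarrow> (p \<longlongrightarrow> l p) F" by metis
  then have "represents X F (restrict l (C_G X))"
    using F by (simp add: represents_def)
  then show thesis using that by blast
qed

text \<open>A choice of one point in almost every factor defines a point of the ultracoproduct. Such
  points witness failures in the converse transfer below.\<close>

lemma ultracoproduct_ultralimit:
  assumes X: "\<forall>i\<in>I. G_space (X i)" and U: "\<U> \<in> ultrafilters_on I"
    and s: "eventually (\<lambda>i. s i \<in> points (X i)) \<U>"
  obtains \<phi> where "\<phi> \<in> points (ultracoproduct I \<U> X)"
    "\<And>p. p \<in> C_G (sum_gspace I X) \<Longrightarrow> ((\<lambda>i. p (i, s i)) \<longlongrightarrow> \<phi> p) \<U>"
proof -
  let ?F = "filtermap (\<lambda>i. (i, s i)) \<U>"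
  have UI: "\<U> \<noteq> bot" "eventually (\<lambda>i. i \<in> I) \<U>" "\<And>P. eventually P \<U> \<or> eventually (\<lambda>x. \<not> P x) \<U>"
    using U by (auto simp: ultrafilters_on_def)
  have F: "?F \<noteq> bot" "eventually (\<lambda>x. x \<in> points (sum_gspace I X)) ?F"
    "\<And>P. eventually P ?F \<or> eventually (\<lambda>x. \<not> P x) ?F"
    using UI(1,3) eventually_conj[OF UI(2) s] by (simp_all add: filtermap_bot_iff eventually_filtermap)
  obtain \<phi> where \<phi>: "represents (sum_gspace I X) ?F \<phi>"
    by (rule ultrafilter_represents[OF G_space_sum[OF X] F])
  have "filtermap fst ?F = \<U>"
    by (simp add: filtermap_filtermap)
  then have "\<phi> \<in> points (ultracoproduct I \<U> X)"
    using in_ultracoproduct_iff[OF X \<phi>] by simp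
  then show thesis
    using that representsD(3)[OF \<phi>] by (simp add: filterlim_filtermap)
qed

text \<open>If the bound failed on almost all factors, points chosen where it fails would have a
  limit at which \<open>p\<close> has modulus at least \<open>d\<close>. The slack between
  \<open>c\<close> and \<open>d\<close> absorbs the passage from strict to weak inequalities; it is
  paid again at each level of an iterated ultracoproduct.\<close>

lemma ultracoproduct_bound:
  assumes X: "\<forall>i\<in>I. G_space (X i)" and U: "\<U> \<in> ultrafilters_on I"
    and p: "p \<in> C_G (sum_gspace I X)" 
    and c: "\<And>\<phi>. \<phi> \<in> points (ultracoproduct I \<U> X) \<Longrightarrow> cmod (\<phi> p) \<le> c" and "c < d"
  shows "eventually (\<lambda>i. \<forall>x\<in>points (X i). cmod (p (i, x)) \<le> d) \<U>"
proof (rule ccontr)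
  assume "\<not> ?thesis"
  then have "eventually (\<lambda>i. \<exists>x\<in>points (X i). \<not> cmod (p (i, x)) \<le> d) \<U>"
    using U by (auto simp: ultrafilters_on_def)
  then have ev: "eventually (\<lambda>i. (SOME x. x \<in> points (X i) \<and> \<not> cmod (p (i, x)) \<le> d) \<in> points (X i) \<and>
      \<not> cmod (p (i, SOME x. x \<in> points (X i) \<and> \<not> cmod (p (i, x)) \<le> d)) \<le> d) \<U>"
    by eventually_elim (rule someI_ex, blast)
  define s where "s = (\<lambda>i. SOME x. x \<in> points (X i) \<and> \<not> cmod (p (i, x)) \<le> d)"
  have s: "eventually (\<lambda>i. s i \<in> points (X i)) \<U>" "eventually (\<lambda>i. d \<le> cmod (p (i, s i))) \<U>"
    using ev unfolding s_def by (eventually_elim, simp)+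
  obtain \<phi> where \<phi>: "\<phi> \<in> points (ultracoproduct I \<U> X)"
    "\<And>p. p \<in> C_G (sum_gspace I X) \<Longrightarrow> ((\<lambda>i. p (i, s i)) \<longlongrightarrow> \<phi> p) \<U>"
    using ultracoproduct_ultralimit[OF X U s(1)] by blast
  have "d \<le> cmod (\<phi> p)"
    by (rule tendsto_lowerbound[OF tendsto_norm[OF \<phi>(2)[OF p]] s(2)])
      (use U in \<open>simp add: ultrafilters_on_def\<close>)
  then show False using c[OF \<phi>(1)] \<open>c < d\<close> by simp
qed

section \<open>The canonical factor map\<close>

lemma eventually_ultrafilter_eq:
  assumes "\<U> \<in> ultrafilters_on I" "\<V> \<noteq> bot" "\<And>P. eventually P \<U> \<Longrightarrow> eventually P \<V>"
  shows "\<V> = \<U>"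
proof -
  have "eventually P \<U>" if "eventually P \<V>" for P
  proof (rule ccontr)
    assume "\<not> eventually P \<U>"
    then have "eventually (\<lambda>x. \<not> P x) \<U>"
      using assms(1) by (auto simp: ultrafilters_on_def)
    from eventually_conj[OF that assms(3)[OF this]] have "eventually (\<lambda>x. False) \<V>"
      by (rule eventually_mono) blast
    then show False using assms(2) by simp
  qed
  then show ?thesis
    using assms(3) by (auto simp: filter_eq_iff)
qed

lemma tensor_ultrafilter:
  assumes U: "\<U> \<in> ultrafilters_on I" and V: "\<V> \<in> ultrafilters_on J"
  shows "\<U> \<otimes>\<^sub>F \<V> \<in> ultrafilters_on (I \<times> J)"
proof -
  have nb: "\<U> \<noteq> bot" "\<V> \<noteq> bot" and I: "eventually (\<lambda>i. i \<in> I) \<U>" and J: "eventually (\<lambda>j. j \<in> J) \<V>"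
    and u: "\<And>P. eventually P \<U> \<or> eventually (\<lambda>i. \<not> P i) \<U>" and v: "\<And>P. eventually P \<V> \<or> eventually (\<lambda>j. \<not> P j) \<V>"
    using U V by (auto simp: ultrafilters_on_def)
  have "\<U> \<otimes>\<^sub>F \<V> \<noteq> bot"
    using nb by (simp add: trivial_limit_def eventually_tensor)
  moreover have "eventually (\<lambda>z. z \<in> I \<times> J) (\<U> \<otimes>\<^sub>F \<V>)"
    unfolding eventually_tensor using I by eventually_elim (use J in eventually_elim, simp)
  moreover have "eventually P (\<U> \<otimes>\<^sub>F \<V>) \<or> eventually (\<lambda>z. \<not> P z) (\<U> \<otimes>\<^sub>F \<V>)" for P
  proof (cases "eventually P (\<U> \<otimes>\<^sub>F \<V>)")
    case False
    then have "eventually (\<lambda>i. \<not> eventually (\<lambda>j. P (i, j)) \<V>) \<U>"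
      using u[of "\<lambda>i. eventually (\<lambda>j. P (i, j)) \<V>"] by (simp add: eventually_tensor)
    then have "eventually (\<lambda>i. eventually (\<lambda>j. \<not> P (i, j)) \<V>) \<U>"
      by eventually_elim (use v in blast)
    then show ?thesis by (simp add: eventually_tensor)
  qed simp
  ultimately show ?thesis
    by (simp add: ultrafilters_on_def)
qed

section \<open>The canonical factor map as the transpose of an algebra homomorphism\<close>

definition slice :: "'i \<Rightarrow> (('i \<times> 'j) \<times> 'x \<Rightarrow> 'c) \<Rightarrow> 'j \<times> 'x \<Rightarrow> 'c"
  where "slice i p = (\<lambda>(j, x). p ((i, j), x))"

lemma slice_apply [simp]: "slice i p (j, x) = p ((i, j), x)"
  by (simp add: slice_def)

text \<open>This is the composite of \<open>p\<close>, extended to the compactification of I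
  \<times> J \<times> X, with the union of inclusions that defines \<psi>.\<close>

definition fubini_pullback :: "'i set \<Rightarrow> 'j set \<Rightarrow> 'j filter
      \<Rightarrow> ('g::{topological_group_add, t2_space}, 'x) gspace
      \<Rightarrow> (('i \<times> 'j) \<times> 'x \<Rightarrow> complex) \<Rightarrow> 'i \<times> (('j \<times> 'x \<Rightarrow> complex) \<Rightarrow> complex) \<Rightarrow> complex"
  where "fubini_pullback I J \<V> X p =
    on_points (sum_gspace I (\<lambda>_. ultracopower J \<V> X)) (\<lambda>(i, \<xi>). \<xi> (slice i p))"

lemma fubini_pullback_apply [simp]:
  "i \<in> I \<Longrightarrow> \<xi> \<in> points (ultracopower J \<V> X) \<Longrightarrow> fubini_pullback I J \<V> X p (i, \<xi>) = \<xi> (slice i p)"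
  by (simp add: fubini_pullback_def)

lemma fubini_pullback_outside:
  "i \<notin> I \<or> \<xi> \<notin> points (ultracopower J \<V> X) \<Longrightarrow> fubini_pullback I J \<V> X p (i, \<xi>) = 0"
  by (auto simp: fubini_pullback_def)

context
  fixes X :: "('g::{topological_group_add, t2_space}, 'x) gspace"
    and I :: "'i set" and J :: "'j set" and \<U> \<V>
  assumes X: "G_space X" and U: "\<U> \<in> ultrafilters_on I" and V: "\<V> \<in> ultrafilters_on J"
begin

abbreviation (input) "YIJ \<equiv> sum_gspace (I \<times> J) (\<lambda>_. X)"
abbreviation (input) "YJ \<equiv> sum_gspace J (\<lambda>_. X)"
abbreviation (input) "UV \<equiv> ultracopower J \<V> X"
abbreviation (input) "YI \<equiv> sum_gspace I (\<lambda>_. ultracopower J \<V> X)"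

lemma XJ: "\<forall>j\<in>J. G_space X" and XIJ: "\<forall>ij\<in>I \<times> J. G_space X"
  using X by auto

lemma G_space_YIJ: "G_space YIJ" and G_space_YJ: "G_space YJ"
  by (rule G_space_sum[OF XIJ], rule G_space_sum[OF XJ])

lemma G_flow_UV: "G_flow UV"
  by (rule G_flow_ultracoproduct[OF XJ V])

lemma G_space_UV: "\<forall>i\<in>I. G_space UV"
  using G_flow_UV by (simp add: G_flow_def)

lemma G_space_YI: "G_space YI"
  by (rule G_space_sum[OF G_space_UV])

lemma UV_character: "\<xi> \<in> points UV \<Longrightarrow> \<xi> \<in> characters YJ"
  by (simp add: points_ultracoproduct)

lemma slice_C_G:
  assumes p: "p \<in> C_G YIJ" and i: "i \<in> I"
  shows "slice i p \<in> C_G YJ"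
proof -
  note D = C_G_D[OF G_space_YIJ p]
  obtain B where B: "\<And>z. z \<in> points YIJ \<Longrightarrow> cmod (p z) \<le> B"
    using D(2) by (auto simp: bounded_iff)
  show ?thesis
  proof (rule C_G_sum_I[OF XJ, of _ B])
    fix j assume j: "j \<in> J"
    then show "continuous_map (space_of X) euclidean (\<lambda>x. slice i p (j, x))"
      using C_G_D(1)[OF X C_G_sum_slice[OF XIJ p, of "(i, j)"]] i by simp
    show "cmod (slice i p (j, x)) \<le> B" if "x \<in> points X" for x
      using B i j that by simp
  next
    fix j x assume "j \<notin> J \<or> x \<notin> points X"
    then show "slice i p (j, x) = 0"
      using D(3) by auto
  next
    fix e :: real assume "e > 0"
    from D(4)[OF this]
    show "eventually (\<lambda>g. \<forall>j\<in>J. \<forall>x\<in>points X. cmod (slice i p (j, act X g x) - slice i p (j, x)) \<le> e) (nhds 0)"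
      by eventually_elim (use i in force)
  qed
qed

text \<open>A bound on gp - p type differences that is uniform in (i, j) survives evaluation at
  every character \<xi>, so it becomes a bound uniform in (i, \<xi>).\<close>

lemma fubini_pullback_C_G:
  assumes p: "p \<in> C_G YIJ"
  shows "fubini_pullback I J \<V> X p \<in> C_G YI"
proof -
  note D = C_G_D[OF G_space_YIJ p]
  obtain B where B: "\<And>z. z \<in> points YIJ \<Longrightarrow> cmod (p z) \<le> B"
    using D(2) by (auto simp: bounded_iff)
  show ?thesis
  proof (rule C_G_sum_I[OF G_space_UV, of _ B])
    fix i assume i: "i \<in> I"
    have "continuous_map (space_of UV) euclidean (\<lambda>\<xi>. \<xi> (slice i p))"
      by (subst space_of_ultracoproduct, rule continuous_map_from_subtopology[OF continuous_map_alpha_eval[OF slice_C_G[OF p i]]])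
    then show "continuous_map (space_of UV) euclidean (\<lambda>x. fubini_pullback I J \<V> X p (i, x))"
      by (rule continuous_map_eq) (simp add: i)
    show "cmod (fubini_pullback I J \<V> X p (i, \<xi>)) \<le> B" if \<xi>: "\<xi> \<in> points UV" for \<xi>
      unfolding fubini_pullback_apply[OF i \<xi>]
      by (rule character_bound[OF G_space_YJ UV_character[OF \<xi>] slice_C_G[OF p i]])
        (use B i in auto)
  next
    fix e :: real assume "e > 0"
    from D(4)[OF this]
    show "eventually (\<lambda>g. \<forall>i\<in>I. \<forall>\<xi>\<in>points UV.
        cmod (fubini_pullback I J \<V> X p (i, act UV g \<xi>) - fubini_pullback I J \<V> X p (i, \<xi>)) \<le> e) (nhds 0)"
    proof eventually_elim
      case (elim g)
      show ?case
      proof (intro ballI)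
        fix i \<xi> assume i: "i \<in> I" and \<xi>: "\<xi> \<in> points UV"
        have g\<xi>: "act UV g \<xi> \<in> points UV"
          using act_in_ultracoproduct[OF XJ \<xi>] by simp
        have "cmod (\<xi> (translate YJ (slice i p) g) - \<xi> (slice i p)) \<le> e"
          by (rule character_diff_bound[OF G_space_YJ UV_character[OF \<xi>] C_G_translate[OF G_space_YJ] ])
            (use elim i in \<open>auto simp: slice_C_G[OF p i] translate_def\<close>)
        then show "cmod (fubini_pullback I J \<V> X p (i, act UV g \<xi>) - fubini_pullback I J \<V> X p (i, \<xi>)) \<le> e"
          unfolding fubini_pullback_apply[OF i \<xi>] fubini_pullback_apply[OF i g\<xi>]
          by (simp add: act_alpha slice_C_G[OF p i])
      qed
    qed
  qed (rule fubini_pullback_outside)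
qed

text \<open>An explicit formula for \<psi>, against which the definite description in
  \<open>fubini_psi\<close> is identified below.\<close>

definition psi_map where
  "psi_map \<Phi> = (\<lambda>p\<in>C_G YIJ. \<Phi> (fubini_pullback I J \<V> X p))"

text \<open>Each \<xi> respects the algebra operations, so taking the pullback is a unital
  homomorphism, and a character composed with it is a character.\<close>

lemma psi_map_character:
  assumes \<Phi>: "\<Phi> \<in> characters YI"
  shows "psi_map \<Phi> \<in> characters YIJ"
proof -
  let ?T = "fubini_pullback I J \<V> X"
  have ch: "\<xi> (\<lambda>z. p z + q z) = \<xi> p + \<xi> q" "\<xi> (\<lambda>z. p z * q z) = \<xi> p * \<xi> q"
    if "\<xi> \<in> points UV" "p \<in> C_G YJ" "q \<in> C_G YJ" for \<xi> p q
    using UV_character[OF that(1)] that(2,3) unfolding characters_def by blast+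
  have chc: "\<xi> (\<lambda>z. c * p z) = c * \<xi> p"
    if "\<xi> \<in> points UV" "p \<in> C_G YJ" for \<xi> p c
    using UV_character[OF that(1)] that(2) unfolding characters_def by blast
  have ch1: "\<xi> (on_points YJ (\<lambda>_. 1)) = 1" if "\<xi> \<in> points UV" for \<xi>
    using UV_character[OF that(1)] unfolding characters_def by blast
  have eqI: "f = g" if "\<And>i \<xi>. i \<in> I \<Longrightarrow> \<xi> \<in> points UV \<Longrightarrow> f (i, \<xi>) = g (i, \<xi>)" 
    "\<And>i \<xi>. i \<notin> I \<or> \<xi> \<notin> points UV \<Longrightarrow> f (i, \<xi>) = g (i, \<xi>)" for f g :: "_ \<Rightarrow> complex"
    using that by (auto simp: fun_eq_iff)
  have add: "?T (\<lambda>z. p z + q z) = (\<lambda>z. ?T p z + ?T q z)"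
    and mult: "?T (\<lambda>z. p z * q z) = (\<lambda>z. ?T p z * ?T q z)"
    if "p \<in> C_G YIJ" "q \<in> C_G YIJ" for p q
  proof -
    have sl: "slice i (\<lambda>z. p z + q z) = (\<lambda>z. slice i p z + slice i q z)"
      "slice i (\<lambda>z. p z * q z) = (\<lambda>z. slice i p z * slice i q z)" for i
      by (auto simp: slice_def)
    show "?T (\<lambda>z. p z + q z) = (\<lambda>z. ?T p z + ?T q z)" 
      by (rule eqI) (simp_all add: sl ch slice_C_G that fubini_pullback_outside)
    show "?T (\<lambda>z. p z * q z) = (\<lambda>z. ?T p z * ?T q z)" 
      by (rule eqI) (simp_all add: sl ch slice_C_G that fubini_pullback_outside)
  qed
  have cm: "?T (\<lambda>z. c * p z) = (\<lambda>z. c * ?T p z)" if "p \<in> C_G YIJ" for p c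
  proof -
    have "slice i (\<lambda>z. c * p z) = (\<lambda>z. c * slice i p z)" for i
      by (auto simp: slice_def)
    then show ?thesis
      by (intro eqI) (simp_all add: chc slice_C_G that fubini_pullback_outside)
  qed
  have one: "?T (on_points YIJ (\<lambda>_. 1)) = on_points YI (\<lambda>_. 1)"
  proof (rule eqI)
    fix i \<xi> assume i: "i \<in> I" and \<xi>: "\<xi> \<in> points UV"
    have "slice i (on_points YIJ (\<lambda>_. 1)) = on_points YJ (\<lambda>_. 1 :: complex)"
      using i by (auto simp: on_points_def slice_def)
    then show "?T (on_points YIJ (\<lambda>_. 1)) (i, \<xi>) = on_points YI (\<lambda>_. 1) (i, \<xi>)"
      using i \<xi> ch1[OF \<xi>] by simp
  qed (auto simp: fubini_pullback_outside)
  have ph: "\<Phi> (\<lambda>z. p z + q z) = \<Phi> p + \<Phi> q" "\<Phi> (\<lambda>z. p z * q z) = \<Phi> p * \<Phi> q"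
    if "p \<in> C_G YI" "q \<in> C_G YI" for p q
    using \<Phi> that unfolding characters_def by blast+
  have phc: "\<Phi> (\<lambda>z. c * p z) = c * \<Phi> p" if "p \<in> C_G YI" for p c
    using \<Phi> that unfolding characters_def by blast
  have "\<Phi> (on_points YI (\<lambda>_. 1)) = 1"
    using \<Phi> unfolding characters_def by blast
  then show ?thesis
    unfolding characters_def psi_map_def
    by (simp add: add mult cm one ph phc fubini_pullback_C_G C_G_add C_G_mult C_G_cmult C_G_const G_space_YIJ)
qed

lemma continuous_map_psi_map:
  "continuous_map (space_of (alpha YI)) (space_of (alpha YIJ)) psi_map"
  unfolding continuous_map_into_alpha
  using psi_map_character continuous_map_alpha_eval[OF fubini_pullback_C_G]
  by (simp add: psi_map_def)

lemma fubini_psi_eq: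
  assumes \<Phi>: "\<Phi> \<in> characters YI"
  shows "fubini_psi I J \<V> X \<Phi> = psi_map \<Phi>"
  unfolding fubini_psi_def
proof (rule alpha_extend_eqI[OF G_space_YI Hausdorff_alpha continuous_map_psi_map _ \<Phi>])
  fix z assume z: "z \<in> points YI"
  obtain i \<xi> where z_eq: "z = (i, \<xi>)" by (cases z)
  then have i: "i \<in> I" and \<xi>: "\<xi> \<in> points UV" using z by auto
  \<comment> \<open>Cutting off outside the points, as \<open>alpha_map\<close> does, changes
    nothing because \<open>p\<close> already vanishes there.\<close>
  have "on_points YJ (\<lambda>y. p (case y of (j, x) \<Rightarrow> ((i, j), x))) = slice i p" if "p \<in> C_G YIJ" for p
    using C_G_D(3)[OF G_space_YIJ that] by (auto simp: on_points_def slice_def)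
  then show "psi_map (alpha_unit YI z) =
      (case z of (i, \<phi>) \<Rightarrow> alpha_map YJ YIJ (\<lambda>(j, x). ((i, j), x)) \<phi>)"
    using i \<xi> by (auto simp: z_eq psi_map_def alpha_map_def fubini_pullback_C_G intro!: restrict_ext)
qed

lemma psi_map_equivariant:
  assumes \<Phi>: "\<Phi> \<in> characters YI"
  shows "psi_map (act (alpha YI) g \<Phi>) = act (alpha YIJ) g (psi_map \<Phi>)"
proof
  fix p
  show "psi_map (act (alpha YI) g \<Phi>) p = act (alpha YIJ) g (psi_map \<Phi>) p"
  proof (cases "p \<in> C_G YIJ")
    case p: True
    have "fubini_pullback I J \<V> X (translate YIJ p g) z = translate YI (fubini_pullback I J \<V> X p) g z" for z
    proof -
      obtain i \<xi> where z: "z = (i, \<xi>)" by (cases z)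
      show ?thesis
      proof (cases "i \<in> I \<and> \<xi> \<in> points UV")
        case True
        then have i: "i \<in> I" and \<xi>: "\<xi> \<in> points UV" by auto
        have g\<xi>: "act UV g \<xi> \<in> points UV"
          using act_in_ultracoproduct[OF XJ \<xi>] by simp
        have "slice i (translate YIJ p g) = translate YJ (slice i p) g"
          using i by (auto simp: slice_def translate_def on_points_def)
        then show ?thesis
          using i \<xi> g\<xi> by (simp add: z translate_def) (simp add: act_alpha slice_C_G[OF p i] translate_def)
      next
        case False
        then show ?thesis
          by (simp add: z fubini_pullback_outside translate_def)
      qed
    qed
    then have "fubini_pullback I J \<V> X (translate YIJ p g) = translate YI (fubini_pullback I J \<V> X p) g"
      by auto
    then show ?thesis
      using p by (simp add: psi_map_def act_alpha C_G_translate[OF G_space_YIJ] fubini_pullback_C_G)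
  qed (simp add: psi_map_def act_alpha)
qed

text \<open>The transfer of closed conditions applied twice; the tensor product of filters is
  defined so that its almost-all quantifier splits into exactly these two levels.\<close>

lemma double_closed_property:
  fixes S :: "(complex \<times> complex) set"
  assumes \<Phi>: "\<Phi> \<in> points (ultracopower I \<U> UV)"
    and p: "p \<in> C_G YIJ" and q: "q \<in> C_G YIJ" and S: "closed S"
    and ev: "eventually (\<lambda>ij. \<forall>x\<in>points X. (p (ij, x), q (ij, x)) \<in> S) (\<U> \<otimes>\<^sub>F \<V>)"
  shows "(\<Phi> (fubini_pullback I J \<V> X p), \<Phi> (fubini_pullback I J \<V> X q)) \<in> S"
proof (rule ultracoproduct_closed_property[OF G_space_UV \<Phi> fubini_pullback_C_G[OF p] fubini_pullback_C_G[OF q] S])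
  have "eventually (\<lambda>i. i \<in> I) \<U>"
    using U by (simp add: ultrafilters_on_def)
  with ev[unfolded eventually_tensor]
  show "eventually (\<lambda>i. \<forall>\<xi>\<in>points UV. (fubini_pullback I J \<V> X p (i, \<xi>), fubini_pullback I J \<V> X q (i, \<xi>)) \<in> S) \<U>"
  proof eventually_elim
    case (elim i)
    show ?case
    proof
      fix \<xi> assume \<xi>: "\<xi> \<in> points UV"
      have "(\<xi> (slice i p), \<xi> (slice i q)) \<in> S"
        by (rule ultracoproduct_closed_property[OF XJ \<xi> slice_C_G[OF p] slice_C_G[OF q] S])
          (use elim in simp_all)
      then show "(fubini_pullback I J \<V> X p (i, \<xi>), fubini_pullback I J \<V> X q (i, \<xi>)) \<in> S"
        using elim(2) \<xi> by simp
    qed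
  qed
qed

text \<open>The indicator of a set in \<open>\<U> \<otimes>\<^sub>F \<V>\<close> is 1 on almost all
  copies, hence takes the value 1 at the image. So the index filter of the image contains the tensor
  ultrafilter, and by maximality equals it.\<close>

lemma psi_map_in_ultracopower:
  assumes \<Phi>: "\<Phi> \<in> points (ultracopower I \<U> UV)"
  shows "psi_map \<Phi> \<in> points (ultracopower (I \<times> J) (\<U> \<otimes>\<^sub>F \<V>) X)"
proof -
  have "\<Phi> \<in> characters YI"
    using \<Phi> by (simp add: points_ultracoproduct)
  from character_imp_represents[OF G_space_YIJ psi_map_character[OF this]]
  obtain F where F: "represents YIJ F (psi_map \<Phi>)" .
  have "filtermap fst F = \<U> \<otimes>\<^sub>F \<V>"
  proof (rule eventually_ultrafilter_eq[OF tensor_ultrafilter[OF U V]])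
    show "filtermap fst F \<noteq> bot"
      using representsD(1)[OF F] by (simp add: filtermap_bot_iff)
    fix P assume P: "eventually P (\<U> \<otimes>\<^sub>F \<V>)"
    let ?p = "index_indicator (I \<times> J) (\<lambda>_. X) P"
    have p: "?p \<in> C_G YIJ"
      by (rule index_indicator_C_G[OF XIJ])
    have cl: "closed ({1} \<times> UNIV :: (complex \<times> complex) set)"
      by (intro closed_Times) auto
    have "eventually (\<lambda>ij. ij \<in> I \<times> J) (\<U> \<otimes>\<^sub>F \<V>)"
      using tensor_ultrafilter[OF U V] by (simp add: ultrafilters_on_def)
    with P have "eventually (\<lambda>ij. \<forall>x\<in>points X. (?p (ij, x), ?p (ij, x)) \<in> {1} \<times> UNIV) (\<U> \<otimes>\<^sub>F \<V>)"
      by eventually_elim (simp add: index_indicator_def)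
    from double_closed_property[OF \<Phi> p p cl this]
    have "psi_map \<Phi> ?p = 1"
      using p by (simp add: psi_map_def)
    then show "eventually P (filtermap fst F)"
      using index_indicator_represents(1)[OF XIJ F, of P] by (simp split: if_splits)
  qed
  then show ?thesis
    using in_ultracoproduct_iff[OF XIJ F] by simp
qed

lemma canonical_factor_map_eq:
  "\<Phi> \<in> points (ultracopower I \<U> UV) \<Longrightarrow> canonical_factor_map I \<U> J \<V> X \<Phi> = psi_map \<Phi>"
  unfolding canonical_factor_map_def using fubini_psi_eq[of \<Phi>] by (simp add: points_ultracoproduct)

lemma continuous_map_psi_map_ultracopower:
  "continuous_map (space_of (ultracopower I \<U> UV)) (space_of (ultracopower (I \<times> J) (\<U> \<otimes>\<^sub>F \<V>) X)) psi_map"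
proof -
  have "continuous_map (subtopology (space_of (alpha YI)) (points (ultracopower I \<U> UV)))
    (subtopology (space_of (alpha YIJ)) (points (ultracopower (I \<times> J) (\<U> \<otimes>\<^sub>F \<V>) X))) psi_map"
    unfolding continuous_map_in_subtopology
    using continuous_map_from_subtopology[OF continuous_map_psi_map] psi_map_in_ultracopower by auto
  then show ?thesis
    by (simp only: space_of_ultracoproduct[symmetric])
qed

text \<open>The image is compact, hence closed, so a missed point could be separated from it by a
  function \<open>p\<close> that vanishes on the image and is 1 at the missed point.\<close>

lemma psi_map_surj:
  "psi_map ` points (ultracopower I \<U> UV) = points (ultracopower (I \<times> J) (\<U> \<otimes>\<^sub>F \<V>) X)"
proof (rule ccontr)
  let ?P = "points (ultracopower I \<U> UV)" and ?Q = "points (ultracopower (I \<times> J) (\<U> \<otimes>\<^sub>F \<V>) X)"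
  let ?A = "space_of (alpha YIJ)"
  assume "psi_map ` ?P \<noteq> ?Q"
  then obtain \<omega> where \<omega>: "\<omega> \<in> ?Q" "\<omega> \<notin> psi_map ` ?P"
    using psi_map_in_ultracopower by blast
  have \<omega>c: "\<omega> \<in> characters YIJ" using \<omega>(1) by (simp add: points_ultracoproduct)
  have "closedin (space_of (alpha YI)) ?P"
    by (rule closedin_ultracoproduct[OF G_space_UV U])
  then have "compactin (space_of (alpha YI)) ?P"
    using closedin_compact_space[OF compact_alpha[OF G_space_YI]] by blast
  then have "compactin ?A (psi_map ` ?P)"
    by (rule image_compactin[OF _ continuous_map_psi_map])
  then have cl: "closedin ?A (psi_map ` ?P)"
    by (rule compactin_imp_closedin[OF Hausdorff_alpha])
  have cl': "closedin ?A {\<omega>}"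
    by (rule closedin_Hausdorff_singleton[OF Hausdorff_alpha]) (simp add: \<omega>c)
  have nm: "normal_space ?A"
    using compact_alpha[OF G_space_YIJ] Hausdorff_alpha compact_Hausdorff_or_regular_imp_normal_space by blast
  have "disjnt (psi_map ` ?P) {\<omega>}"
    using \<omega>(2) unfolding disjnt_def by blast
  from Urysohn_lemma[OF nm cl cl' this, of 0 1]
  obtain f where f: "continuous_map ?A (top_of_set {0..1::real}) f" "f ` psi_map ` ?P \<subseteq> {0}" "f ` {\<omega>} \<subseteq> {1}"
    by auto
  have f1: "continuous_map ?A euclideanreal f"
    using f(1) by (simp add: continuous_map_in_subtopology)
  have fc: "continuous_map ?A euclidean (\<lambda>\<phi>. of_real (f \<phi>) :: complex)"
    by (rule continuous_map_euclidean_comp[OF _ f1]) (intro continuous_intros)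
  obtain p where p: "p \<in> C_G YIJ" "\<And>\<phi>. \<phi> \<in> characters YIJ \<Longrightarrow> \<phi> p = of_real (f \<phi>)"
    using C_G_of_continuous_alpha[OF G_space_YIJ fc] by blast
  have "cmod (\<Phi> (fubini_pullback I J \<V> X p)) \<le> 0" if \<Phi>: "\<Phi> \<in> ?P" for \<Phi>
  proof -
    have "psi_map \<Phi> \<in> characters YIJ"
      using psi_map_in_ultracopower[OF \<Phi>] by (simp add: points_ultracoproduct)
    from p(2)[OF this] show ?thesis
      using p(1) f(2) \<Phi> by (auto simp: psi_map_def)
  qed
  \<comment> \<open>The bound 0 is weakened to 1/3 for almost all \<open>i\<close> and to 1/2 for
    almost all \<open>j\<close>, a strict loss at each level; it stays below the value 1 at the
    missed point.\<close>
  then have ev: "eventually (\<lambda>i. \<forall>\<xi>\<in>points UV. cmod (fubini_pullback I J \<V> X p (i, \<xi>)) \<le> 1/3) \<U>"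
    by (rule ultracoproduct_bound[OF G_space_UV U fubini_pullback_C_G[OF p(1)]]) simp_all
  have "eventually (\<lambda>i. i \<in> I) \<U>"
    using U by (simp add: ultrafilters_on_def)
  with ev have "eventually (\<lambda>i. eventually (\<lambda>j. \<forall>x\<in>points X. cmod (p ((i, j), x)) \<le> 1/2) \<V>) \<U>"
  proof eventually_elim
    case (elim i)
    have "eventually (\<lambda>j. \<forall>x\<in>points X. cmod (slice i p (j, x)) \<le> 1/2) \<V>"
      by (rule ultracoproduct_bound[OF XJ V slice_C_G[OF p(1) elim(2)], of "1/3"]) (use elim in auto)
    then show ?case by simp
  qed
  then have ev2: "eventually (\<lambda>ij. \<forall>x\<in>points X. (p (ij, x), p (ij, x)) \<in> cball 0 (1/2) \<times> UNIV) (\<U> \<otimes>\<^sub>F \<V>)"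
    by (simp add: eventually_tensor)
  have clb: "closed (cball 0 (1/2) \<times> UNIV :: (complex \<times> complex) set)"
    by (intro closed_Times) auto
  have "cmod (\<omega> p) \<le> 1/2"
    using ultracoproduct_closed_property[OF XIJ \<omega>(1) p(1) p(1) clb ev2] by simp
  then show False
    using p(2)[OF \<omega>c] f(3) by simp
qed

text \<open>A continuous bijection from a compact to a Hausdorff space is a homeomorphism, and
  equivariance and surjectivity always hold. Hypothesis and goal of the theorem both become
  statements about injectivity.\<close>

lemma canonical_factor_map_isomorphism_iff:
  "flow_isomorphism (ultracopower I \<U> UV) (ultracopower (I \<times> J) (\<U> \<otimes>\<^sub>F \<V>) X) (canonical_factor_map I \<U> J \<V> X)
    \<longleftrightarrow> inj_on psi_map (points (ultracopower I \<U> UV))"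
proof -
  let ?A = "ultracopower I \<U> UV" and ?B = "ultracopower (I \<times> J) (\<U> \<otimes>\<^sub>F \<V>) X"
  have fl: "compact_space (space_of ?A)" "Hausdorff_space (space_of ?B)"
    using G_flow_ultracoproduct[OF G_space_UV U] G_flow_ultracoproduct[OF XIJ tensor_ultrafilter[OF U V]]
    by (auto simp: G_flow_def G_space_def)
  have ch: "\<Phi> \<in> characters YI" if "\<Phi> \<in> points ?A" for \<Phi>
    using that by (simp add: points_ultracoproduct)
  have eqv: "canonical_factor_map I \<U> J \<V> X (act ?A g \<Phi>) = act ?B g (canonical_factor_map I \<U> J \<V> X \<Phi>)"
    if "\<Phi> \<in> points ?A" for g \<Phi>
    using psi_map_equivariant[OF ch[OF that], of g] canonical_factor_map_eq[OF that]
      canonical_factor_map_eq[OF act_in_ultracoproduct[OF G_space_UV that, of g]] by simp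
  have "homeomorphic_map (space_of ?A) (space_of ?B) (canonical_factor_map I \<U> J \<V> X) \<longleftrightarrow>
      homeomorphic_map (space_of ?A) (space_of ?B) psi_map"
    by (intro iffI; erule homeomorphic_map_eq) (simp_all add: canonical_factor_map_eq)
  also have "\<dots> \<longleftrightarrow> inj_on psi_map (points ?A)"
  proof
    show "homeomorphic_map (space_of ?A) (space_of ?B) psi_map" if "inj_on psi_map (points ?A)"
      by (rule continuous_imp_homeomorphic_map[OF continuous_map_psi_map_ultracopower fl psi_map_surj that])
  qed (rule homeomorphic_imp_injective_map)
  finally show ?thesis
    unfolding flow_isomorphism_def using eqv by blast
qed

text \<open>Injectivity inverts \<open>psi_map\<close>, so the limit of \<open>r\<close> becomes a
  function on the ultracopower over I \<times> J, which Tietze extension lifts to a jointly uniform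
  \<open>p\<close>. Agreement holds only on the double ultracopower; on single slices it is
  recovered approximately and almost everywhere.\<close>

lemma fubini_pullback_lift:
  assumes inj: "inj_on psi_map (points (ultracopower I \<U> UV))"
    and r: "(\<lambda>z. of_real (r z)) \<in> C_G YI" and r01: "\<And>z. r z \<in> {0..1}"
  obtains p where "\<And>z. p z \<in> {0..1::real}" "(\<lambda>z. of_real (p z)) \<in> C_G YIJ"
    "\<And>\<Phi>. \<Phi> \<in> points (ultracopower I \<U> UV) \<Longrightarrow>
      \<Phi> (fubini_pullback I J \<V> X (\<lambda>z. of_real (p z))) = \<Phi> (\<lambda>z. of_real (r z))"
proof -
  let ?A = "ultracopower I \<U> UV" and ?B = "ultracopower (I \<times> J) (\<U> \<otimes>\<^sub>F \<V>) X"
  let ?r = "\<lambda>z. of_real (r z) :: complex"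
  have fl: "compact_space (space_of ?A)" "Hausdorff_space (space_of ?B)"
    using G_flow_ultracoproduct[OF G_space_UV U] G_flow_ultracoproduct[OF XIJ tensor_ultrafilter[OF U V]]
    by (auto simp: G_flow_def G_space_def)
  have "homeomorphic_map (space_of ?A) (space_of ?B) psi_map"
    by (rule continuous_imp_homeomorphic_map[OF continuous_map_psi_map_ultracopower fl psi_map_surj inj])
  then obtain k where k: "homeomorphic_maps (space_of ?A) (space_of ?B) psi_map k"
    by (auto simp: homeomorphic_map_maps)
  have kc: "continuous_map (space_of ?B) (space_of ?A) k" and k_psi: "\<And>\<Phi>. \<Phi> \<in> points ?A \<Longrightarrow> k (psi_map \<Phi>) = \<Phi>"
    using k by (auto simp: homeomorphic_maps_def)
  have "continuous_map (space_of ?A) euclidean (\<lambda>\<Phi>. \<Phi> ?r)"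
    by (subst space_of_ultracoproduct, rule continuous_map_from_subtopology[OF continuous_map_alpha_eval[OF r]])
  then have "continuous_map (space_of ?A) euclideanreal (\<lambda>\<Phi>. Re (\<Phi> ?r))"
    by (rule continuous_map_euclidean_comp[rotated]) (intro continuous_intros)
  from continuous_map_compose[OF kc this]
  have f: "continuous_map (subtopology (space_of (alpha YIJ)) (points ?B)) euclideanreal (\<lambda>\<omega>. Re (k \<omega> ?r))"
    by (simp only: o_def space_of_ultracoproduct[symmetric])
  \<comment> \<open>The values are real and in the unit interval, so passing to the real part for
    the Tietze extension loses nothing.\<close>
  have val: "\<Phi> ?r \<in> of_real ` {0..1}" if \<Phi>: "\<Phi> \<in> points ?A" for \<Phi>
  proof -
    have cl: "closed (of_real ` {0..1} \<times> UNIV :: (complex \<times> complex) set)"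
      by (intro closed_Times compact_imp_closed compact_continuous_image continuous_intros) auto
    have "(\<Phi> ?r, \<Phi> ?r) \<in> of_real ` {0..1} \<times> UNIV"
      by (rule ultracoproduct_closed_property[OF G_space_UV \<Phi> r r cl]) (use r01 in auto)
    then show ?thesis by simp
  qed
  have kA: "k \<omega> \<in> points ?A" if "\<omega> \<in> points ?B" for \<omega>
    using continuous_map_image_subset_topspace[OF kc] that by blast
  have f01: "(\<lambda>\<omega>. Re (k \<omega> ?r)) ` points ?B \<subseteq> {0..1}"
    using val[OF kA] by force
  obtain p where p: "\<And>z. p z \<in> {0..1::real}" "(\<lambda>z. of_real (p z)) \<in> C_G YIJ"
    "\<And>\<omega>. \<omega> \<in> points ?B \<Longrightarrow> \<omega> (\<lambda>z. of_real (p z)) = of_real (Re (k \<omega> ?r))"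
    using Tietze_alpha[OF G_space_YIJ closedin_ultracoproduct[OF XIJ tensor_ultrafilter[OF U V]] f f01] by blast
  show thesis
  proof (rule that[OF p(1,2)])
    fix \<Phi> assume \<Phi>: "\<Phi> \<in> points ?A"
    have "\<Phi> (fubini_pullback I J \<V> X (\<lambda>z. of_real (p z))) = psi_map \<Phi> (\<lambda>z. of_real (p z))"
      using p(2) by (simp add: psi_map_def)
    also have "\<dots> = of_real (Re (\<Phi> ?r))"
      using p(3)[OF psi_map_in_ultracopower[OF \<Phi>]] k_psi[OF \<Phi>] by simp
    also have "\<dots> = \<Phi> ?r"
      using val[OF \<Phi>] by auto
    finally show "\<Phi> (fubini_pullback I J \<V> X (\<lambda>z. of_real (p z))) = \<Phi> ?r" .
  qed
qed

end

section \<open>The modulus of a function\<close>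

text \<open>Writing \<open>translate X u 0\<close> where \<open>u\<close> would do on the points
  gives the difference the shape treated by \<open>bounded_translate_diff\<close>.\<close>

definition modulus :: "('g::{topological_group_add, t2_space}, 'x) gspace \<Rightarrow> ('x \<Rightarrow> real) \<Rightarrow> 'g \<Rightarrow> real"
  where "modulus X u g = supnorm X (\<lambda>x. translate X u g x - translate X u 0 x)"

lemma modulus_le_iff:
  assumes X: "G_space X" and u: "\<forall>x\<in>points X. u x \<in> {0..1}" and "0 \<le> e"
  shows "modulus X u g \<le> e \<longleftrightarrow> (\<forall>x\<in>points X. \<bar>u (act X g x) - u x\<bar> \<le> e)"
proof -
  have "bounded (u ` points X)"
    using u by (intro boundedI[of _ 1]) auto
  then show ?thesis
    unfolding modulus_def supnorm_le_iff[OF \<open>0 \<le> e\<close> bounded_translate_diff[OF X \<open>bounded (u ` points X)\<close>]]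
    using X by (simp add: translate_def)
qed

lemma modulus_nonneg:
  assumes X: "G_space X" and u: "\<forall>x\<in>points X. u x \<in> {0..1}"
  shows "0 \<le> modulus X u g"
proof -
  have "bounded (u ` points X)"
    using u by (intro boundedI[of _ 1]) auto
  then show ?thesis
    unfolding modulus_def by (intro supnorm_nonneg bounded_translate_diff X)
qed

lemma le_modulus:
  assumes X: "G_space X" and u: "\<forall>x\<in>points X. u x \<in> {0..1}" and x: "x \<in> points X"
  shows "\<bar>u (act X g x) - u x\<bar> \<le> modulus X u g"
  using modulus_le_iff[OF X u modulus_nonneg[OF X u], of g g] x by simp

text \<open>Symmetry comes from the substitution of \<open>act X (- g) x\<close> for
  \<open>x\<close>, subadditivity from the intermediate point \<open>act X h x\<close>. These bound
  the difference of the values at \<open>g\<close> and \<open>h\<close> by the value at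
  \<open>g - h\<close>, so continuity everywhere follows from smallness near the identity, which is
  membership in C_G.\<close>

lemma modulus_SN1:
  fixes X :: "('g::{topological_group_add, t2_space}, 'x) gspace"
  assumes X: "G_space X" and u: "\<forall>x\<in>points X. u x \<in> {0..1}"
    and C: "(\<lambda>x. of_real (u x)) \<in> C_G X"
  shows "modulus X u \<in> SN1"
proof -
  note le_iff = modulus_le_iff[OF X u] and nn = modulus_nonneg[OF X u] and le = le_modulus[OF X u]
  have zero: "modulus X u 0 = 0"
    using le_iff[of 0 0] nn[of 0] X by simp
  have one: "modulus X u g \<le> 1" for g
  proof (subst le_iff)
    show "\<forall>x\<in>points X. \<bar>u (act X g x) - u x\<bar> \<le> 1"
    proof
      fix x assume "x \<in> points X"
      then show "\<bar>u (act X g x) - u x\<bar> \<le> 1"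
        using u[rule_format, of x] u[rule_format, of "act X g x"] X by auto
    qed
  qed auto
  have uminus_le: "modulus X u (- g) \<le> modulus X u g" for g
  proof (subst le_iff)
    show "\<forall>x\<in>points X. \<bar>u (act X (- g) x) - u x\<bar> \<le> modulus X u g"
    proof
      fix x assume x: "x \<in> points X"
      then have "act X g (act X (- g) x) = x"
        using act_add[OF X x, of g "- g"] X by simp
      then show "\<bar>u (act X (- g) x) - u x\<bar> \<le> modulus X u g"
        using le[of "act X (- g) x" g] x X by (simp add: abs_minus_commute)
    qed
  qed (auto simp: nn)
  have uminus: "modulus X u (- g) = modulus X u g" for g
    using uminus_le[of g] uminus_le[of "- g"] by simp
  have add: "modulus X u (g + h) \<le> modulus X u g + modulus X u h" for g h
  proof (subst le_iff)
    show "\<forall>x\<in>points X. \<bar>u (act X (g + h) x) - u x\<bar> \<le> modulus X u g + modulus X u h"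
    proof
      fix x assume x: "x \<in> points X"
      show "\<bar>u (act X (g + h) x) - u x\<bar> \<le> modulus X u g + modulus X u h"
        using le[of "act X h x" g] le[OF x, of h] x X by (simp add: act_add)
    qed
  qed (auto simp: nn)
  have "continuous_on UNIV (modulus X u)"
    unfolding continuous_on_def
  proof (intro ballI tendstoI)
    fix h :: 'g and e :: real assume "e > 0"
    have "((\<lambda>g. g - h) \<longlongrightarrow> h - h) (at h within UNIV)"
      by (intro tendsto_intros)
    then have lim: "filterlim (\<lambda>g. g - h) (nhds 0) (at h within UNIV)" by simp
    have "e / 2 > 0" using \<open>e > 0\<close> by simp
    from C_G_D(4)[OF X C this]
    have "eventually (\<lambda>g. modulus X u g \<le> e / 2) (nhds 0)"
    proof eventually_elim
      case (elim g)
      have "cmod (of_real a - of_real b) = \<bar>a - b\<bar>" for a b :: real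
        by (simp flip: of_real_diff)
      with elim show ?case using \<open>e > 0\<close> by (subst le_iff) simp_all
    qed
    from eventually_compose_filterlim[OF this lim]
    show "eventually (\<lambda>g. dist (modulus X u g) (modulus X u h) < e) (at h within UNIV)"
    proof eventually_elim
      case (elim g)
      have "modulus X u g \<le> modulus X u (g - h) + modulus X u h"
        using add[of "g - h" h] by simp
      moreover have "modulus X u h \<le> modulus X u (g - h) + modulus X u g"
        using add[of "- (g - h)" g] uminus[of "g - h"] by simp
      ultimately show ?case
        using elim \<open>e > 0\<close> by (simp add: dist_real_def)
    qed
  qed
  moreover have "bounded (range (modulus X u))"
    using nn one by (intro boundedI[of _ 1]) auto
  ultimately show ?thesis
    using nn zero uminus add one by (auto simp: SN1_def seminorm_def)
qed

section \<open>Separation by orbit-Lipschitz functions\<close>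

text \<open>The competitors in the supremum defining \<open>rho_dist\<close>, with the norm
  inequality spelled out at points.\<close>

definition Lipschitz_functions :: "('g::{topological_group_add, t2_space}, 'x) gspace \<Rightarrow> ('g \<Rightarrow> real) \<Rightarrow> ('x \<Rightarrow> real) set"
  where "Lipschitz_functions X \<sigma> = {f. continuous_map (space_of X) euclideanreal f \<and>
    (\<forall>x\<in>points X. f x \<in> {0..1}) \<and> (\<forall>g. \<forall>x\<in>points X. \<bar>f (act X g x) - f x\<bar> \<le> \<sigma> g)}"

lemma Lipschitz_functions_iff:
  assumes X: "G_space X" and \<sigma>: "\<And>g. 0 \<le> \<sigma> g"
  shows "f \<in> Lipschitz_functions X \<sigma> \<longleftrightarrow>
    continuous_map (space_of X) euclideanreal f \<and> f \<in> points X \<rightarrow> {0..1} \<and> orbit_Lipschitz X \<sigma> f"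
proof -
  have "orbit_Lipschitz X \<sigma> f \<longleftrightarrow> (\<forall>g. \<forall>x\<in>points X. \<bar>f (act X g x) - f x\<bar> \<le> \<sigma> g)"
    if f: "\<And>x. x \<in> points X \<Longrightarrow> f x \<in> {0..1}"
  proof -
    have b: "bounded ((\<lambda>x. translate X f g x - f x) ` points X)" for g
    proof (intro boundedI[of _ 1])
      fix y assume "y \<in> (\<lambda>x. translate X f g x - f x) ` points X"
      then obtain x where "x \<in> points X" "y = f (act X g x) - f x"
        by (auto simp: translate_def)
      then show "norm y \<le> 1"
        using f[of x] f[of "act X g x"] X by auto
    qed
    show ?thesis
      unfolding orbit_Lipschitz_def supnorm_le_iff[OF \<sigma> b] by (simp add: translate_def)
  qed
  then show ?thesis
    unfolding Lipschitz_functions_def by (auto simp: Pi_iff)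
qed

section \<open>Lattice operations on orbit-Lipschitz functions\<close>

lemma Lipschitz_functions_const:
  assumes "\<And>g. 0 \<le> \<sigma> g" "c \<in> {0..1}"
  shows "(\<lambda>_. c) \<in> Lipschitz_functions X \<sigma>"
  using assms by (simp add: Lipschitz_functions_def)

lemma Lipschitz_functions_max:
  assumes "f \<in> Lipschitz_functions X \<sigma>" "h \<in> Lipschitz_functions X \<sigma>"
  shows "(\<lambda>x. max (f x) (h x)) \<in> Lipschitz_functions X \<sigma>"
proof -
  have "\<bar>max a b - max c d\<bar> \<le> s" if "\<bar>a - c\<bar> \<le> s" "\<bar>b - d\<bar> \<le> s" for a b c d s :: real
    using that by (auto simp: max_def)
  then show ?thesis
    using assms by (auto simp: Lipschitz_functions_def intro: continuous_map_real_max)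
qed

lemma Lipschitz_functions_min:
  assumes "f \<in> Lipschitz_functions X \<sigma>" "h \<in> Lipschitz_functions X \<sigma>"
  shows "(\<lambda>x. min (f x) (h x)) \<in> Lipschitz_functions X \<sigma>"
proof -
  have "\<bar>min a b - min c d\<bar> \<le> s" if "\<bar>a - c\<bar> \<le> s" "\<bar>b - d\<bar> \<le> s" for a b c d s :: real
    using that by (auto simp: min_def)
  then show ?thesis
    using assms by (auto simp: Lipschitz_functions_def min.coboundedI1 intro: continuous_map_real_min)
qed

text \<open>With \<open>c\<close> the value of \<open>f\<close> at a chosen point, this moves the
  value there to 0 while keeping the range in the unit interval.\<close>

lemma Lipschitz_functions_truncate:
  assumes "f \<in> Lipschitz_functions X \<sigma>" "\<And>g. 0 \<le> \<sigma> g" "0 \<le> c"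
  shows "(\<lambda>x. max 0 (f x - c)) \<in> Lipschitz_functions X \<sigma>"
proof -
  have "\<bar>max 0 (a - c) - max 0 (b - c)\<bar> \<le> s" if "\<bar>a - b\<bar> \<le> s" for a b s :: real
    using that by (auto simp: max_def)
  moreover have "continuous_map (space_of X) euclideanreal (\<lambda>x. max 0 (f x - c))"
    using assms(1) by (intro continuous_map_real_max continuous_map_diff) (auto simp: Lipschitz_functions_def)
  ultimately show ?thesis
    using assms by (force simp: Lipschitz_functions_def)
qed

lemma Lipschitz_functions_flip:
  assumes "f \<in> Lipschitz_functions X \<sigma>" 
  shows "(\<lambda>x. 1 - f x) \<in> Lipschitz_functions X \<sigma>"
proof -
  have "continuous_map (space_of X) euclideanreal (\<lambda>x. 1 - f x)"
    using assms by (intro continuous_map_diff) (auto simp: Lipschitz_functions_def)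
  moreover have "\<bar>(1 - a) - (1 - b)\<bar> = \<bar>a - b\<bar>" for a b :: real
    by simp
  ultimately show ?thesis
    using assms by (auto simp: Lipschitz_functions_def)
qed

text \<open>A finite maximum, with the constant 0 for the empty family.\<close>

lemma Lipschitz_upper_bound:
  assumes "finite T" "T \<subseteq> Lipschitz_functions X \<sigma>" "\<And>g. 0 \<le> \<sigma> g" "\<And>v. v \<in> T \<Longrightarrow> v x = 0"
  shows "\<exists>w\<in>Lipschitz_functions X \<sigma>. w x = 0 \<and> (\<forall>v\<in>T. \<forall>z. v z \<le> w z)"
  using assms(1,2,4)
proof (induction T rule: finite_induct)
  case empty
  show ?case
    by (rule bexI[OF _ Lipschitz_functions_const[of _ 0]]) (use assms(3) in auto)
next
  case (insert v T)
  then obtain w where w: "w \<in> Lipschitz_functions X \<sigma>" "w x = 0" "\<forall>v\<in>T. \<forall>z. v z \<le> w z"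
    by auto
  show ?case
  proof (rule bexI[OF _ Lipschitz_functions_max[OF w(1), of v]])
    show "max (w x) (v x) = 0 \<and> (\<forall>va\<in>insert v T. \<forall>z. va z \<le> max (w z) (v z))"
      using w insert.prems(2)[of v] by (auto simp: le_max_iff_disj)
  qed (use insert in auto)
qed

text \<open>A finite minimum, with the constant 1 for the empty family; \<open>c < 1\<close> makes
  that constant admissible.\<close>

lemma Lipschitz_lower_bound:
  assumes "finite T" "T \<subseteq> Lipschitz_functions X \<sigma>" "\<And>g. 0 \<le> \<sigma> g" "c < 1" "\<And>v y. v \<in> T \<Longrightarrow> y \<in> B \<Longrightarrow> c < v y"
  shows "\<exists>w\<in>Lipschitz_functions X \<sigma>. (\<forall>y\<in>B. c < w y) \<and> (\<forall>v\<in>T. \<forall>z. w z \<le> v z)"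
  using assms(1,2,5)
proof (induction T rule: finite_induct)
  case empty
  show ?case
    by (rule bexI[OF _ Lipschitz_functions_const[of _ 1]]) (use assms(3,4) in auto)
next
  case (insert v T)
  then obtain w where w: "w \<in> Lipschitz_functions X \<sigma>" "\<forall>y\<in>B. c < w y" "\<forall>v\<in>T. \<forall>z. w z \<le> v z"
    by auto
  show ?case
  proof (rule bexI[OF _ Lipschitz_functions_min[OF w(1), of v]])
    show "(\<forall>y\<in>B. c < min (w y) (v y)) \<and> (\<forall>va\<in>insert v T. \<forall>z. min (w z) (v z) \<le> va z)"
      using w insert.prems(2)[of v] by (auto simp: min_le_iff_disj)
  qed (use insert in auto)
qed

text \<open>If the distance were below 1/4, a point near \<open>x\<close> could be moved near
  \<open>y\<close> by some \<open>g\<close> with \<sigma>(g) barely above 1/4 at most. That raises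
  \<open>u\<close> by little more than 1/4 + 1/8, short of the required 1/2.\<close>

lemma partial_dist_lower_bound:
  assumes X: "G_space X"
    and u: "continuous_map (space_of X) euclideanreal u"
    and lip: "\<And>g x. x \<in> points X \<Longrightarrow> \<bar>u (act X g x) - u x\<bar> \<le> \<sigma> g + 1/8"
    and x: "x \<in> points X" "u x \<le> 1/4" and y: "y \<in> points X" "3/4 \<le> u y"
  shows "1/4 \<le> partial_dist X \<sigma> x y"
proof (rule ccontr)
  assume "\<not> ?thesis"
  then have "partial_dist X \<sigma> x y < 1/4" by simp
  then obtain c where c: "0 \<le> c" "c < 1/4" "translates_meet X \<sigma> x y c"
    unfolding partial_dist_def by (subst (asm) cInf_less_iff) (auto intro!: bdd_belowI[of _ 0])
  \<comment> \<open>The slack 1/2 - 1/8 - 1/4 = 1/8 is divided into three parts of 1/24: one for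
    each neighbourhood and one for \<epsilon>. The strict inequalities then give the
    contradiction.\<close>
  define A where "A = {z \<in> points X. u z \<in> {..<1/4 + 1/24}}"
  define B where "B = {z \<in> points X. u z \<in> {3/4 - 1/24<..}}"
  have "openin (space_of X) A" "openin (space_of X) B"
    unfolding A_def B_def by (rule openin_continuous_map_preimage[OF u], simp)+
  moreover have "x \<in> A" "y \<in> B"
    using x y by (auto simp: A_def B_def)
  moreover have "(1/24 :: real) > 0" by simp
  ultimately have "{act X g a | g a. g \<in> seminorm_ball \<sigma> (c + 1/24) \<and> a \<in> A} \<inter> B \<noteq> {}"
    using c(3)[unfolded translates_meet_def] by blast
  then obtain g a where ga: "g \<in> seminorm_ball \<sigma> (c + 1/24)" "a \<in> A" "act X g a \<in> B"
    by blast
  then have "\<sigma> g < c + 1/24" "u a < 1/4 + 1/24" "3/4 - 1/24 < u (act X g a)" "a \<in> points X"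
    by (auto simp: seminorm_ball_def A_def B_def)
  then show False
    using lip[of a g] c(2) by simp
qed

text \<open>A near-optimal competitor is flipped if necessary so that it increases from
  \<open>x\<close> to \<open>y\<close>, and then truncated at its value at \<open>x\<close>.\<close>

lemma rho_dist_gt:
  assumes X: "G_space X" and \<sigma>: "\<And>g. 0 \<le> \<sigma> g" and c: "c < rho_dist X \<sigma> x y"
    and x: "x \<in> points X" and y: "y \<in> points X" and "0 \<le> c"
  obtains v where "v \<in> Lipschitz_functions X \<sigma>" "v x = 0" "c < v y"
proof -
  have "rho_dist X \<sigma> x y = Sup {\<bar>f x - f y\<bar> | f. f \<in> Lipschitz_functions X \<sigma>}"
    unfolding rho_dist_def Lipschitz_functions_iff[OF X \<sigma>] ..
  moreover have "{\<bar>f x - f y\<bar> | f. f \<in> Lipschitz_functions X \<sigma>} \<noteq> {}"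
    using Lipschitz_functions_const[of \<sigma> 0 X, OF \<sigma>] by auto
  ultimately obtain f where f: "f \<in> Lipschitz_functions X \<sigma>" "c < \<bar>f x - f y\<bar>"
    using c less_cSupD[of "{\<bar>f x - f y\<bar> | f. f \<in> Lipschitz_functions X \<sigma>}" c] by auto
  have "\<exists>h\<in>Lipschitz_functions X \<sigma>. c < h y - h x"
  proof (cases "f x \<le> f y")
    case True
    then show ?thesis using f by auto
  next
    case False
    then show ?thesis using Lipschitz_functions_flip[OF f(1)] f(2) by force
  qed
  then obtain h where h: "h \<in> Lipschitz_functions X \<sigma>" "c < h y - h x" by blast
  have "0 \<le> h x"
    using h(1) x by (auto simp: Lipschitz_functions_def)
  from Lipschitz_functions_truncate[OF h(1) \<sigma> this] show thesis
    by (rule that) (use h(2) in auto)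
qed

text \<open>Functions separating pairs of points are combined by two compactness arguments: for
  fixed \<open>x\<close> finitely many of them cover \<open>B\<close> and their maximum is large on
  \<open>B\<close> while still 0 at \<open>x\<close>; then finitely many such maxima are small on
  sets covering \<open>A\<close>, and their minimum separates \<open>A\<close> from
  \<open>B\<close>.\<close>

lemma Lipschitz_separation:
  assumes X: "G_flow X" and \<sigma>: "\<sigma> \<in> SN1"
    and eq: "\<And>x y. x \<in> points X \<Longrightarrow> y \<in> points X \<Longrightarrow> rho_dist X \<sigma> x y = partial_dist X \<sigma> x y"
    and u: "continuous_map (space_of X) euclideanreal u"
    and lip: "\<And>g x. x \<in> points X \<Longrightarrow> \<bar>u (act X g x) - u x\<bar> \<le> \<sigma> g + 1/8"
  obtains f where "f \<in> Lipschitz_functions X \<sigma>"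
    "\<And>x. x \<in> points X \<Longrightarrow> u x \<le> 1/4 \<Longrightarrow> f x \<le> 1/20"
    "\<And>x. x \<in> points X \<Longrightarrow> 3/4 \<le> u x \<Longrightarrow> 1/5 \<le> f x"
proof -
  let ?L = "Lipschitz_functions X \<sigma>"
  have GX: "G_space X" and cX: "compact_space (space_of X)" using X by (auto simp: G_flow_def)
  have \<sigma>0: "0 \<le> \<sigma> g" for g
    using \<sigma> by (simp add: SN1_def seminorm_def)
  define A where "A = {x \<in> points X. u x \<in> {..1/4}}"
  define B where "B = {x \<in> points X. u x \<in> {3/4..}}"
  have "closedin (space_of X) A" "closedin (space_of X) B"
    unfolding A_def B_def by (rule closedin_continuous_map_preimage[OF u], simp)+
  then have cA: "compactin (space_of X) A" and cB: "compactin (space_of X) B"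
    using closedin_compact_space[OF cX] by auto
  have contL: "continuous_map (space_of X) euclideanreal v" if "v \<in> ?L" for v
    using that by (simp add: Lipschitz_functions_def)
  have pt: "\<exists>v\<in>?L. v x = 0 \<and> (\<forall>y\<in>B. 1/5 < v y)" if x: "x \<in> A" for x
  proof -
    have "\<exists>v\<in>?L. v x = 0 \<and> 1/5 < v y" if y: "y \<in> B" for y
    proof -
      have xy: "x \<in> points X" "u x \<le> 1/4" "y \<in> points X" "3/4 \<le> u y"
        using x y by (auto simp: A_def B_def)
      \<comment> \<open>The lower bound 1/4 on \<partial>_\<sigma> is turned into one on
        \<rho>_\<sigma>; anything below 1/4 is strictly exceeded by a competitor. The later 1/20
        only has to be positive and below 1/5.\<close>
      have "1/5 < rho_dist X \<sigma> x y"
        using partial_dist_lower_bound[OF GX u lip xy] eq[OF xy(1,3)] by simp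
      from rho_dist_gt[OF GX \<sigma>0 this xy(1,3)] show ?thesis by auto
    qed
    then obtain v where v: "\<And>y. y \<in> B \<Longrightarrow> v y \<in> ?L \<and> v y x = 0 \<and> 1/5 < v y y"
      by metis
    define N where "N = (\<lambda>y. {z \<in> points X. v y z \<in> {1/5<..}})"
    have "\<exists>\<F>. finite \<F> \<and> \<F> \<subseteq> N ` B \<and> B \<subseteq> \<Union>\<F>"
    proof (rule compactinD[OF cB])
      show "openin (space_of X) W" if "W \<in> N ` B" for W
      proof -
        from that obtain y where "y \<in> B" "W = N y" by blast
        then show ?thesis
          unfolding N_def using openin_continuous_map_preimage[OF contL[of "v y"], of "{1/5<..}"] v by simp
      qed
      show "B \<subseteq> \<Union> (N ` B)"
      proof
        fix y assume y: "y \<in> B"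
        then have "y \<in> N y" using v[OF y] by (simp add: N_def B_def)
        then show "y \<in> \<Union> (N ` B)" using y by blast
      qed
    qed
    then obtain \<F> where "finite \<F>" "\<F> \<subseteq> N ` B" "B \<subseteq> \<Union>\<F>" by blast
    then obtain C where C: "finite C" "C \<subseteq> B" "B \<subseteq> \<Union> (N ` C)"
      by (metis finite_subset_image)
    have "\<exists>w\<in>?L. w x = 0 \<and> (\<forall>v\<in>v ` C. \<forall>z. v z \<le> w z)"
      by (rule Lipschitz_upper_bound[OF _ _ \<sigma>0]) (use C v in auto)
    then obtain w where w: "w \<in> ?L" "w x = 0" "\<And>y z. y \<in> C \<Longrightarrow> v y z \<le> w z"
      by blast
    have "1/5 < w z" if z: "z \<in> B" for z
    proof -
      obtain y where y: "y \<in> C" "z \<in> N y" using C(3) z by blast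
      then have "1/5 < v y z" by (simp add: N_def)
      then show ?thesis using w(3)[OF y(1), of z] by simp
    qed
    then show ?thesis using w(1,2) by blast
  qed
  then obtain v where v: "\<And>x. x \<in> A \<Longrightarrow> v x \<in> ?L \<and> v x x = 0 \<and> (\<forall>y\<in>B. 1/5 < v x y)"
    by metis
  define N where "N = (\<lambda>x. {z \<in> points X. v x z \<in> {..<1/20}})"
  have "\<exists>\<F>. finite \<F> \<and> \<F> \<subseteq> N ` A \<and> A \<subseteq> \<Union>\<F>"
  proof (rule compactinD[OF cA])
    show "openin (space_of X) W" if "W \<in> N ` A" for W
    proof -
      from that obtain x where "x \<in> A" "W = N x" by blast
      then show ?thesis
        unfolding N_def using openin_continuous_map_preimage[OF contL[of "v x"], of "{..<1/20}"] v by simp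
    qed
    show "A \<subseteq> \<Union> (N ` A)"
    proof
      fix x assume x: "x \<in> A"
      then have "x \<in> N x" using v[OF x] by (simp add: N_def A_def)
      then show "x \<in> \<Union> (N ` A)" using x by blast
    qed
  qed
  then obtain \<F> where "finite \<F>" "\<F> \<subseteq> N ` A" "A \<subseteq> \<Union>\<F>" by blast
  then obtain C where C: "finite C" "C \<subseteq> A" "A \<subseteq> \<Union> (N ` C)"
    by (metis finite_subset_image)
  have "\<exists>w\<in>?L. (\<forall>y\<in>B. 1/5 < w y) \<and> (\<forall>v\<in>v ` C. \<forall>z. w z \<le> v z)"
    by (rule Lipschitz_lower_bound[OF _ _ \<sigma>0]) (use C v in auto)
  then obtain w where w: "w \<in> ?L" "\<And>y. y \<in> B \<Longrightarrow> 1/5 < w y" "\<And>x z. x \<in> C \<Longrightarrow> w z \<le> v x z"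
    by blast
  show thesis
  proof (rule that[OF w(1)])
    fix z assume z: "z \<in> points X" "u z \<le> 1/4"
    then have "z \<in> A" by (simp add: A_def)
    then obtain x where x: "x \<in> C" "z \<in> N x" using C(3) by blast
    then have "v x z < 1/20" by (simp add: N_def)
    then show "w z \<le> 1/20" using w(3)[OF x(1), of z] by simp
  next
    fix z assume "z \<in> points X" "3/4 \<le> u z"
    then have "z \<in> B" by (simp add: B_def)
    then show "1/5 \<le> w z" using w(2)[of z] by simp
  qed
qed

section \<open>Continuous functions of the values of a character\<close>

lemma cmod_of_real_diff: "cmod (of_real a - of_real b) = \<bar>a - b\<bar>"
  by (simp flip: of_real_diff)

text \<open>Continuity of \<open>f\<close> suffices because the character is a limit of point
  evaluations.\<close>

lemma character_comp:
  assumes X: "G_space X" and \<phi>: "\<phi> \<in> characters X" and p: "p \<in> C_G X" and f: "continuous_on UNIV f"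
  shows "\<phi> (on_points X (\<lambda>x. f (p x))) = f (\<phi> p)"
proof -
  obtain F where F: "represents X F \<phi>"
    using character_imp_represents[OF X \<phi>] .
  have "((\<lambda>x. f (p x)) \<longlongrightarrow> f (\<phi> p)) F"
    using f by (intro continuous_on_tendsto_compose[OF f representsD(3)[OF F p]]) auto
  moreover have "eventually (\<lambda>x. f (p x) = on_points X (\<lambda>x. f (p x)) x) F"
    using representsD(2)[OF F] by eventually_elim simp
  ultimately have "(on_points X (\<lambda>x. f (p x)) \<longlongrightarrow> f (\<phi> p)) F"
    by (rule Lim_transform_eventually)
  then show ?thesis
    using tendsto_unique[OF representsD(1)[OF F] representsD(3)[OF F C_G_comp[OF X f p]]] by blast
qed

lemma character_range:
  assumes X: "G_space X" and \<phi>: "\<phi> \<in> characters X" and p: "p \<in> C_G X" and S: "closed S"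
    and pS: "\<And>x. x \<in> points X \<Longrightarrow> p x \<in> S"
  shows "\<phi> p \<in> S"
proof -
  obtain F where F: "represents X F \<phi>"
    using character_imp_represents[OF X \<phi>] .
  have "eventually (\<lambda>x. p x \<in> S) F"
    using representsD(2)[OF F] by eventually_elim (rule pS)
  then show ?thesis
    by (rule Lim_in_closed_set[OF S _ representsD(1)[OF F] representsD(3)[OF F p]])
qed

lemma closed_unit_interval: "closed (of_real ` {0..1} :: complex set)"
  by (intro compact_imp_closed compact_continuous_image continuous_intros) auto

section \<open>Semi-norms on the group\<close>

lemma points_translation_space [simp]: "points translation_space = UNIV"
  and act_translation_space [simp]: "act translation_space = (+)"
  by (simp_all add: translation_space_def)

lemma G_space_translation_space:
  "G_space (translation_space :: ('g::{topological_group_add, t2_space}, 'g) gspace)"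
proof -
  have "continuous_on UNIV (\<lambda>z::'g \<times> 'g. fst z + snd z)"
    by (intro continuous_intros)
  moreover have "Hausdorff_space (euclidean :: 'g topology)"
    using hausdorff by (fastforce simp: Hausdorff_space_def disjnt_def)
  ultimately show ?thesis
    unfolding G_space_def by (simp add: translation_space_def case_prod_unfold add.assoc)
qed

lemma G_space_Samuel:
  "G_space (Samuel :: ('g::{topological_group_add, t2_space}, ('g \<Rightarrow> complex) \<Rightarrow> complex) gspace)"
proof -
  have "G_flow (alpha (translation_space :: ('g, 'g) gspace))"
    by (rule G_flow_alpha[OF G_space_translation_space])
  then show ?thesis
    by (simp add: Samuel_def G_flow_def)
qed

lemma SN1_D:
  assumes "\<sigma> \<in> SN1"
  shows "\<sigma> 0 = 0" "0 \<le> \<sigma> g" "\<sigma> g \<le> 1" "\<sigma> (- g) = \<sigma> g" "\<sigma> (g + h) \<le> \<sigma> g + \<sigma> h" "continuous_on UNIV \<sigma>"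
  using assms by (auto simp: SN1_def seminorm_def)

lemma SN1_diff_le:
  assumes "\<sigma> \<in> SN1"
  shows "\<bar>\<sigma> (h + g) - \<sigma> g\<bar> \<le> \<sigma> h"
proof -
  have "\<sigma> g \<le> \<sigma> (- h) + \<sigma> (h + g)"
    using SN1_D(5)[OF assms, of "- h" "h + g"] by (simp add: add.assoc[symmetric])
  then show ?thesis
    using SN1_D(5)[OF assms, of h g] SN1_D(4)[OF assms, of h] by linarith
qed

lemma SN1_small:
  assumes "\<sigma> \<in> SN1" "e > 0"
  shows "eventually (\<lambda>g. \<sigma> g \<le> e) (nhds 0)"
proof -
  have "isCont \<sigma> 0"
    using SN1_D(6)[OF assms(1)] by (simp add: continuous_on_eq_continuous_at)
  then have "(\<sigma> \<longlongrightarrow> \<sigma> 0) (nhds 0)"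
    by (simp add: continuous_at tendsto_at_iff_tendsto_nhds)
  from tendstoD[OF this \<open>e > 0\<close>] show ?thesis
    by eventually_elim (use SN1_D(1)[OF assms(1)] in \<open>auto simp: dist_real_def\<close>)
qed

text \<open>By the reverse triangle inequality left translation by \<open>h\<close> changes \<sigma>
  by at most \<sigma>(h), which is small near the identity. Hence \<sigma> extends to the Samuel
  compactification.\<close>

lemma SN1_C_G:
  assumes "\<sigma> \<in> SN1"
  shows "(\<lambda>g. of_real (\<sigma> g)) \<in> C_G translation_space"
proof (rule C_G_I[OF G_space_translation_space, of _ 1])
  have "continuous_on UNIV (\<lambda>g. of_real (\<sigma> g) :: complex)"
    using SN1_D(6)[OF assms] by (intro continuous_intros)
  then show "continuous_map (space_of translation_space) euclidean (\<lambda>g. of_real (\<sigma> g) :: complex)"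
    by (simp add: translation_space_def)
  fix e :: real assume "e > 0"
  show "eventually (\<lambda>h. \<forall>g\<in>points translation_space. cmod (of_real (\<sigma> (act translation_space h g)) - of_real (\<sigma> g)) \<le> e) (nhds 0)"
    using SN1_small[OF assms \<open>e > 0\<close>]
    by eventually_elim (auto simp: cmod_of_real_diff intro: order_trans[OF SN1_diff_le[OF assms]])
qed (use SN1_D[OF assms] in auto)

text \<open>The reverse triangle inequality passes to the extension of \<sigma>: moving any point of
  Sa(G) by \<open>h\<close> changes it by at most \<sigma>(h).\<close>

lemma Samuel_seminorm_translate:
  fixes \<sigma> :: "'g::{topological_group_add, t2_space} \<Rightarrow> real"
  assumes \<sigma>: "\<sigma> \<in> SN1" and s: "s \<in> characters translation_space"
  shows "cmod (act Samuel h s (\<lambda>g. of_real (\<sigma> g)) - s (\<lambda>g. of_real (\<sigma> g))) \<le> \<sigma> h"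
proof -
  let ?T = "translation_space :: ('g, 'g) gspace"
  note C = SN1_C_G[OF \<sigma>]
  have "cmod (s (translate ?T (\<lambda>g. of_real (\<sigma> g)) h) - s (\<lambda>g. of_real (\<sigma> g))) \<le> \<sigma> h"
    by (rule character_diff_bound[OF G_space_translation_space s C_G_translate[OF G_space_translation_space C] C])
      (simp add: translate_def cmod_of_real_diff SN1_diff_le[OF \<sigma>])
  then show ?thesis
    using C by (simp add: Samuel_def act_alpha)
qed

section \<open>Injectivity of the canonical factor map\<close>

text \<open>
  In the proof, \<open>W i j\<close> is the modulus $\omega_{ij}$ of $q_{ij}$, \<open>om i\<close> is its extension to
  $J\times\mathrm{Sa}(G)$, and \<open>R\<close> is the resulting function on
  $I\times\Sigma^G_{\mathcal V}\mathrm{Sa}(G)$. That \<open>R\<close> is in $\mathrm{C}_G$ rests on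
  $\lim_{j\to\mathcal V}\omega_{ij}(h)\le\|rh-r\|$, uniformly in \<open>i\<close>.
\<close>

lemma fubini_group_dominates:
  fixes X :: "('g::{topological_group_add, t2_space}, 'x) gspace"
  assumes X: "G_space X" and U: "\<U> \<in> ultrafilters_on I" and V: "\<V> \<in> ultrafilters_on J"
    and inj: "inj_on (psi_map (Samuel :: ('g, ('g \<Rightarrow> complex) \<Rightarrow> complex) gspace) I J \<V>)
      (points (ultracopower I \<U> (ultracopower J \<V> Samuel)))"
    and r: "(\<lambda>z. of_real (r z)) \<in> C_G (sum_gspace I (\<lambda>_. ultracopower J \<V> X))"
    and Q: "\<And>i z. Q i z \<in> {0..1}"
      "\<And>i. i \<in> I \<Longrightarrow> (\<lambda>z. of_real (Q i z)) \<in> C_G (sum_gspace J (\<lambda>_. X))"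
      "\<And>i \<xi>. i \<in> I \<Longrightarrow> \<xi> \<in> points (ultracopower J \<V> X) \<Longrightarrow> \<xi> (\<lambda>z. of_real (Q i z)) = of_real (r (i, \<xi>))"
  obtains \<tau> where "\<tau> \<in> SN1"
    "eventually (\<lambda>ij. \<forall>g. \<forall>x\<in>points X. \<bar>Q (fst ij) (snd ij, act X g x) - Q (fst ij) (snd ij, x)\<bar> \<le> \<tau> g + 1/8) (\<U> \<otimes>\<^sub>F \<V>)"
proof -
  let ?T = "translation_space :: ('g, 'g) gspace"
  let ?S = "Samuel :: ('g, ('g \<Rightarrow> complex) \<Rightarrow> complex) gspace"
  let ?YJ = "sum_gspace J (\<lambda>_. X)" and ?K = "ultracopower J \<V> X"
  let ?SJ = "sum_gspace J (\<lambda>_. ?S)" and ?L = "ultracopower J \<V> ?S"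
  note S = G_space_Samuel
  have pS: "points ?S = characters ?T"
    by (simp add: Samuel_def)
  have XJ: "\<forall>j\<in>J. G_space X" and SJ: "\<forall>j\<in>J. G_space ?S" and SIJ: "\<forall>j\<in>I \<times> J. G_space ?S"
    using X S by auto
  note GYJ = G_space_sum[OF XJ] and GSJ = G_space_sum[OF SJ] and GSIJ = G_space_sum[OF SIJ]
  have L: "\<forall>i\<in>I. G_space ?L" and K: "\<forall>i\<in>I. G_space ?K"
    using G_flow_ultracoproduct[OF SJ V] G_flow_ultracoproduct[OF XJ V] by (auto simp: G_flow_def)
  have evI: "eventually (\<lambda>i. i \<in> I) \<U>" and evJ: "eventually (\<lambda>j. j \<in> J) \<V>"
    using U V by (auto simp: ultrafilters_on_def)
  define W where "W = (\<lambda>i j. modulus X (\<lambda>x. Q i (j, x)))"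
  have Q01: "\<forall>x\<in>points X. Q i (j, x) \<in> {0..1}" for i j
    using Q(1) by blast
  have W_SN1: "W i j \<in> SN1" if "i \<in> I" "j \<in> J" for i j
    unfolding W_def by (rule modulus_SN1[OF X Q01 C_G_sum_slice[OF XJ Q(2)[OF that(1)] that(2)]])
  have W_le_iff: "W i j g \<le> e \<longleftrightarrow> (\<forall>x\<in>points X. \<bar>Q i (j, act X g x) - Q i (j, x)\<bar> \<le> e)" if "0 \<le> e" for i j g e
    unfolding W_def by (rule modulus_le_iff[OF X Q01 that])
  define om where "om = (\<lambda>i (j, s). if j \<in> J \<and> s \<in> characters ?T then s (\<lambda>g. of_real (W i j g)) else (0 :: complex))"
  have om: "om i (j, s) = s (\<lambda>g. of_real (W i j g))" if "j \<in> J" "s \<in> characters ?T" for i j s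
    using that by (simp add: om_def)
  have act_S: "act ?S h s \<in> characters ?T" if "s \<in> characters ?T" for h s
    using act_points[OF S, of s h] that by (simp add: pS)
  have om_act: "cmod (om i (j, act ?S h s) - om i (j, s)) \<le> W i j h"
    if "i \<in> I" "j \<in> J" "s \<in> characters ?T" for i j h s
    using Samuel_seminorm_translate[OF W_SN1[OF that(1,2)] that(3), of h] that act_S[OF that(3)] by (simp add: om)
  have om01: "om i (j, s) \<in> of_real ` {0..1}" if "i \<in> I" "j \<in> J" "s \<in> characters ?T" for i j s
    unfolding om[OF that(2,3)]
    by (rule character_range[OF G_space_translation_space that(3) SN1_C_G[OF W_SN1[OF that(1,2)]] closed_unit_interval])
      (use SN1_D[OF W_SN1[OF that(1,2)]] in auto)
  have om_C: "om i \<in> C_G ?SJ" if i: "i \<in> I" for i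
  proof (rule C_G_sum_I[OF SJ, of _ 1])
    fix j assume j: "j \<in> J"
    have "continuous_map (space_of ?S) euclidean (\<lambda>s. s (\<lambda>g. of_real (W i j g)))"
      unfolding Samuel_def by (rule continuous_map_alpha_eval[OF SN1_C_G[OF W_SN1[OF i j]]])
    then show "continuous_map (space_of ?S) euclidean (\<lambda>s. om i (j, s))"
      by (rule continuous_map_eq) (simp add: om j pS)
    show "cmod (om i (j, s)) \<le> 1" if "s \<in> points ?S" for s
      using om01[OF i j, of s] that pS by auto
  next
    fix j s assume "j \<notin> J \<or> s \<notin> points ?S"
    then show "om i (j, s) = 0"
      by (auto simp: om_def pS)
  next
    fix e :: real assume "e > 0"
    \<comment> \<open>For fixed \<open>i\<close> the function \<open>Q i\<close> has one modulus for
      all \<open>j\<close>, so all \<open>W i j h\<close> are small together. No such uniformity in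
      \<open>i\<close> is available.\<close>
    from C_G_D(4)[OF GYJ Q(2)[OF i] this]
    show "eventually (\<lambda>h. \<forall>j\<in>J. \<forall>s\<in>points ?S. cmod (om i (j, act ?S h s) - om i (j, s)) \<le> e) (nhds 0)"
    proof eventually_elim
      case (elim h)
      have "W i j h \<le> e" if "j \<in> J" for j
        using elim that \<open>e > 0\<close> by (subst W_le_iff) (auto simp: cmod_of_real_diff)
      then show ?case
        using om_act[OF i] pS by (blast intro: order_trans)
    qed
  qed
  define R where "R = (\<lambda>(i, \<xi>). if i \<in> I \<and> \<xi> \<in> points ?L then Re (\<xi> (om i)) else 0)"
  have om_R: "\<xi> (om i) = of_real (R (i, \<xi>))" "R (i, \<xi>) \<in> {0..1}" if i: "i \<in> I" and \<xi>: "\<xi> \<in> points ?L" for i \<xi>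
  proof -
    have "\<xi> \<in> characters ?SJ"
      using \<xi> by (simp add: points_ultracoproduct)
    then have "\<xi> (om i) \<in> of_real ` {0..1}"
      by (rule character_range[OF GSJ _ om_C[OF i] closed_unit_interval]) (use om01[OF i] pS in auto)
    then show "\<xi> (om i) = of_real (R (i, \<xi>))" "R (i, \<xi>) \<in> {0..1}"
      using i \<xi> by (auto simp: R_def)
  qed
  have R01: "R z \<in> {0..1}" for z
  proof (cases z)
    case (Pair i \<xi>)
    then show ?thesis
      using om_R(2)[of i \<xi>] by (cases "i \<in> I \<and> \<xi> \<in> points ?L") (auto simp: R_def)
  qed
  have R_C: "(\<lambda>z. of_real (R z)) \<in> C_G (sum_gspace I (\<lambda>_. ?L))"
  proof (rule C_G_sum_I[OF L, of _ 1])
    fix i assume i: "i \<in> I"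
    have "continuous_map (space_of ?L) euclidean (\<lambda>\<xi>. \<xi> (om i))"
      by (subst space_of_ultracoproduct, rule continuous_map_from_subtopology[OF continuous_map_alpha_eval[OF om_C[OF i]]])
    then show "continuous_map (space_of ?L) euclidean (\<lambda>\<xi>. of_real (R (i, \<xi>)) :: complex)"
      by (rule continuous_map_eq) (simp add: om_R(1)[OF i])
    show "cmod (of_real (R (i, \<xi>))) \<le> 1" for \<xi>
      using R01[of "(i, \<xi>)"] by simp
  next
    fix i \<xi> assume "i \<notin> I \<or> \<xi> \<notin> points ?L"
    then show "of_real (R (i, \<xi>)) = (0 :: complex)"
      by (auto simp: R_def)
  next
    fix e :: real assume "e > 0"
    then have "e / 2 > 0" by simp
    \<comment> \<open>The neighbourhood of the identity comes from \<open>r\<close> and not from the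
      lifts \<open>Q i\<close>, so it is the same for all \<open>i\<close>.\<close>
    from C_G_D(4)[OF G_space_sum[OF K] r this]
    show "eventually (\<lambda>h. \<forall>i\<in>I. \<forall>\<xi>\<in>points ?L. cmod (of_real (R (i, act ?L h \<xi>)) - of_real (R (i, \<xi>))) \<le> e) (nhds 0)"
    proof eventually_elim
      case (elim h)
      show ?case
      proof (intro ballI)
        fix i \<xi> assume i: "i \<in> I" and \<xi>: "\<xi> \<in> points ?L"
        let ?q = "\<lambda>z. of_real (Q i z) :: complex"
        have tq: "translate ?YJ ?q h \<in> C_G ?YJ"
          by (rule C_G_translate[OF GYJ Q(2)[OF i]])
        \<comment> \<open>At points of the ultracopower the lift \<open>Q i\<close> is
          \<open>r\<close>, so the difference of the translate and the lift is evaluated there by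
          the modulus of \<open>r\<close>.\<close>
        have bd: "cmod (\<zeta> (\<lambda>z. translate ?YJ ?q h z - ?q z)) \<le> e / 2" if \<zeta>: "\<zeta> \<in> points ?K" for \<zeta>
        proof -
          have \<zeta>c: "\<zeta> \<in> characters ?YJ" using \<zeta> by (simp add: points_ultracoproduct)
          have h\<zeta>: "act ?K h \<zeta> \<in> points ?K"
            using act_in_ultracoproduct[OF XJ \<zeta>] by simp
          have "\<zeta> (\<lambda>z. translate ?YJ ?q h z - ?q z) = \<zeta> (translate ?YJ ?q h) - \<zeta> ?q"
            using character_diff(1)[OF GYJ \<zeta>c tq Q(2)[OF i]] by simp
          also have "\<zeta> (translate ?YJ ?q h) = act ?K h \<zeta> ?q"
            using Q(2)[OF i] by (simp add: act_alpha)
          finally show ?thesis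
            using elim i \<zeta> Q(3)[OF i \<zeta>] Q(3)[OF i h\<zeta>] by auto
        qed
        have dC: "(\<lambda>z. translate ?YJ ?q h z - ?q z) \<in> C_G ?YJ"
          using C_G_add[OF GYJ tq C_G_cmult[OF GYJ Q(2)[OF i], of "- 1"]] by simp
        \<comment> \<open>The estimate on the whole fibre descends to almost all factors, with e/2
          enlarged to e; it bounds \<open>W i j h\<close>, and through \<open>om_act\<close> the
          variation of \<open>om i\<close>.\<close>
        have "eventually (\<lambda>j. \<forall>x\<in>points X. cmod (translate ?YJ ?q h (j, x) - ?q (j, x)) \<le> e) \<V>"
        proof (rule ultracoproduct_bound[OF XJ V dC])
          show "cmod (\<zeta> (\<lambda>z. translate ?YJ ?q h z - ?q z)) \<le> e / 2" if "\<zeta> \<in> points ?K" for \<zeta>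
            using that by (rule bd)
          show "e / 2 < e" using \<open>e > 0\<close> by simp
        qed
        then have W_ev: "eventually (\<lambda>j. j \<in> J \<and> W i j h \<le> e) \<V>"
          using evJ
        proof eventually_elim
          case (elim j)
          then show ?case
            using \<open>e > 0\<close> by (auto simp: W_le_iff translate_def cmod_of_real_diff)
        qed
        have tom: "translate ?SJ (om i) h \<in> C_G ?SJ"
          by (rule C_G_translate[OF GSJ om_C[OF i]])
        have h\<xi>: "act ?L h \<xi> \<in> points ?L"
          using act_in_ultracoproduct[OF SJ \<xi>] by simp
        have cl: "closed {z :: complex \<times> complex. cmod (fst z - snd z) \<le> e}"
          by (intro closed_Collect_le continuous_intros)
        from W_ev have ev: "eventually (\<lambda>j. \<forall>s\<in>points ?S. (translate ?SJ (om i) h (j, s), om i (j, s)) \<in> {z. cmod (fst z - snd z) \<le> e}) \<V>"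
        proof eventually_elim
          case (elim j)
          show ?case
          proof
            fix s assume "s \<in> points ?S"
            then show "(translate ?SJ (om i) h (j, s), om i (j, s)) \<in> {z. cmod (fst z - snd z) \<le> e}"
              using elim om_act[OF i, of j s h] pS by (simp add: translate_def)
          qed
        qed
        have "cmod (\<xi> (translate ?SJ (om i) h) - \<xi> (om i)) \<le> e"
          using ultracoproduct_closed_property[OF SJ \<xi> tom om_C[OF i] cl ev] by simp
        moreover have "\<xi> (translate ?SJ (om i) h) = act ?L h \<xi> (om i)"
          using om_C[OF i] by (simp add: act_alpha)
        ultimately show "cmod (of_real (R (i, act ?L h \<xi>)) - of_real (R (i, \<xi>))) \<le> e"
          using om_R(1)[OF i \<xi>] om_R(1)[OF i h\<xi>] by simp
      qed
    qed
  qed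
  \<comment> \<open>Here the Fubini property of the group enters: \<open>p\<close> has one modulus
    for all pairs (i, j), which the family \<open>W\<close> need not have.\<close>
  obtain p where p: "\<And>z. p z \<in> {0..1::real}" "(\<lambda>z. of_real (p z)) \<in> C_G (sum_gspace (I \<times> J) (\<lambda>_. ?S))"
    "\<And>\<Phi>. \<Phi> \<in> points (ultracopower I \<U> ?L) \<Longrightarrow>
      \<Phi> (fubini_pullback I J \<V> ?S (\<lambda>z. of_real (p z))) = \<Phi> (\<lambda>z. of_real (R z))"
    using fubini_pullback_lift[OF S U V inj R_C R01] by blast
  let ?p = "\<lambda>z. of_real (p z) :: complex" and ?P = "fubini_pullback I J \<V> ?S (\<lambda>z. of_real (p z))"
  have P_C: "?P \<in> C_G (sum_gspace I (\<lambda>_. ?L))"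
    by (rule fubini_pullback_C_G[OF S U V p(2)])
  have dC: "(\<lambda>z. ?P z - of_real (R z)) \<in> C_G (sum_gspace I (\<lambda>_. ?L))"
    using C_G_add[OF G_space_sum[OF L] P_C C_G_cmult[OF G_space_sum[OF L] R_C, of "- 1"]] by simp
  have "cmod (\<Phi> (\<lambda>z. ?P z - of_real (R z))) \<le> 0" if \<Phi>: "\<Phi> \<in> points (ultracopower I \<U> ?L)" for \<Phi>
  proof -
    have "\<Phi> \<in> characters (sum_gspace I (\<lambda>_. ?L))" using \<Phi> by (simp add: points_ultracoproduct)
    from character_diff(1)[OF G_space_sum[OF L] this P_C R_C] show ?thesis
      using p(3)[OF \<Phi>] by simp
  qed
  \<comment> \<open>Exact agreement in the double limit becomes an error 1/100 for almost all
    \<open>i\<close> and 1/50 for almost all \<open>j\<close>.\<close>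
  then have "eventually (\<lambda>i. \<forall>\<xi>\<in>points ?L. cmod (?P (i, \<xi>) - of_real (R (i, \<xi>))) \<le> 1/100) \<U>"
    by (rule ultracoproduct_bound[OF L U dC]) simp_all
  with evI have ev: "eventually (\<lambda>i. eventually (\<lambda>j. \<forall>s\<in>points ?S. cmod (?p ((i, j), s) - om i (j, s)) \<le> 1/50) \<V>) \<U>"
  proof eventually_elim
    case (elim i)
    have sl: "slice i ?p \<in> C_G ?SJ"
      by (rule slice_C_G[OF S U V p(2) elim(1)])
    have dC: "(\<lambda>z. slice i ?p z - om i z) \<in> C_G ?SJ"
      using C_G_add[OF GSJ sl C_G_cmult[OF GSJ om_C[OF elim(1)], of "- 1"]] by simp
    have "cmod (\<xi> (\<lambda>z. slice i ?p z - om i z)) \<le> 1/100" if \<xi>: "\<xi> \<in> points ?L" for \<xi>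
    proof -
      have "\<xi> \<in> characters ?SJ" using \<xi> by (simp add: points_ultracoproduct)
      from character_diff(1)[OF GSJ this sl om_C[OF elim(1)]] show ?thesis
        using elim(2) \<xi> om_R(1)[OF elim(1) \<xi>] fubini_pullback_apply[OF elim(1) \<xi>] by auto
    qed
    then have "eventually (\<lambda>j. \<forall>s\<in>points ?S. cmod (slice i ?p (j, s) - om i (j, s)) \<le> 1/50) \<V>"
      by (rule ultracoproduct_bound[OF SJ V dC]) simp_all
    then show ?case
      by simp
  qed
  define \<tau> where "\<tau> = modulus (sum_gspace (I \<times> J) (\<lambda>_. ?S)) p"
  have p01: "\<forall>z\<in>points (sum_gspace (I \<times> J) (\<lambda>_. ?S)). p z \<in> {0..1}"
    using p(1) by blast
  have \<tau>: "\<tau> \<in> SN1"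
    unfolding \<tau>_def by (rule modulus_SN1[OF GSIJ p01 p(2)])
  show thesis
  proof (rule that[OF \<tau>])
    from ev evI show "eventually (\<lambda>ij. \<forall>g. \<forall>x\<in>points X. \<bar>Q (fst ij) (snd ij, act X g x) - Q (fst ij) (snd ij, x)\<bar> \<le> \<tau> g + 1/8) (\<U> \<otimes>\<^sub>F \<V>)"
      unfolding eventually_tensor
    proof eventually_elim
      case (elim i)
      from elim(1) evJ show ?case
      proof eventually_elim
        case (elim j)
        note i = \<open>i \<in> I\<close> and j = \<open>j \<in> J\<close>
        have W_le: "W i j g \<le> \<tau> g + 1/8" for g
        proof -
          define u where "u = alpha_unit ?T"
          have u: "u k \<in> characters ?T" for k
            unfolding u_def by (rule alpha_unit_character[OF G_space_translation_space]) simp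
          have close: "\<bar>p ((i, j), u k) - W i j k\<bar> \<le> 1/50" for k
          proof -
            have "om i (j, u k) = of_real (W i j k)"
              using SN1_C_G[OF W_SN1[OF i j]] by (simp add: om[OF j u]) (simp add: u_def)
            then show ?thesis
              using elim(1) u[of k] pS cmod_of_real_diff[of "p ((i, j), u k)" "W i j k"] by auto
          qed
          \<comment> \<open>Two evaluations of \<open>p\<close>, at \<open>g\<close> and at the
            identity, suffice: \<open>W i j 0 = 0\<close>, so the total error is 2/50, which is
            below 1/8.\<close>
          have "act ?S g (u 0) = u g"
            using act_alpha_unit[OF G_space_translation_space, of 0 g] by (simp add: u_def Samuel_def)
          then have "\<bar>p ((i, j), u g) - p ((i, j), u 0)\<bar> \<le> \<tau> g"
            using le_modulus[OF GSIJ p01, of "((i, j), u 0)" g, folded \<tau>_def] i j u pS by simp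
          then show ?thesis
            using close[of g] close[of 0] SN1_D(1)[OF W_SN1[OF i j]] by linarith
        qed
        show ?case
          using le_modulus[OF X Q01, of _ i j] W_le unfolding W_def by (fastforce intro: order_trans)
      qed
    qed
  qed
qed

text \<open>The contradiction is numerical: the pullback of one function on I \<times> J \<times> X
  has real part at most 1/20 at \<Phi> and at least 1/5 at \<Psi>, although \<open>psi_map\<close>
  identifies the two.\<close>

lemma psi_map_inj_on:
  fixes X :: "('g::{topological_group_add, t2_space}, 'x) gspace"
  assumes X: "G_flow X" and resp: "cofinally_seminorm_respecting X"
    and U: "\<U> \<in> ultrafilters_on I" and V: "\<V> \<in> ultrafilters_on J"
    and inj: "inj_on (psi_map (Samuel :: ('g, ('g \<Rightarrow> complex) \<Rightarrow> complex) gspace) I J \<V>)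
      (points (ultracopower I \<U> (ultracopower J \<V> Samuel)))"
  shows "inj_on (psi_map X I J \<V>) (points (ultracopower I \<U> (ultracopower J \<V> X)))"
proof (rule inj_onI, rule ccontr)
  let ?K = "ultracopower J \<V> X"
  let ?YI = "sum_gspace I (\<lambda>_. ?K)" and ?YJ = "sum_gspace J (\<lambda>_. X)" and ?YIJ = "sum_gspace (I \<times> J) (\<lambda>_. X)"
  have GX: "G_space X" using X by (simp add: G_flow_def)
  have XJ: "\<forall>j\<in>J. G_space X" and XIJ: "\<forall>j\<in>I \<times> J. G_space X" using GX by auto
  have K: "\<forall>i\<in>I. G_space ?K"
    using G_flow_ultracoproduct[OF XJ V] by (auto simp: G_flow_def)
  note GYJ = G_space_sum[OF XJ] and GYI = G_space_sum[OF K]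
  fix \<Phi> \<Psi> assume \<Phi>: "\<Phi> \<in> points (ultracopower I \<U> ?K)" and \<Psi>: "\<Psi> \<in> points (ultracopower I \<U> ?K)"
    and eq: "psi_map X I J \<V> \<Phi> = psi_map X I J \<V> \<Psi>" and neq: "\<Phi> \<noteq> \<Psi>"
  have \<Phi>c: "\<Phi> \<in> characters ?YI" and \<Psi>c: "\<Psi> \<in> characters ?YI"
    using \<Phi> \<Psi> by (simp_all add: points_ultracoproduct)
  obtain q where q: "q \<in> C_G ?YI" "\<Phi> q \<noteq> \<Psi> q"
  proof -
    have "\<Phi> \<in> extensional (C_G ?YI)" "\<Psi> \<in> extensional (C_G ?YI)"
      using \<Phi>c \<Psi>c by (simp_all add: characters_def)
    then show thesis
      using neq that extensionalityI by blast
  qed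
  define D where "D = cmod (\<Psi> q - \<Phi> q)"
  have D: "D > 0" using q by (simp add: D_def)
  \<comment> \<open>The distance to \<open>\<Phi> q\<close>, scaled and truncated so that \<Phi>
    receives 0 and \<Psi> receives 1.\<close>
  define f where "f = (\<lambda>w. min 1 (cmod (w - \<Phi> q) / D))"
  have f: "continuous_on UNIV (\<lambda>w. of_real (f w) :: complex)"
    unfolding f_def by (intro continuous_intros) (use D in auto)
  define r where "r = on_points ?YI (\<lambda>z. f (q z))"
  have r_eq: "(\<lambda>z. of_real (r z) :: complex) = on_points ?YI (\<lambda>z. of_real (f (q z)))"
    by (auto simp: r_def on_points_def)
  have r_C: "(\<lambda>z. of_real (r z)) \<in> C_G ?YI"
    unfolding r_eq by (rule C_G_comp[OF GYI f q(1)])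
  have f01: "f w \<in> {0..1}" for w
    using D by (simp add: f_def)
  have r01: "r z \<in> {0..1}" for z
    using f01 by (simp add: r_def on_points_def)
  have \<Phi>r: "\<Phi> (\<lambda>z. of_real (r z)) = 0"
    unfolding r_eq character_comp[OF GYI \<Phi>c q(1) f] by (simp add: f_def)
  have \<Psi>r: "\<Psi> (\<lambda>z. of_real (r z)) = 1"
    unfolding r_eq character_comp[OF GYI \<Psi>c q(1) f] using D by (simp add: f_def D_def)
  \<comment> \<open>Tietze extension is applied for each \<open>i\<close> separately, without
    control that is uniform in \<open>i\<close>.\<close>
  have "\<exists>Q. (\<forall>z. Q z \<in> {0..1::real}) \<and> (i \<in> I \<longrightarrow> (\<lambda>z. of_real (Q z)) \<in> C_G ?YJ \<and>
      (\<forall>\<xi>\<in>points ?K. \<xi> (\<lambda>z. of_real (Q z)) = of_real (r (i, \<xi>))))" for i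
  proof (cases "i \<in> I")
    case True
    have "continuous_map (space_of ?K) euclidean (\<lambda>\<xi>. of_real (r (i, \<xi>)) :: complex)"
      using C_G_D(1)[OF bspec[OF K True] C_G_sum_slice[OF K r_C True]] .
    then have "continuous_map (space_of ?K) euclidean (\<lambda>\<xi>. Re (of_real (r (i, \<xi>))))"
      by (rule continuous_map_euclidean_comp[rotated]) (intro continuous_intros)
    then have c: "continuous_map (subtopology (space_of (alpha ?YJ)) (points ?K)) euclideanreal (\<lambda>\<xi>. r (i, \<xi>))"
      by (simp only: space_of_ultracoproduct[symmetric] Re_complex_of_real)
    have "(\<lambda>\<xi>. r (i, \<xi>)) ` points ?K \<subseteq> {0..1}"
      using r01 by blast
    from Tietze_alpha[OF GYJ closedin_ultracoproduct[OF XJ V] c this] show ?thesis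
      by metis
  next
    case False
    then show ?thesis by (intro exI[of _ "\<lambda>_. 0"]) simp
  qed
  then obtain Q where Q: "\<And>i z. Q i z \<in> {0..1::real}"
      "\<And>i. i \<in> I \<Longrightarrow> (\<lambda>z. of_real (Q i z)) \<in> C_G ?YJ"
      "\<And>i \<xi>. i \<in> I \<Longrightarrow> \<xi> \<in> points ?K \<Longrightarrow> \<xi> (\<lambda>z. of_real (Q i z)) = of_real (r (i, \<xi>))"
    by metis
  obtain \<tau>0 where \<tau>0: "\<tau>0 \<in> SN1"
    "eventually (\<lambda>ij. \<forall>g. \<forall>x\<in>points X. \<bar>Q (fst ij) (snd ij, act X g x) - Q (fst ij) (snd ij, x)\<bar> \<le> \<tau>0 g + 1/8) (\<U> \<otimes>\<^sub>F \<V>)"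
    by (rule fubini_group_dominates[OF GX U V inj r_C Q])
  \<comment> \<open>Cofinality replaces the dominating semi-norm by a larger one for which the two
    distances agree; the bound on the lifts persists.\<close>
  obtain \<tau> where \<tau>: "\<tau> \<in> SN1" "\<And>g. \<tau>0 g \<le> \<tau> g"
    and rho: "\<And>x y. x \<in> points X \<Longrightarrow> y \<in> points X \<Longrightarrow> rho_dist X \<tau> x y = partial_dist X \<tau> x y"
    using resp \<tau>0(1) unfolding cofinally_seminorm_respecting_def by (metis subsetD)
  define Gd where "Gd = {ij \<in> I \<times> J. \<forall>g. \<forall>x\<in>points X. \<bar>Q (fst ij) (snd ij, act X g x) - Q (fst ij) (snd ij, x)\<bar> \<le> \<tau> g + 1/8}"
  have "eventually (\<lambda>ij. ij \<in> I \<times> J) (\<U> \<otimes>\<^sub>F \<V>)"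
    using tensor_ultrafilter[OF U V] by (simp add: ultrafilters_on_def)
  with \<tau>0(2) have evGd: "eventually (\<lambda>ij. ij \<in> Gd) (\<U> \<otimes>\<^sub>F \<V>)"
  proof eventually_elim
    case (elim ij)
    have "\<bar>Q (fst ij) (snd ij, act X g x) - Q (fst ij) (snd ij, x)\<bar> \<le> \<tau> g + 1/8" if "x \<in> points X" for g x
      using elim(1)[rule_format, OF that, of g] \<tau>(2)[of g] by linarith
    then show ?case using elim(2) by (simp add: Gd_def)
  qed
  have "\<exists>h. h \<in> Lipschitz_functions X \<tau> \<and> (\<forall>x\<in>points X. Q (fst ij) (snd ij, x) \<le> 1/4 \<longrightarrow> h x \<le> 1/20) \<and>
      (\<forall>x\<in>points X. 3/4 \<le> Q (fst ij) (snd ij, x) \<longrightarrow> 1/5 \<le> h x)" if ij: "ij \<in> Gd" for ij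
  proof -
    have i: "fst ij \<in> I" and j: "snd ij \<in> J"
      and lip: "\<And>g x. x \<in> points X \<Longrightarrow> \<bar>Q (fst ij) (snd ij, act X g x) - Q (fst ij) (snd ij, x)\<bar> \<le> \<tau> g + 1/8"
      using ij by (auto simp: Gd_def)
    have "continuous_map (space_of X) euclidean (\<lambda>x. of_real (Q (fst ij) (snd ij, x)) :: complex)"
      using C_G_D(1)[OF GX C_G_sum_slice[OF XJ Q(2)[OF i] j]] .
    then have "continuous_map (space_of X) euclidean (\<lambda>x. Re (of_real (Q (fst ij) (snd ij, x))))"
      by (rule continuous_map_euclidean_comp[rotated]) (intro continuous_intros)
    then have "continuous_map (space_of X) euclideanreal (\<lambda>x. Q (fst ij) (snd ij, x))"
      by (simp only: Re_complex_of_real)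
    from Lipschitz_separation[OF X \<tau>(1) rho this lip] show ?thesis
      by metis
  qed
  then obtain h where h: "\<And>ij. ij \<in> Gd \<Longrightarrow> h ij \<in> Lipschitz_functions X \<tau>"
    and h_low: "\<And>ij x. ij \<in> Gd \<Longrightarrow> x \<in> points X \<Longrightarrow> Q (fst ij) (snd ij, x) \<le> 1/4 \<Longrightarrow> h ij x \<le> 1/20"
    and h_high: "\<And>ij x. ij \<in> Gd \<Longrightarrow> x \<in> points X \<Longrightarrow> 3/4 \<le> Q (fst ij) (snd ij, x) \<Longrightarrow> 1/5 \<le> h ij x"
    by metis
  \<comment> \<open>Indices outside \<open>Gd\<close> form a null set, and the value 0 there
    respects every Lipschitz bound.\<close>
  define p where "p = (\<lambda>(ij, x). if ij \<in> Gd \<and> x \<in> points X then of_real (h ij x) else (0 :: complex))"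
  have h01: "h ij x \<in> {0..1}" if "ij \<in> Gd" "x \<in> points X" for ij x
    using h[OF that(1)] that(2) by (simp add: Lipschitz_functions_def)
  have p_C: "p \<in> C_G ?YIJ"
  proof (rule C_G_sum_I[OF XIJ, of _ 1])
    fix ij assume "ij \<in> I \<times> J"
    show "continuous_map (space_of X) euclidean (\<lambda>x. p (ij, x))"
    proof (cases "ij \<in> Gd")
      case True
      have "continuous_map (space_of X) euclideanreal (h ij)"
        using h[OF True] by (simp add: Lipschitz_functions_def)
      then have "continuous_map (space_of X) euclidean (\<lambda>x. of_real (h ij x) :: complex)"
        by (rule continuous_map_euclidean_comp[rotated]) (intro continuous_intros)
      then show ?thesis
        by (rule continuous_map_eq) (simp add: p_def True)
    qed (simp add: p_def)
    show "cmod (p (ij, x)) \<le> 1" if "x \<in> points X" for x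
      using h01[of ij x] that by (simp add: p_def)
  next
    fix ij x assume "ij \<notin> I \<times> J \<or> x \<notin> points X"
    then show "p (ij, x) = 0"
      by (auto simp: p_def Gd_def)
  next
    fix e :: real assume "e > 0"
    \<comment> \<open>All \<open>h ij\<close> are Lipschitz for the same \<tau>, so \<tau> itself is
      the common modulus that the lifts lacked.\<close>
    from SN1_small[OF \<tau>(1) this]
    show "eventually (\<lambda>g. \<forall>ij\<in>I \<times> J. \<forall>x\<in>points X. cmod (p (ij, act X g x) - p (ij, x)) \<le> e) (nhds 0)"
    proof eventually_elim
      case (elim g)
      show ?case
      proof (intro ballI)
        fix ij x assume "x \<in> points X"
        show "cmod (p (ij, act X g x) - p (ij, x)) \<le> e"
        proof (cases "ij \<in> Gd")
          case True
          then have "\<bar>h ij (act X g x) - h ij x\<bar> \<le> \<tau> g"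
            using h[OF True] \<open>x \<in> points X\<close> by (simp add: Lipschitz_functions_def)
          then show ?thesis
            using True elim \<open>x \<in> points X\<close> GX by (simp add: p_def cmod_of_real_diff)
        qed (use \<open>e > 0\<close> in \<open>simp add: p_def\<close>)
      qed
    qed
  qed
  let ?P = "fubini_pullback I J \<V> X p"
  have P_C: "?P \<in> C_G ?YI"
    by (rule fubini_pullback_C_G[OF GX U V p_C])
  \<comment> \<open>Here \<open>p\<close> lives on I \<times> J \<times> X, but \<open>r\<close>
    only on I \<times> \<Sigma>, and it is lifted slice by slice. So the two levels of transfer are
    carried out by hand, with \<open>Q i\<close> linking them.\<close>
  have transfer: "(\<Omega> ?P, \<Omega> (\<lambda>z. of_real (r z))) \<in> S"
    if \<Omega>: "\<Omega> \<in> points (ultracopower I \<U> ?K)" and S: "closed S"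
      and pS: "\<And>ij x. ij \<in> Gd \<Longrightarrow> x \<in> points X \<Longrightarrow> (of_real (h ij x), of_real (Q (fst ij) (snd ij, x))) \<in> S"
    for \<Omega> and S :: "(complex \<times> complex) set"
  proof (rule ultracoproduct_closed_property[OF K \<Omega> P_C r_C S])
    have "eventually (\<lambda>i. i \<in> I) \<U>"
      using U by (simp add: ultrafilters_on_def)
    with evGd[unfolded eventually_tensor]
    show "eventually (\<lambda>i. \<forall>\<xi>\<in>points ?K. (?P (i, \<xi>), of_real (r (i, \<xi>))) \<in> S) \<U>"
    proof eventually_elim
      case (elim i)
      show ?case
      proof
        fix \<xi> assume \<xi>: "\<xi> \<in> points ?K"
        from elim(1) have "eventually (\<lambda>j. \<forall>x\<in>points X. (slice i p (j, x), of_real (Q i (j, x))) \<in> S) \<V>"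
          by eventually_elim (use pS in \<open>force simp: p_def\<close>)
        from ultracoproduct_closed_property[OF XJ \<xi> slice_C_G[OF GX U V p_C elim(2)] Q(2)[OF elim(2)] S this]
        show "(?P (i, \<xi>), of_real (r (i, \<xi>))) \<in> S"
          unfolding fubini_pullback_apply[OF elim(2) \<xi>] Q(3)[OF elim(2) \<xi>] .
      qed
    qed
  qed
  \<comment> \<open>An implication is not a closed condition, so the bound for small lifts is
    replaced by an affine inequality: where the lift exceeds 1/4, four times its value exceeds 1 and
    the inequality is automatic.\<close>
  have "(\<Phi> ?P, \<Phi> (\<lambda>z. of_real (r z))) \<in> {z. Re (fst z) \<le> 1/20 + 4 * Re (snd z)}"
  proof (rule transfer[OF \<Phi>])
    show "closed {z :: complex \<times> complex. Re (fst z) \<le> 1/20 + 4 * Re (snd z)}"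
      by (intro closed_Collect_le continuous_intros)
    fix ij x assume ij: "ij \<in> Gd" and x: "x \<in> points X"
    show "(of_real (h ij x), of_real (Q (fst ij) (snd ij, x))) \<in> {z :: complex \<times> complex. Re (fst z) \<le> 1/20 + 4 * Re (snd z)}"
      using h_low[OF ij x] h01[OF ij x] Q(1)[of "fst ij" "(snd ij, x)"]
      by (cases "Q (fst ij) (snd ij, x) \<le> 1/4") auto
  qed
  then have low: "Re (\<Phi> ?P) \<le> 1/20"
    by (simp add: \<Phi>r)
  \<comment> \<open>The mirror image: where the lift is below 3/4, the subtracted term exceeds 1 and
    the left side is negative.\<close>
  have "(\<Psi> ?P, \<Psi> (\<lambda>z. of_real (r z))) \<in> {z. 1/5 - 4 * (1 - Re (snd z)) \<le> Re (fst z)}"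
  proof (rule transfer[OF \<Psi>])
    show "closed {z :: complex \<times> complex. 1/5 - 4 * (1 - Re (snd z)) \<le> Re (fst z)}"
      by (intro closed_Collect_le continuous_intros)
    fix ij x assume ij: "ij \<in> Gd" and x: "x \<in> points X"
    show "(of_real (h ij x), of_real (Q (fst ij) (snd ij, x))) \<in> {z :: complex \<times> complex. 1/5 - 4 * (1 - Re (snd z)) \<le> Re (fst z)}"
      using h_high[OF ij x] h01[OF ij x] Q(1)[of "fst ij" "(snd ij, x)"]
      by (cases "3/4 \<le> Q (fst ij) (snd ij, x)") auto
  qed
  then have high: "1/5 \<le> Re (\<Psi> ?P)"
    by (simp add: \<Psi>r)
  \<comment> \<open>Evaluating the common image at \<open>p\<close> is evaluating the two characters
    at the pullback of \<open>p\<close>.\<close>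
  have "\<Phi> ?P = \<Psi> ?P"
    using fun_cong[OF eq, of p] p_C by (simp add: psi_map_def[OF GX U V])
  then show False using low high by simp
qed

theorem theorem6p17:
  fixes X :: "('g::{topological_group_add, t2_space}, 'x) gspace"
  assumes "fubini_group TYPE('i) TYPE('g)"
    and "G_flow X"
    and "cofinally_seminorm_respecting X"
  shows "fubini_flow TYPE('i) X"
  unfolding fubini_flow_def
proof (intro allI impI ballI)
  fix I J :: "'i set" and \<U> \<V>
  assume inf: "infinite I" "infinite J" and U: "\<U> \<in> ultrafilters_on I" and V: "\<V> \<in> ultrafilters_on J"
  have X: "G_space X" using assms(2) by (simp add: G_flow_def)
  have "inj_on (psi_map (Samuel :: ('g, ('g \<Rightarrow> complex) \<Rightarrow> complex) gspace) I J \<V>)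
      (points (ultracopower I \<U> (ultracopower J \<V> Samuel)))"
    using assms(1) inf U V unfolding fubini_group_def fubini_flow_def canonical_factor_map_isomorphism_iff[OF G_space_Samuel U V, symmetric]
    by blast
  from psi_map_inj_on[OF assms(2,3) U V this]
  show "flow_isomorphism (ultracopower I \<U> (ultracopower J \<V> X))
      (ultracopower (I \<times> J) (\<U> \<otimes>\<^sub>F \<V>) X) (canonical_factor_map I \<U> J \<V> X)"
    by (simp add: canonical_factor_map_isomorphism_iff[OF X U V])
qed
end
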